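(* Let $\Theta$ satisfy the hypothesis recalled in the context, and let $0\le r<T$. For all $\gamma\in\Theta^r_T$ and $y\in\mathbb R^n$ there is a unique solution, denoted $Q^\gamma_{r,y}$, to the martingale problem $Z^\gamma$ on $(\Omega^r,\mathcal B^r_T)$ starting from $y$ at time $r$. Consider a representation of $\gamma$ with subdivision $r=s_0<\dots<s_N=T$, partitions $(A_{i,j})_{j\in I_i}$ and parameters $\theta_{i,j}$. For $r\le s<T$ let $i$ be such that $s_i\le s<s_{i+1}$. For every bounded $\mathcal B^r_{s_{i+1}}$-measurable $\psi$ on $\Omega^r$, the map $$T^\gamma_s(\psi)=\sum_{j\in I_i}1_{A_{i,j}}T^{\theta_{i,j}}_s(\psi)$$ is $\mathcal B^r_s$-measurable. The map $T^\gamma_s$ admits a unique extension to all bounded $\mathcal B^r_T$-measurable functions such that the chain rule $$\forall\, r\le s\le t\le T,\qquad T^\gamma_s(\psi)=T^\gamma_s\big(T^\gamma_t(\psi)\big)$$ is satisfied. Moreover, for every bounded $\mathcal B^r_T$-measurable $\psi$, $T^\gamma_s(\psi)$ is a $\mathcal B^r_s$-measurable version of the $Q^\gamma_{r,y}$-conditional expectation of $\psi$ given $\mathcal B^r_s$.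
   Context: Fix $n\ge1$ and a finite horizon $T>0$. For $0\le r\le t\le T$, $\Omega^r_t$ denotes either (for all $r,t$) the space $C([r,t],\mathbb R^n)$ of continuous paths with the topology of uniform convergence, or (for all $r,t$) the space $D([r,t],\mathbb R^n)$ of càdlàg paths with the Skorokhod topology; $\Omega^r=\Omega^r_T$; $X_u(\omega)=\omega(u)$; $\mathcal B^r_t$ is the $\sigma$-algebra generated by $X_u$, $r\le u\le t$. Functions of the path on a smaller interval are regarded as functions on larger path spaces through restriction of paths. A martingale problem is a family $Z=(Z^k)_{k\in I}$ of real processes $Z^k=(Z^k_{r,t})_{0\le r\le t\le T}$ on path space. It is additive if $Z^k_{r,s}$ is $\mathcal B^r_s$-measurable, right continuous in $s$, and $Z^k_{r,t}=Z^k_{r,s}+Z^k_{s,t}$ for $r\le s\le t$; it is bounded if every $Z^k_{r,t}$ is bounded. A probability measure $Q$ on $(\Omega^r_t,\mathcal B^r_t)$ is a solution to $Z$ starting from $y$ at time $r$ if $Q(X_r=y)=1$ and for every $k$, $(Z^k_{r,u})_{r\le u\le t}$ is a $Q$-martingale for $(\mathcal B^r_u)_u$. Hypothesis on $\Theta$: $\Theta$ is a set of Borel maps on $\mathbb R_+\times\mathbb R^n$ with values in a topological space $E$; to each $\theta\in\Theta$ is associated an additive bounded martingale problem $Z^\theta=(Z^{\theta,k})_{k\in I}$ (same index set $I$ for all $\theta$) such that (1) for all $\theta\in\Theta$, $0\le r<t\le T$, $y\in\mathbb R^n$ there is a unique solution $Q^\theta_{r,y}$ on $(\Omega^r_t,\mathcal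 B^r_t)$ to $Z^\theta$ starting from $y$ at time $r$; (2) for all $\theta\in\Theta$ and $r<T$, $y\mapsto Q^\theta_{r,y}$ is weakly continuous. $\Theta^r_T$ is the set of $E$-valued processes $\gamma$ on $\Omega^r$ for which there are a finite subdivision $r=s_0<s_1<\dots<s_N=T$, finite sets $I_i$ ($0\le i\le N-1$) with $I_0=\{1\}$, finite partitions $(A_{i,j})_{j\in I_i}$ of $\Omega^r$ into $\mathcal B^r_{s_i}$-measurable sets, and $\theta_{i,j}\in\Theta$ such that $\gamma(u,\omega)=\sum_{j\in I_i}\theta_{i,j}(u,X_u(\omega))1_{A_{i,j}}(\omega)$ for $s_i\le u<s_{i+1}$. For such $\gamma$, $Z^\gamma$ is the additive family ($Z^{\gamma,k}_{r,v}=Z^{\gamma,k}_{r,u}+Z^{\gamma,k}_{u,v}$ for $r\le u\le v\le T$) determined by $Z^{\gamma,k}_{s_i,u}(\omega)=\sum_{j\in I_i}Z^{\theta_{i,j},k}_{s_i,u}(\omega)1_{A_{i,j}}(\omega)$ for $s_i\le u\le s_{i+1}$. A probability measure $Q$ on $(\Omega^r,\mathcal B^r_T)$ is a solution to $Z^\gamma$ starting from $y$ at time $r$ if $Q(X_r=y)=1$ and for every $k\in I$, $(Z^{\gamma,k}_{r,u})_{r\le u\le T}$ is a $Q$-martingale for $(\mathcal B^r_u)_{r\le u\le T}$. For $\theta\in\Theta$, $s<T$, $\psi$ bounded $\mathcal B^r_T$-measurable, $T^\theta_s(\psi)(\omega)=\int_{\Omega^s_T}\psi(i(\omega_{|[r,s]},\omega'))\,dQ^\theta_{s,X_s(\omega)}(\omega')$,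 where $i(\omega,\omega')(u)=\omega(u)$ for $r\le u\le s$ and $i(\omega,\omega')(u)=\omega'(u)+\omega(s)-\omega'(s)$ for $s\le u\le T$. Convention: $T^\gamma_T(\psi)=\psi$.
   Formalization: Added hypothesis: for each θ and r<t, some countable subset of I has the same solutions as I on [r,t] from every starting point (automatic if I is countable); for uncountable I without it, uniqueness of the solution to Z^γ can fail. *)

theory Defs
  imports "HOL-Probability.Probability"
begin

section \<open>Path spaces\<close>

text \<open>A path on \<open>[r,t]\<close> is a function that is \<^const>\<open>extensional\<close> on \<open>{r..t}\<close>, so that the
  restriction of paths to \<open>{u..v}\<close> is \<open>\<lambda>\<omega>. restrict \<omega> {u..v}\<close>.\<close>

type_synonym 'n path = "real \<Rightarrow> real ^ 'n"

datatype path_kind = Continuous_Paths | Cadlag_Paths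

text \<open>At the end points the filters below degenerate to \<^const>\<open>bot\<close> or to a trivial condition:
  nothing is required from the left at \<open>r\<close> nor from the right at \<open>t\<close>.\<close>

definition cadlag_on :: "real \<Rightarrow> real \<Rightarrow> 'n::finite path \<Rightarrow> bool" where
  "cadlag_on r t \<omega> \<longleftrightarrow>
     (\<forall>u\<in>{r..t}. (\<omega> \<longlongrightarrow> \<omega> u) (at u within {u<..t}) \<and> (\<exists>l. (\<omega> \<longlongrightarrow> l) (at u within {r..<u})))"

definition path_space :: "path_kind \<Rightarrow> real \<Rightarrow> real \<Rightarrow> 'n::finite path set" where
  "path_space \<kappa> r t = {\<omega> \<in> extensional {r..t}.
     case \<kappa> of Continuous_Paths \<Rightarrow> continuous_on {r..t} \<omega> | Cadlag_Paths \<Rightarrow> cadlag_on r t \<omega>}"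

text \<open>The Skorokhod J1 topology is given by Billingsley's metric: an increasing bijection of
  \<open>[r,t]\<close> is automatically a homeomorphism.\<close>

definition time_changes :: "real \<Rightarrow> real \<Rightarrow> (real \<Rightarrow> real) set" where
  "time_changes r t = {\<tau>. strict_mono_on {r..t} \<tau> \<and> \<tau> ` {r..t} = {r..t}}"

definition skorokhod_bounds :: "real \<Rightarrow> real \<Rightarrow> 'n::finite path \<Rightarrow> 'n path \<Rightarrow> real set" where
  "skorokhod_bounds r t \<omega> \<omega>' = {e. 0 \<le> e \<and>
     (\<exists>\<tau>\<in>time_changes r t. \<forall>u\<in>{r..t}. \<bar>\<tau> u - u\<bar> \<le> e \<and> dist (\<omega> u) (\<omega>' (\<tau> u)) \<le> e)}"

definition skorokhod_dist :: "real \<Rightarrow> real \<Rightarrow> 'n::finite path \<Rightarrow> 'n path \<Rightarrow> real" where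
  "skorokhod_dist r t \<omega> \<omega>' =
     (if \<omega> \<in> path_space Cadlag_Paths r t \<and> \<omega>' \<in> path_space Cadlag_Paths r t
      then Inf (skorokhod_bounds r t \<omega> \<omega>') else 0)"

definition path_topology :: "path_kind \<Rightarrow> real \<Rightarrow> real \<Rightarrow> 'n::finite path topology" where
  "path_topology \<kappa> r t = (case \<kappa> of
     Continuous_Paths \<Rightarrow> mtopology_of (cfunspace (top_of_set {r..t}) euclidean_metric)
   | Cadlag_Paths \<Rightarrow> Metric_space.mtopology (path_space Cadlag_Paths r t) (skorokhod_dist r t))"

text \<open>The \<open>\<sigma>\<close>-algebra on the paths on \<open>[r,t]\<close> that is generated by the coordinates \<open>X\<^sub>v\<close> with
  \<open>r \<le> v \<le> u\<close>; for \<open>u = t\<close> it is the full \<open>\<sigma>\<close>-algebra.\<close>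

definition path_sigma :: "path_kind \<Rightarrow> real \<Rightarrow> real \<Rightarrow> real \<Rightarrow> 'n::finite path measure" where
  "path_sigma \<kappa> r t u = sigma (path_space \<kappa> r t)
     {(\<lambda>\<omega>. \<omega> v) -` A \<inter> path_space \<kappa> r t | v A. v \<in> {r..u} \<and> A \<in> sets borel}"

definition bounded_path_functions ::
  "path_kind \<Rightarrow> real \<Rightarrow> real \<Rightarrow> real \<Rightarrow> ('n::finite path \<Rightarrow> real) set" where
  "bounded_path_functions \<kappa> r t u = {\<psi> \<in> extensional (path_space \<kappa> r t).
     \<psi> \<in> borel_measurable (path_sigma \<kappa> r t u) \<and> (\<exists>C. \<forall>\<omega>\<in>path_space \<kappa> r t. \<bar>\<psi> \<omega>\<bar> \<le> C)}"


section \<open>Martingale problems\<close>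

definition martingale_on ::
  "'a measure \<Rightarrow> (real \<Rightarrow> 'a measure) \<Rightarrow> real \<Rightarrow> real \<Rightarrow> (real \<Rightarrow> 'a \<Rightarrow> real) \<Rightarrow> bool" where
  "martingale_on M F r t X \<longleftrightarrow>
     (\<forall>u\<in>{r..t}. subalgebra M (F u) \<and> X u \<in> borel_measurable (F u) \<and> integrable M (X u)) \<and>
     (\<forall>u v. r \<le> u \<and> u \<le> v \<and> v \<le> t \<longrightarrow> (AE \<omega> in M. real_cond_exp M (F u) (X v) \<omega> = X u \<omega>))"

text \<open>Here \<open>X k u\<close> is the process with index \<open>k\<close> at time \<open>u\<close>, for a fixed initial time \<open>r\<close>.\<close>

definition mp_solution ::
  "path_kind \<Rightarrow> real \<Rightarrow> real \<Rightarrow> 'k set \<Rightarrow> ('k \<Rightarrow> real \<Rightarrow> 'n::finite path \<Rightarrow> real) \<Rightarrow> real ^ 'n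
    \<Rightarrow> 'n path measure \<Rightarrow> bool" where
  "mp_solution \<kappa> r t I X y Q \<longleftrightarrow>
     prob_space Q \<and> space Q = path_space \<kappa> r t \<and> sets Q = sets (path_sigma \<kappa> r t t) \<and>
     measure Q {\<omega> \<in> space Q. \<omega> r = y} = 1 \<and>
     (\<forall>k\<in>I. martingale_on Q (path_sigma \<kappa> r t) r t (X k))"

definition mp_law ::
  "path_kind \<Rightarrow> real \<Rightarrow> real \<Rightarrow> 'k set \<Rightarrow> ('k \<Rightarrow> real \<Rightarrow> 'n::finite path \<Rightarrow> real) \<Rightarrow> real ^ 'n
    \<Rightarrow> 'n path measure" where
  "mp_law \<kappa> r t I X y = (THE Q. mp_solution \<kappa> r t I X y Q)"

text \<open>In a martingale problem \<open>Z\<close>, the variable \<open>Z k r s\<close> is a function on the paths on \<open>[r,s]\<close>. It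
  is evaluated on longer paths through restriction.\<close>

type_synonym ('k, 'n) mp = "'k \<Rightarrow> real \<Rightarrow> real \<Rightarrow> 'n path \<Rightarrow> real"

definition on_path :: "('k, 'n::finite) mp \<Rightarrow> ('k, 'n) mp" where
  "on_path Z k r s \<omega> = Z k r s (restrict \<omega> {r..s})"

definition additive_mp :: "path_kind \<Rightarrow> real \<Rightarrow> 'k set \<Rightarrow> ('k, 'n::finite) mp \<Rightarrow> bool" where
  "additive_mp \<kappa> T I Z \<longleftrightarrow> (\<forall>k\<in>I.
     (\<forall>r s. 0 \<le> r \<and> r \<le> s \<and> s \<le> T \<longrightarrow> Z k r s \<in> borel_measurable (path_sigma \<kappa> r s s)) \<and>
     (\<forall>r s. \<forall>\<omega>\<in>path_space \<kappa> r T. 0 \<le> r \<and> r \<le> s \<and> s < T \<longrightarrow>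
        ((\<lambda>u. on_path Z k r u \<omega>) \<longlongrightarrow> on_path Z k r s \<omega>) (at_right s)) \<and>
     (\<forall>r s t. \<forall>\<omega>\<in>path_space \<kappa> r t. 0 \<le> r \<and> r \<le> s \<and> s \<le> t \<and> t \<le> T \<longrightarrow>
        Z k r t \<omega> = on_path Z k r s \<omega> + on_path Z k s t \<omega>))"

definition bounded_mp :: "path_kind \<Rightarrow> real \<Rightarrow> 'k set \<Rightarrow> ('k, 'n::finite) mp \<Rightarrow> bool" where
  "bounded_mp \<kappa> T I Z \<longleftrightarrow> (\<forall>k\<in>I. \<forall>r t. 0 \<le> r \<and> r \<le> t \<and> t \<le> T \<longrightarrow>
     (\<exists>C. \<forall>\<omega>\<in>path_space \<kappa> r t. \<bar>Z k r t \<omega>\<bar> \<le> C))"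

definition weakly_continuous ::
  "path_kind \<Rightarrow> real \<Rightarrow> real \<Rightarrow> (real ^ 'n::finite \<Rightarrow> 'n path measure) \<Rightarrow> bool" where
  "weakly_continuous \<kappa> r t Q \<longleftrightarrow>
     (\<forall>f. continuous_map (path_topology \<kappa> r t) euclideanreal f \<and>
          (\<exists>C. \<forall>\<omega>\<in>path_space \<kappa> r t. \<bar>f \<omega>\<bar> \<le> C) \<longrightarrow>
          continuous_on UNIV (\<lambda>y. \<integral>\<omega>. f \<omega> \<partial>Q y))"

type_synonym ('n, 'e) control = "real \<times> (real ^ 'n) \<Rightarrow> 'e"

definition borel_controls :: "('n::finite, 'e::topological_space) control set" where
  "borel_controls = {\<theta> \<in> extensional ({0..} \<times> UNIV).
     \<theta> \<in> borel_measurable (restrict_space borel ({0..} \<times> UNIV))}"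

definition theta_hypothesis ::
  "path_kind \<Rightarrow> real \<Rightarrow> ('n::finite, 'e::topological_space) control set \<Rightarrow> 'k set
    \<Rightarrow> (('n, 'e) control \<Rightarrow> ('k, 'n) mp) \<Rightarrow> bool" where
  "theta_hypothesis \<kappa> T \<Theta> I Z \<longleftrightarrow>
     \<Theta> \<subseteq> borel_controls \<and>
     (\<forall>\<theta>\<in>\<Theta>. additive_mp \<kappa> T I (Z \<theta>) \<and> bounded_mp \<kappa> T I (Z \<theta>)) \<and>
     (\<forall>\<theta>\<in>\<Theta>. \<forall>r t y. 0 \<le> r \<and> r < t \<and> t \<le> T \<longrightarrow>
        (\<exists>!Q. mp_solution \<kappa> r t I (\<lambda>k. on_path (Z \<theta>) k r) y Q)) \<and>
     (\<forall>\<theta>\<in>\<Theta>. \<forall>r. 0 \<le> r \<and> r < T \<longrightarrow>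
        weakly_continuous \<kappa> r T (mp_law \<kappa> r T I (\<lambda>k. on_path (Z \<theta>) k r)))"

text \<open>For a countable index set the next condition is automatic (see \<open>countable_imp_countably_determined\<close>).
  It cannot be dropped for uncountable index sets: uniqueness of the solutions from every point
  does not give uniqueness from a diffuse initial law, since a martingale property that fails on
  a null set of initial points for each index may fail for some index at every initial point.
  Example: \<open>n = 2\<close>, continuous paths. Let countably many indices force \<open>X\<^sup>1\<close> to be constant and
  \<open>X\<^sup>2\<close> to solve \<open>x' = 2 * sqrt \<bar>x\<bar>\<close>, and let the indices \<open>a \<in> \<real>\<close> carry
  the process \<open>\<integral>\<^bsub>r\<^esub>\<^bsup>t\<^esup> 1{X\<^sup>1 = a, X\<^sup>2 = 0} du\<close>. The solution from each point is the maximal one.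
  If \<open>X\<^sup>1\<close> is first run as a Brownian motion with \<open>X\<^sup>2 = 0\<close>, then after switching to this
  problem \<open>X\<^sup>2\<close> may also stay at 0.\<close>

definition countably_determined ::
  "path_kind \<Rightarrow> real \<Rightarrow> 'k set \<Rightarrow> ('k, 'n::finite) mp \<Rightarrow> bool" where
  "countably_determined \<kappa> T I Z \<longleftrightarrow>
     (\<forall>r t. 0 \<le> r \<and> r < t \<and> t \<le> T \<longrightarrow> (\<exists>K\<subseteq>I. countable K \<and>
        (\<forall>y Q. mp_solution \<kappa> r t K (\<lambda>k. on_path Z k r) y Q \<longrightarrow>
               mp_solution \<kappa> r t I (\<lambda>k. on_path Z k r) y Q)))"

lemma countable_imp_countably_determined: "countable I \<Longrightarrow> countably_determined \<kappa> T I Z"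
  by (auto simp: countably_determined_def)


section \<open>Piecewise controls\<close>

text \<open>A representation of a piecewise control: the subdivision \<open>s\<^sub>0 < \<dots> < s\<^sub>N\<close>, the sets \<open>I\<^sub>i\<close>, the
  cells \<open>A\<^sub>i\<^sub>j\<close> and the parameters \<open>\<theta>\<^sub>i\<^sub>j\<close>.\<close>

record ('n, 'e) switching =
  steps :: nat
  times :: "nat \<Rightarrow> real"
  labels :: "nat \<Rightarrow> nat set"
  cells :: "nat \<Rightarrow> nat \<Rightarrow> 'n path set"
  params :: "nat \<Rightarrow> nat \<Rightarrow> ('n, 'e) control"

definition is_switching ::
  "path_kind \<Rightarrow> real \<Rightarrow> ('n::finite, 'e) control set \<Rightarrow> real \<Rightarrow> ('n, 'e) switching \<Rightarrow> bool" where
  "is_switching \<kappa> T \<Theta> r R \<longleftrightarrow>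
     times R 0 = r \<and> times R (steps R) = T \<and> labels R 0 = {1} \<and>
     (\<forall>i<steps R. times R i < times R (Suc i) \<and> finite (labels R i) \<and>
        disjoint_family_on (cells R i) (labels R i) \<and>
        (\<Union>j\<in>labels R i. cells R i j) = path_space \<kappa> r T \<and>
        (\<forall>j\<in>labels R i. cells R i j \<in> sets (path_sigma \<kappa> r T (times R i)) \<and> params R i j \<in> \<Theta>))"

text \<open>As the cells form a partition, the sum \<open>\<Sum>\<^sub>j \<theta>\<^sub>i\<^sub>j(u, X\<^sub>u) 1\<^bsub>A\<^sub>i\<^sub>j\<^esub>\<close> is the value of the only active
  parameter; this needs no addition on \<open>'e\<close>. There is no condition at the final time.\<close>

definition represents ::
  "path_kind \<Rightarrow> real \<Rightarrow> ('n::finite, 'e) control set \<Rightarrow> real \<Rightarrow> ('n, 'e) switching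
    \<Rightarrow> (real \<Rightarrow> 'n path \<Rightarrow> 'e) \<Rightarrow> bool" where
  "represents \<kappa> T \<Theta> r R \<gamma> \<longleftrightarrow> is_switching \<kappa> T \<Theta> r R \<and>
     (\<forall>i<steps R. \<forall>u\<in>{times R i..<times R (Suc i)}. \<forall>j\<in>labels R i. \<forall>\<omega>\<in>cells R i j.
        \<gamma> u \<omega> = params R i j (u, \<omega> u))"

definition piecewise_controls ::
  "path_kind \<Rightarrow> real \<Rightarrow> ('n::finite, 'e) control set \<Rightarrow> real \<Rightarrow> (real \<Rightarrow> 'n path \<Rightarrow> 'e) set" where
  "piecewise_controls \<kappa> T \<Theta> r = {\<gamma>. \<exists>R. represents \<kappa> T \<Theta> r R \<gamma>}"

text \<open>The additive family attached to a representation, in closed form: the projection of \<open>[u,v]\<close>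
  to \<open>[s\<^sub>i,s\<^sub>i\<^sub>+\<^sub>1]\<close> is \<open>[proj i u, proj i v]\<close>, and it is a single point, with no contribution, if the
  two intervals do not overlap. Lemmas \<open>switched_mp_additive\<close>, \<open>switched_mp_on_step\<close> and
  \<open>switched_mp_unique\<close> below show that it is the only additive family with the prescribed values.\<close>

definition proj_step :: "('n, 'e) switching \<Rightarrow> nat \<Rightarrow> real \<Rightarrow> real" where
  "proj_step R i u = min (max u (times R i)) (times R (Suc i))"

definition switched_mp ::
  "(('n::finite, 'e) control \<Rightarrow> ('k, 'n) mp) \<Rightarrow> ('n, 'e) switching \<Rightarrow> ('k, 'n) mp" where
  "switched_mp Z R k u v \<omega> = (\<Sum>i<steps R. \<Sum>j\<in>labels R i.
     on_path (Z (params R i j)) k (proj_step R i u) (proj_step R i v) \<omega> * indicator (cells R i j) \<omega>)"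


section \<open>Conditional operators\<close>

definition paste :: "real \<Rightarrow> real \<Rightarrow> real \<Rightarrow> 'n::finite path \<Rightarrow> 'n path \<Rightarrow> 'n path" where
  "paste r s T \<omega> \<omega>' = (\<lambda>u\<in>{r..T}. if u \<le> s then \<omega> u else \<omega>' u + \<omega> s - \<omega>' s)"

definition control_operator ::
  "path_kind \<Rightarrow> real \<Rightarrow> 'k set \<Rightarrow> (('n::finite, 'e) control \<Rightarrow> ('k, 'n) mp) \<Rightarrow> real
    \<Rightarrow> ('n, 'e) control \<Rightarrow> real \<Rightarrow> ('n path \<Rightarrow> real) \<Rightarrow> 'n path \<Rightarrow> real" where
  "control_operator \<kappa> T I Z r \<theta> s \<psi> \<omega> =
     (\<integral>\<omega>'. \<psi> (paste r s T \<omega> \<omega>') \<partial>mp_law \<kappa> s T I (\<lambda>k. on_path (Z \<theta>) k s) (\<omega> s))"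

definition step_operator ::
  "path_kind \<Rightarrow> real \<Rightarrow> 'k set \<Rightarrow> (('n::finite, 'e) control \<Rightarrow> ('k, 'n) mp) \<Rightarrow> real
    \<Rightarrow> ('n, 'e) switching \<Rightarrow> nat \<Rightarrow> real \<Rightarrow> ('n path \<Rightarrow> real) \<Rightarrow> 'n path \<Rightarrow> real" where
  "step_operator \<kappa> T I Z r R i s \<psi> = (\<lambda>\<omega>\<in>path_space \<kappa> r T.
     \<Sum>j\<in>labels R i. indicator (cells R i j) \<omega> * control_operator \<kappa> T I Z r (params R i j) s \<psi> \<omega>)"

text \<open>\<open>E s\<close> is the extension of the operator at time \<open>s\<close>; it has to preserve bounded measurable
  functions for the chain rule to be meaningful.\<close>

definition chain_extension ::
  "path_kind \<Rightarrow> real \<Rightarrow> 'k set \<Rightarrow> (('n::finite, 'e) control \<Rightarrow> ('k, 'n) mp) \<Rightarrow> real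
    \<Rightarrow> ('n, 'e) switching \<Rightarrow> (real \<Rightarrow> ('n path \<Rightarrow> real) \<Rightarrow> 'n path \<Rightarrow> real) \<Rightarrow> bool" where
  "chain_extension \<kappa> T I Z r R E \<longleftrightarrow>
     E \<in> {r..T} \<rightarrow>\<^sub>E (bounded_path_functions \<kappa> r T T \<rightarrow>\<^sub>E bounded_path_functions \<kappa> r T T) \<and>
     (\<forall>\<psi>\<in>bounded_path_functions \<kappa> r T T. E T \<psi> = \<psi>) \<and>
     (\<forall>i<steps R. \<forall>s\<in>{times R i..<times R (Suc i)}.
        \<forall>\<psi>\<in>bounded_path_functions \<kappa> r T (times R (Suc i)).
          E s \<psi> = step_operator \<kappa> T I Z r R i s \<psi>) \<and>
     (\<forall>s t. \<forall>\<psi>\<in>bounded_path_functions \<kappa> r T T. r \<le> s \<and> s \<le> t \<and> t \<le> T \<longrightarrow>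
        E s \<psi> = E s (E t \<psi>))"


section \<open>Consistency of the definitions\<close>

subsection \<open>The topologies\<close>

lemma topspace_path_topology_continuous:
  "topspace (path_topology Continuous_Paths r t) = path_space Continuous_Paths r t"
proof -
  have "bounded (f ` {r..t})" if "continuous_on {r..t} f" for f :: "'a path"
    using compact_continuous_image[OF that] compact_imp_bounded by auto
  then show ?thesis
    by (auto simp: path_topology_def path_space_def Met_TC.mbounded_def)
qed

lemma time_changes_inverse:
  assumes "\<tau> \<in> time_changes r t"
  obtains \<sigma> where "\<sigma> \<in> time_changes r t"
    "\<And>u. u \<in> {r..t} \<Longrightarrow> \<tau> (\<sigma> u) = u" "\<And>u. u \<in> {r..t} \<Longrightarrow> \<sigma> (\<tau> u) = u"
proof -
  have sm: "strict_mono_on {r..t} \<tau>" and im: "\<tau> ` {r..t} = {r..t}"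
    using assms by (auto simp: time_changes_def)
  have inj: "inj_on \<tau> {r..t}"
    using sm by (rule strict_mono_on_imp_inj_on)
  define \<sigma> where "\<sigma> = the_inv_into {r..t} \<tau>"
  have 1: "\<tau> (\<sigma> u) = u" if "u \<in> {r..t}" for u
    using f_the_inv_into_f[OF inj, of u] that im by (simp add: \<sigma>_def)
  have 2: "\<sigma> (\<tau> u) = u" if "u \<in> {r..t}" for u
    using the_inv_into_f_f[OF inj that] by (simp add: \<sigma>_def)
  have 3: "\<sigma> u \<in> {r..t}" if "u \<in> {r..t}" for u
    using the_inv_into_into[OF inj, of u "{r..t}"] that im by (simp add: \<sigma>_def)
  have "strict_mono_on {r..t} \<sigma>"
  proof (rule strict_mono_onI)
    fix u v assume uv: "u \<in> {r..t}" "v \<in> {r..t}" "u < v"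
    show "\<sigma> u < \<sigma> v"
    proof (rule ccontr)
      assume "\<not> \<sigma> u < \<sigma> v"
      then have "\<tau> (\<sigma> v) \<le> \<tau> (\<sigma> u)"
        using strict_mono_onD[OF sm 3[OF uv(2)] 3[OF uv(1)]] by (cases "\<sigma> u = \<sigma> v") auto
      with 1 uv show False by auto
    qed
  qed
  moreover have "\<sigma> ` {r..t} = {r..t}"
  proof
    show "\<sigma> ` {r..t} \<subseteq> {r..t}"
      using 3 by blast
    show "{r..t} \<subseteq> \<sigma> ` {r..t}"
    proof
      fix u assume u: "u \<in> {r..t}"
      have "\<tau> u \<in> {r..t}"
        using im u by blast
      then show "u \<in> \<sigma> ` {r..t}"
        using 2[OF u] by (metis imageI)
    qed
  qed
  ultimately show ?thesis
    using that 1 2 by (auto simp: time_changes_def)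
qed

lemma skorokhod_bounds_commute_subset: "skorokhod_bounds r t \<omega> \<omega>' \<subseteq> skorokhod_bounds r t \<omega>' \<omega>"
proof
  fix e assume "e \<in> skorokhod_bounds r t \<omega> \<omega>'"
  then obtain \<tau> where e: "0 \<le> e" and \<tau>: "\<tau> \<in> time_changes r t"
    and le: "\<And>u. u \<in> {r..t} \<Longrightarrow> \<bar>\<tau> u - u\<bar> \<le> e \<and> dist (\<omega> u) (\<omega>' (\<tau> u)) \<le> e"
    by (auto simp: skorokhod_bounds_def)
  obtain \<sigma> where \<sigma>: "\<sigma> \<in> time_changes r t" "\<And>u. u \<in> {r..t} \<Longrightarrow> \<tau> (\<sigma> u) = u"
    using time_changes_inverse[OF \<tau>] by metis
  have "\<bar>\<sigma> u - u\<bar> \<le> e \<and> dist (\<omega>' u) (\<omega> (\<sigma> u)) \<le> e" if u: "u \<in> {r..t}" for u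
  proof -
    have "\<sigma> u \<in> {r..t}"
      using \<sigma>(1) u by (auto simp: time_changes_def)
    from le[OF this] show ?thesis
      using \<sigma>(2)[OF u] by (simp add: dist_commute abs_minus_commute)
  qed
  with e \<sigma>(1) show "e \<in> skorokhod_bounds r t \<omega>' \<omega>"
    unfolding skorokhod_bounds_def by blast
qed

lemma skorokhod_bounds_commute: "skorokhod_bounds r t \<omega> \<omega>' = skorokhod_bounds r t \<omega>' \<omega>"
  using skorokhod_bounds_commute_subset by (rule subset_antisym) (rule skorokhod_bounds_commute_subset)

lemma skorokhod_bounds_triangle:
  assumes "a \<in> skorokhod_bounds r t \<omega> \<omega>'" "b \<in> skorokhod_bounds r t \<omega>' \<omega>''"
  shows "a + b \<in> skorokhod_bounds r t \<omega> \<omega>''"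
proof -
  obtain \<sigma> where a: "0 \<le> a" and \<sigma>: "\<sigma> \<in> time_changes r t"
    and lea: "\<And>u. u \<in> {r..t} \<Longrightarrow> \<bar>\<sigma> u - u\<bar> \<le> a \<and> dist (\<omega> u) (\<omega>' (\<sigma> u)) \<le> a"
    using assms(1) by (auto simp: skorokhod_bounds_def)
  obtain \<tau> where b: "0 \<le> b" and \<tau>: "\<tau> \<in> time_changes r t"
    and leb: "\<And>u. u \<in> {r..t} \<Longrightarrow> \<bar>\<tau> u - u\<bar> \<le> b \<and> dist (\<omega>' u) (\<omega>'' (\<tau> u)) \<le> b"
    using assms(2) by (auto simp: skorokhod_bounds_def)
  have in\<sigma>: "\<sigma> u \<in> {r..t}" if "u \<in> {r..t}" for u
    using \<sigma> that by (auto simp: time_changes_def)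
  have "strict_mono_on {r..t} (\<tau> \<circ> \<sigma>)"
  proof (rule strict_mono_onI)
    fix u v assume uv: "u \<in> {r..t}" "v \<in> {r..t}" "u < v"
    have "\<sigma> u < \<sigma> v"
      using \<sigma> uv strict_mono_onD unfolding time_changes_def by blast
    then have "\<tau> (\<sigma> u) < \<tau> (\<sigma> v)"
      using \<tau> in\<sigma>[OF uv(1)] in\<sigma>[OF uv(2)] strict_mono_onD unfolding time_changes_def by blast
    then show "(\<tau> \<circ> \<sigma>) u < (\<tau> \<circ> \<sigma>) v"
      by simp
  qed
  moreover have "(\<tau> \<circ> \<sigma>) ` {r..t} = {r..t}"
    using \<sigma> \<tau> unfolding image_comp[symmetric] time_changes_def by simp
  ultimately have "\<tau> \<circ> \<sigma> \<in> time_changes r t"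
    by (simp add: time_changes_def)
  moreover have "\<bar>(\<tau> \<circ> \<sigma>) u - u\<bar> \<le> a + b \<and> dist (\<omega> u) (\<omega>'' ((\<tau> \<circ> \<sigma>) u)) \<le> a + b"
    if u: "u \<in> {r..t}" for u
    using lea[OF u] leb[OF in\<sigma>[OF u]] dist_triangle[of "\<omega> u" "\<omega>'' (\<tau> (\<sigma> u))" "\<omega>' (\<sigma> u)"] by auto
  ultimately show ?thesis
    using a b unfolding skorokhod_bounds_def by (auto intro!: bexI[of _ "\<tau> \<circ> \<sigma>"])
qed

lemma cadlag_on_bounded:
  assumes "cadlag_on r t \<omega>"
  shows "bounded (\<omega> ` {r..t})"
proof -
  have "\<exists>U. open U \<and> u \<in> U \<and> bounded (\<omega> ` (U \<inter> {r..t}))" if u: "u \<in> {r..t}" for u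
  proof -
    note bspec[OF assms[unfolded cadlag_on_def] u]
    then obtain l where lims: "(\<omega> \<longlongrightarrow> \<omega> u) (at u within {u<..t})"
        "(\<omega> \<longlongrightarrow> l) (at u within {r..<u})"
      by blast
    from tendstoD[OF lims(1), of 1] obtain d1 where
      d1: "0 < d1" "\<And>v. v \<in> {u<..t} \<Longrightarrow> dist v u < d1 \<Longrightarrow> dist (\<omega> v) (\<omega> u) < 1"
      unfolding eventually_at by auto
    from tendstoD[OF lims(2), of 1] obtain d2 where
      d2: "0 < d2" "\<And>v. v \<in> {r..<u} \<Longrightarrow> dist v u < d2 \<Longrightarrow> dist (\<omega> v) l < 1"
      unfolding eventually_at by auto
    have "\<omega> ` (ball u (min d1 d2) \<inter> {r..t}) \<subseteq> ball (\<omega> u) 1 \<union> ball l 1"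
    proof
      fix x assume "x \<in> \<omega> ` (ball u (min d1 d2) \<inter> {r..t})"
      then obtain v where v: "x = \<omega> v" "dist v u < d1" "dist v u < d2" "v \<in> {r..t}"
        by (auto simp: dist_commute)
      then show "x \<in> ball (\<omega> u) 1 \<union> ball l 1"
        using d1(2)[of v] d2(2)[of v] by (cases v u rule: linorder_cases) (auto simp: dist_commute)
    qed
    then have "bounded (\<omega> ` (ball u (min d1 d2) \<inter> {r..t}))"
      by (rule bounded_subset[rotated]) simp
    with d1(1) d2(1) show ?thesis
      by (intro exI[of _ "ball u (min d1 d2)"]) auto
  qed
  then obtain U where U: "\<And>u. u \<in> {r..t} \<Longrightarrow> open (U u) \<and> u \<in> U u \<and> bounded (\<omega> ` (U u \<inter> {r..t}))"
    by metis
  have "{r..t} \<subseteq> (\<Union>u\<in>{r..t}. U u)"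
    using U by blast
  moreover have "open (U u)" if "u \<in> {r..t}" for u
    using U that by blast
  ultimately obtain C where C: "C \<subseteq> {r..t}" "finite C" "{r..t} \<subseteq> (\<Union>u\<in>C. U u)"
    using compactE_image[OF compact_Icc] by metis
  then have "\<omega> ` {r..t} \<subseteq> (\<Union>u\<in>C. \<omega> ` (U u \<inter> {r..t}))"
    by blast
  moreover have "bounded (\<Union>u\<in>C. \<omega> ` (U u \<inter> {r..t}))"
    using C U by (intro bounded_UN) auto
  ultimately show ?thesis
    by (rule bounded_subset[rotated])
qed

lemma skorokhod_bounds_nonempty:
  assumes "cadlag_on r t \<omega>" "cadlag_on r t \<omega>'"
  shows "skorokhod_bounds r t \<omega> \<omega>' \<noteq> {}"
proof -
  obtain a b where "\<And>u. u \<in> {r..t} \<Longrightarrow> norm (\<omega> u) \<le> a" "\<And>u. u \<in> {r..t} \<Longrightarrow> norm (\<omega>' u) \<le> b"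
    using assms[THEN cadlag_on_bounded] unfolding bounded_iff by (metis imageI)
  then have "dist (\<omega> u) (\<omega>' u) \<le> max 0 (a + b)" if "u \<in> {r..t}" for u
    using that norm_triangle_ineq4[of "\<omega> u" "\<omega>' u"] unfolding dist_norm by fastforce
  then have "max 0 (a + b) \<in> skorokhod_bounds r t \<omega> \<omega>'"
    unfolding skorokhod_bounds_def
    by (auto intro!: bexI[of _ id] simp: time_changes_def strict_mono_on_def)
  then show ?thesis by auto
qed

lemma time_changes_endpoint:
  assumes "\<tau> \<in> time_changes r t" "r \<le> t"
  shows "\<tau> t = t"
proof -
  have im: "\<tau> ` {r..t} = {r..t}"
    using assms(1) by (simp add: time_changes_def)
  moreover have t: "t \<in> {r..t}"
    using assms(2) by simp
  ultimately obtain v where v: "v \<in> {r..t}" "\<tau> v = t"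
    by (metis imageE)
  have "\<tau> t \<le> t"
    using imageI[OF t, of \<tau>] im by simp
  moreover have "v < t \<Longrightarrow> \<tau> v < \<tau> t"
    using assms v strict_mono_onD[of "{r..t}" \<tau> v t] unfolding time_changes_def by simp
  ultimately show ?thesis
    using v by (cases "v = t") auto
qed

lemma skorokhod_dist_zero_imp_eq:
  assumes "cadlag_on r t \<omega>" "cadlag_on r t \<omega>'"
    and small: "\<And>e. 0 < e \<Longrightarrow> \<exists>a\<in>skorokhod_bounds r t \<omega> \<omega>'. a < e"
    and u: "u \<in> {r..t}"
  shows "\<omega> u = \<omega>' u"
proof -
  have approx: "\<exists>\<tau>\<in>time_changes r t. \<forall>u\<in>{r..t}. \<bar>\<tau> u - u\<bar> < e \<and> dist (\<omega> u) (\<omega>' (\<tau> u)) < e"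
    if e: "0 < e" for e
  proof -
    obtain a where a: "a \<in> skorokhod_bounds r t \<omega> \<omega>'" "a < e"
      using small[OF e] by blast
    then obtain \<tau> where "\<tau> \<in> time_changes r t"
        "\<forall>u\<in>{r..t}. \<bar>\<tau> u - u\<bar> \<le> a \<and> dist (\<omega> u) (\<omega>' (\<tau> u)) \<le> a"
      unfolding skorokhod_bounds_def by blast
    with a(2) show ?thesis
      by (intro bexI[of _ \<tau>]) (auto intro: le_less_trans)
  qed
  have "dist (\<omega> u) (\<omega>' u) \<le> e" if e: "0 < e" for e
  proof (cases "u = t")
    case True
    obtain \<tau> where "\<tau> \<in> time_changes r t" "dist (\<omega> u) (\<omega>' (\<tau> u)) < e"
      using approx[OF e] u by blast
    then show ?thesis
      using time_changes_endpoint[of \<tau> r t] True u by auto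
  next
    case False
    then have ut: "u < t" using u by auto
    have lims: "(\<omega> \<longlongrightarrow> \<omega> u) (at u within {u<..t})" "(\<omega>' \<longlongrightarrow> \<omega>' u) (at u within {u<..t})"
      using assms(1,2) u by (auto simp: cadlag_on_def)
    from tendstoD[OF lims(1), of "e/3"] e obtain d1 where
      d1: "0 < d1" "\<And>v. v \<in> {u<..t} \<Longrightarrow> dist v u < d1 \<Longrightarrow> dist (\<omega> v) (\<omega> u) < e/3"
      unfolding eventually_at by auto
    from tendstoD[OF lims(2), of "e/3"] e obtain d2 where
      d2: "0 < d2" "\<And>v. v \<in> {u<..t} \<Longrightarrow> dist v u < d2 \<Longrightarrow> dist (\<omega>' v) (\<omega>' u) < e/3"
      unfolding eventually_at by auto
    define d where "d = min (t - u) (min d1 d2)"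
    define v where "v = u + d / 2"
    have d: "0 < d" "d \<le> t - u" "d \<le> d1" "d \<le> d2"
      using d1 d2 ut by (auto simp: d_def)
    have v: "v \<in> {r..t}" "v \<in> {u<..t}" "dist v u < d1"
      using d u by (auto simp: v_def dist_real_def)
    obtain \<tau> where \<tau>: "\<tau> \<in> time_changes r t" "\<bar>\<tau> v - v\<bar> < min (d/2) (e/3)"
        "dist (\<omega> v) (\<omega>' (\<tau> v)) < min (d/2) (e/3)"
      using approx[of "min (d/2) (e/3)"] d e v by (metis divide_pos_pos min_less_iff_conj zero_less_numeral)
    have "\<tau> v \<in> {r..t}"
      using \<tau>(1) v(1) unfolding time_changes_def by auto
    then have "\<tau> v \<in> {u<..t}" "dist (\<tau> v) u < d2"
      using \<tau>(2) d by (auto simp: v_def dist_real_def abs_if split: if_splits)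
    from d2(2)[OF this] d1(2)[OF v(2,3)] \<tau>(3) show ?thesis
      using dist_triangle[of "\<omega> u" "\<omega>' u" "\<omega> v"] dist_triangle[of "\<omega> v" "\<omega>' u" "\<omega>' (\<tau> v)"]
      by (auto simp: dist_commute)
  qed
  then have "dist (\<omega> u) (\<omega>' u) \<le> 0"
    by (rule field_le_epsilon) simp
  then show ?thesis
    by simp
qed

lemma Metric_space_skorokhod:
  "Metric_space (path_space Cadlag_Paths r t :: 'n::finite path set) (skorokhod_dist r t)"
proof
  let ?D = "path_space Cadlag_Paths r t :: 'n path set"
  let ?B = "skorokhod_bounds r t :: 'n path \<Rightarrow> 'n path \<Rightarrow> real set"
  have cadlag: "cadlag_on r t \<omega>" if "\<omega> \<in> ?D" for \<omega>
    using that by (simp add: path_space_def)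
  have bdd: "bdd_below (?B \<omega> \<omega>')" for \<omega> \<omega>'
    by (rule bdd_belowI[of _ 0]) (simp add: skorokhod_bounds_def)
  have ne: "?B \<omega> \<omega>' \<noteq> {}" if "\<omega> \<in> ?D" "\<omega>' \<in> ?D" for \<omega> \<omega>'
    using that cadlag skorokhod_bounds_nonempty by blast
  show "0 \<le> skorokhod_dist r t \<omega> \<omega>'" for \<omega> \<omega>' :: "'n path"
  proof (cases "\<omega> \<in> ?D \<and> \<omega>' \<in> ?D")
    case True
    then have "0 \<le> Inf (?B \<omega> \<omega>')"
      using ne by (intro cInf_greatest) (simp_all add: skorokhod_bounds_def)
    with True show ?thesis
      by (simp add: skorokhod_dist_def)
  next
    case False
    then show ?thesis
      by (auto simp: skorokhod_dist_def)
  qed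
  show "skorokhod_dist r t \<omega> \<omega>' = skorokhod_dist r t \<omega>' \<omega>" for \<omega> \<omega>' :: "'n path"
    unfolding skorokhod_dist_def skorokhod_bounds_commute[of r t \<omega> \<omega>'] by (simp add: conj_commute)
  show "(skorokhod_dist r t \<omega> \<omega>' = 0) = (\<omega> = \<omega>')" if D: "\<omega> \<in> ?D" "\<omega>' \<in> ?D" for \<omega> \<omega>'
  proof
    assume "skorokhod_dist r t \<omega> \<omega>' = 0"
    then have "Inf (?B \<omega> \<omega>') = 0"
      using D by (simp add: skorokhod_dist_def)
    then have "\<exists>a\<in>?B \<omega> \<omega>'. a < e" if "0 < e" for e
      using that cInf_lessD[OF ne[OF D], of e] by auto
    then have "\<omega> u = \<omega>' u" if "u \<in> {r..t}" for u
      using skorokhod_dist_zero_imp_eq[OF cadlag[OF D(1)] cadlag[OF D(2)]] that by blast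
    then show "\<omega> = \<omega>'"
      using D by (intro extensionalityI[of _ "{r..t}"]) (auto simp: path_space_def)
  next
    assume "\<omega> = \<omega>'"
    then have "0 \<in> ?B \<omega> \<omega>'"
      unfolding skorokhod_bounds_def
      by (auto intro!: bexI[of _ id] simp: time_changes_def strict_mono_on_def)
    then have "Inf (?B \<omega> \<omega>') \<le> 0"
      using bdd by (rule cInf_lower)
    moreover have "0 \<le> Inf (?B \<omega> \<omega>')"
      using ne[OF D] by (intro cInf_greatest) (auto simp: skorokhod_bounds_def)
    ultimately show "skorokhod_dist r t \<omega> \<omega>' = 0"
      using D by (simp add: skorokhod_dist_def)
  qed
  show "skorokhod_dist r t \<omega> \<omega>'' \<le> skorokhod_dist r t \<omega> \<omega>' + skorokhod_dist r t \<omega>' \<omega>''"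
    if D: "\<omega> \<in> ?D" "\<omega>' \<in> ?D" "\<omega>'' \<in> ?D" for \<omega> \<omega>' \<omega>''
  proof (rule field_le_epsilon)
    fix e :: real assume e: "0 < e"
    obtain a where a: "a \<in> ?B \<omega> \<omega>'" "a < Inf (?B \<omega> \<omega>') + e/2"
      using cInf_lessD[OF ne[OF D(1,2)], of "Inf (?B \<omega> \<omega>') + e/2"] e by auto
    obtain b where b: "b \<in> ?B \<omega>' \<omega>''" "b < Inf (?B \<omega>' \<omega>'') + e/2"
      using cInf_lessD[OF ne[OF D(2,3)], of "Inf (?B \<omega>' \<omega>'') + e/2"] e by auto
    have "Inf (?B \<omega> \<omega>'') \<le> a + b"
      using skorokhod_bounds_triangle[OF a(1) b(1)] bdd by (rule cInf_lower)
    with a b D show "skorokhod_dist r t \<omega> \<omega>'' \<le>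
        skorokhod_dist r t \<omega> \<omega>' + skorokhod_dist r t \<omega>' \<omega>'' + e"
      by (simp add: skorokhod_dist_def)
  qed
qed

lemma topspace_path_topology: "topspace (path_topology \<kappa> r t) = path_space \<kappa> r t"
proof (cases \<kappa>)
  case Cadlag_Paths
  then show ?thesis
    by (simp add: path_topology_def Metric_space.topspace_mtopology[OF Metric_space_skorokhod])
qed (simp add: topspace_path_topology_continuous)


subsection \<open>The additive family of a representation\<close>

lemma restrict_in_path_space:
  assumes "\<omega> \<in> path_space \<kappa> r t" "r \<le> a" "b \<le> t"
  shows "restrict \<omega> {a..b} \<in> path_space \<kappa> a b"
proof (cases \<kappa>)
  case Continuous_Paths
  have "continuous_on {a..b} \<omega>"
    using assms Continuous_Paths by (auto simp: path_space_def intro: continuous_on_subset)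
  then show ?thesis
    using Continuous_Paths by (simp add: path_space_def cong: continuous_on_cong_simp)
next
  case Cadlag_Paths
  have "cadlag_on a b (restrict \<omega> {a..b})"
    unfolding cadlag_on_def
  proof
    fix u assume u: "u \<in> {a..b}"
    have c: "cadlag_on r t \<omega>" and urt: "u \<in> {r..t}"
      using assms Cadlag_Paths u by (auto simp: path_space_def)
    note bspec[OF c[unfolded cadlag_on_def] urt]
    then obtain l where "(\<omega> \<longlongrightarrow> \<omega> u) (at u within {u<..t})"
        "(\<omega> \<longlongrightarrow> l) (at u within {r..<u})"
      by blast
    then have 1: "(\<omega> \<longlongrightarrow> \<omega> u) (at u within {u<..b})" and 2: "(\<omega> \<longlongrightarrow> l) (at u within {a..<u})"
      using assms by (auto elim!: tendsto_within_subset)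
    have "(restrict \<omega> {a..b} \<longlongrightarrow> \<omega> u) (at u within {u<..b})"
      using u by (intro Lim_transform_within[OF 1, of 1]) auto
    moreover have "(restrict \<omega> {a..b} \<longlongrightarrow> l) (at u within {a..<u})"
      using u by (intro Lim_transform_within[OF 2, of 1]) auto
    ultimately show "(restrict \<omega> {a..b} \<longlongrightarrow> restrict \<omega> {a..b} u) (at u within {u<..b}) \<and>
        (\<exists>l. (restrict \<omega> {a..b} \<longlongrightarrow> l) (at u within {a..<u}))"
      using u by auto
  qed
  then show ?thesis
    using Cadlag_Paths by (simp add: path_space_def)
qed

lemma additive_mp_on_path:
  assumes "additive_mp \<kappa> T I Z" "k \<in> I" "\<omega> \<in> path_space \<kappa> r T"
    and "0 \<le> r" "r \<le> u" "u \<le> v" "v \<le> w" "w \<le> T"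
  shows "on_path Z k u w \<omega> = on_path Z k u v \<omega> + on_path Z k v w \<omega>"
proof -
  have "restrict \<omega> {u..w} \<in> path_space \<kappa> u w"
    using assms by (intro restrict_in_path_space) auto
  then have "Z k u w (restrict \<omega> {u..w}) =
      on_path Z k u v (restrict \<omega> {u..w}) + on_path Z k v w (restrict \<omega> {u..w})"
    using assms unfolding additive_mp_def by auto
  moreover have "{u..w} \<inter> {u..v} = {u..v}" "{u..w} \<inter> {v..w} = {v..w}"
    using assms by auto
  ultimately show ?thesis
    by (simp add: on_path_def del: Int_atLeastAtMost)
qed

lemma is_switching_times_mono:
  assumes "is_switching \<kappa> T \<Theta> r R" "i \<le> j" "j \<le> steps R"
  shows "times R i \<le> times R j"
  using assms(2,3)
proof (induction rule: dec_induct)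
  case (step n)
  then show ?case
    using assms(1) unfolding is_switching_def by (smt (verit) Suc_le_lessD Suc_leD)
qed simp

lemma is_switching_times_bounds:
  assumes "is_switching \<kappa> T \<Theta> r R" "i \<le> steps R"
  shows "r \<le> times R i" "times R i \<le> T"
  using is_switching_times_mono[OF assms(1), of 0 i] is_switching_times_mono[OF assms(1), of i "steps R"]
    assms unfolding is_switching_def by auto

lemma switched_mp_additive:
  assumes R: "is_switching \<kappa> T \<Theta> r R" and Z: "\<forall>\<theta>\<in>\<Theta>. additive_mp \<kappa> T I (Z \<theta>)"
    and "k \<in> I" "\<omega> \<in> path_space \<kappa> r T" "0 \<le> r" "r \<le> u" "u \<le> v" "v \<le> w" "w \<le> T"
  shows "switched_mp Z R k u w \<omega> = switched_mp Z R k u v \<omega> + switched_mp Z R k v w \<omega>"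
proof -
  let ?Z = "\<lambda>i j. on_path (Z (params R i j)) k" and ?p = "proj_step R"
  have "?Z i j (?p i u) (?p i w) \<omega> = ?Z i j (?p i u) (?p i v) \<omega> + ?Z i j (?p i v) (?p i w) \<omega>"
    if ij: "i < steps R" "j \<in> labels R i" for i j
  proof (rule additive_mp_on_path)
    show "additive_mp \<kappa> T I (Z (params R i j))"
      using R Z ij unfolding is_switching_def by blast
    have "r \<le> times R i" "times R (Suc i) \<le> T" "times R i \<le> times R (Suc i)"
      using is_switching_times_bounds[OF R, of i] is_switching_times_bounds[OF R, of "Suc i"]
        is_switching_times_mono[OF R, of i "Suc i"] ij by auto
    then show "r \<le> ?p i u" "?p i u \<le> ?p i v" "?p i v \<le> ?p i w" "?p i w \<le> T"
      using assms by (auto simp: proj_step_def min_def max_def)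
  qed (use assms in auto)
  then show ?thesis
    unfolding switched_mp_def by (simp add: sum.distrib[symmetric] distrib_right)
qed

lemma switched_mp_on_step:
  assumes R: "is_switching \<kappa> T \<Theta> r R" and Z: "\<forall>\<theta>\<in>\<Theta>. additive_mp \<kappa> T I (Z \<theta>)"
    and k: "k \<in> I" and \<omega>: "\<omega> \<in> path_space \<kappa> r T" and "0 \<le> r"
    and i: "i < steps R" and u: "times R i \<le> u" "u \<le> times R (Suc i)"
  shows "switched_mp Z R k (times R i) u \<omega> =
    (\<Sum>j\<in>labels R i. on_path (Z (params R i j)) k (times R i) u \<omega> * indicator (cells R i j) \<omega>)"
proof -
  have "(\<Sum>j\<in>labels R i'. on_path (Z (params R i' j)) k (proj_step R i' (times R i)) (proj_step R i' u) \<omega>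
      * indicator (cells R i' j) \<omega>) = 0" if i': "i' < steps R" "i' \<noteq> i" for i'
  proof (rule sum.neutral, rule ballI)
    fix j assume j: "j \<in> labels R i'"
    have le: "r \<le> times R i'" "times R (Suc i') \<le> T" "times R i' \<le> times R (Suc i')"
      using is_switching_times_bounds[OF R, of i'] is_switching_times_bounds[OF R, of "Suc i'"]
        is_switching_times_mono[OF R, of i' "Suc i'"] i' by auto
    have eq: "proj_step R i' (times R i) = proj_step R i' u"
    proof (cases "i' < i")
      case True
      then have "times R (Suc i') \<le> times R i"
        using i by (intro is_switching_times_mono[OF R]) auto
      then show ?thesis using u le by (simp add: proj_step_def min_def max_def)
    next
      case False
      then have "times R (Suc i) \<le> times R i'"
        using i' by (intro is_switching_times_mono[OF R]) auto
      then show ?thesis using u le by (simp add: proj_step_def min_def max_def)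
    qed
    have "additive_mp \<kappa> T I (Z (params R i' j))"
      using R Z i' j unfolding is_switching_def by blast
    from additive_mp_on_path[OF this k \<omega> \<open>0 \<le> r\<close>, of "proj_step R i' u" "proj_step R i' u" "proj_step R i' u"]
    have "on_path (Z (params R i' j)) k (proj_step R i' u) (proj_step R i' u) \<omega> = 0"
      using le by (auto simp: proj_step_def min_def max_def)
    with eq show "on_path (Z (params R i' j)) k (proj_step R i' (times R i)) (proj_step R i' u) \<omega>
        * indicator (cells R i' j) \<omega> = 0"
      by simp
  qed
  then have "switched_mp Z R k (times R i) u \<omega> =
    (\<Sum>i'<steps R. if i' = i then (\<Sum>j\<in>labels R i. on_path (Z (params R i j)) k (proj_step R i (times R i))
      (proj_step R i u) \<omega> * indicator (cells R i j) \<omega>) else 0)"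
    unfolding switched_mp_def by (intro sum.cong) auto
  then show ?thesis
    using i u by (simp add: proj_step_def min_def max_def)
qed

lemma switched_mp_unique:
  assumes R: "is_switching \<kappa> T \<Theta> r R" and Z: "\<forall>\<theta>\<in>\<Theta>. additive_mp \<kappa> T I (Z \<theta>)"
    and k: "k \<in> I" and \<omega>: "\<omega> \<in> path_space \<kappa> r T" and "0 \<le> r"
    and add: "\<And>u v. r \<le> u \<Longrightarrow> u \<le> v \<Longrightarrow> v \<le> T \<Longrightarrow> W r v = W r u + W u v"
    and step: "\<And>i u. i < steps R \<Longrightarrow> times R i \<le> u \<Longrightarrow> u \<le> times R (Suc i) \<Longrightarrow> W (times R i) u =
      (\<Sum>j\<in>labels R i. on_path (Z (params R i j)) k (times R i) u \<omega> * indicator (cells R i j) \<omega>)"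
    and uv: "r \<le> u" "u \<le> v" "v \<le> T"
  shows "W u v = switched_mp Z R k u v \<omega>"
proof -
  let ?S = "\<lambda>u v. switched_mp Z R k u v \<omega>"
  have times: "times R 0 = r" "times R (steps R) = T"
    using R by (auto simp: is_switching_def)
  have addS: "?S r v = ?S r u + ?S u v" if "r \<le> u" "u \<le> v" "v \<le> T" for u v
    using switched_mp_additive[OF R Z k \<omega> \<open>0 \<le> r\<close>, of r u v] that by simp
  have "\<forall>u. r \<le> u \<and> u \<le> times R i \<longrightarrow> W r u = ?S r u" if "i \<le> steps R" for i
    using that
  proof (induction i)
    case 0
    have "r \<le> T"
      using is_switching_times_bounds[OF R, of 0] times by simp
    then have "W r r = 0" "?S r r = 0"
      using add[of r r] addS[of r r] by auto
    then show ?case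
      using times by auto
  next
    case (Suc i)
    show ?case
    proof (intro allI impI)
      fix u assume u: "r \<le> u \<and> u \<le> times R (Suc i)"
      show "W r u = ?S r u"
      proof (cases "u \<le> times R i")
        case True
        with u Suc show ?thesis by simp
      next
        case False
        have b: "r \<le> times R i" "times R i \<le> u" "u \<le> T" "i < steps R"
          using is_switching_times_bounds[OF R] Suc.prems u False by (auto intro: order_trans)
        have "W (times R i) u = ?S (times R i) u"
          using step[of i u] switched_mp_on_step[OF R Z k \<omega> \<open>0 \<le> r\<close>, of i u] b u by simp
        moreover have "W r (times R i) = ?S r (times R i)"
          using Suc b by simp
        ultimately show ?thesis
          using add[of "times R i" u] addS[of "times R i" u] b by simp
      qed
    qed
  qed
  from this[of "steps R"] times have "W r u = ?S r u" "W r v = ?S r v"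
    using uv by auto
  then show ?thesis
    using add[of u v] addS[of u v] uv by simp
qed

end

theory Submission
  imports Defs
begin

text \<open>Everything follows from one identity. Let \<open>Q\<close> solve the switched problem, let \<open>s\<close> lie in the
  step that ends at \<open>t\<close>, and let \<open>\<psi>\<close> depend on the path up to \<open>t\<close>. Then the step operator at
  time \<open>s\<close>, applied to \<open>\<psi>\<close>, is the conditional expectation of \<open>\<psi>\<close> given the past of \<open>s\<close>
  (\<open>step_operator_conditional\<close>). The past decides which parameter is active; given the past, the path
  on \<open>[s,t]\<close> almost surely has a conditional law that solves the problem of this parameter from the
  current position; and there is only one such law (\<open>active_law_AE\<close>). Composing the step operators
  backwards from the horizon gives the conditional expectation of every \<open>\<psi>\<close> at every time
  (\<open>chain_cond_exp\<close>). At the initial time the past is deterministic, so \<open>Q\<close> is determined: this is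
  the uniqueness of the solution (\<open>switched_solution_measure\<close>).

  Three facts make conditional laws available. Path spaces, of continuous or of cadlag paths, are
  measurable retracts of the real line (\<open>path_decode_code\<close>), and on the real line a conditional
  distribution is built from its distribution function (\<open>real_conditional_distribution\<close>). The
  martingale property is a family of vanishing integrals, which by right continuity may be restricted to
  countable sets of times and events (\<open>centered_from_countable\<close>); together with countable
  determination, almost every conditional law satisfies all conditions at once. Finally the
  laws of a parameter depend measurably on the starting point: weak continuity controls the integrals
  of weighted suprema along the path, and these generate the \<open>\<sigma>\<close>-algebra
  (\<open>weakly_continuous_kernel\<close>).

  The opposite operation to conditioning is gluing: a measure is followed up to \<open>s\<close>, then a kernel takes
  over. Centered increments survive gluing (\<open>centered_glue\<close>). Gluing the laws of the active parameters
  one step after the other gives a solution (\<open>switched_solution_exists\<close>). Gluing the law of a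
  parameter to itself gives a solution of the same problem, hence by uniqueness the same law: this is
  the Markov property (\<open>law_markov\<close>). It makes the chain rule within one step an identity at every
  path, while the chain rule across steps is part of the construction (\<open>chain_chain\<close>).\<close>

section \<open>Kernels and conditional distributions\<close>

lemma integral_bounded_le:
  fixes f :: "'a \<Rightarrow> real"
  assumes "prob_space M" "\<And>x. x \<in> space M \<Longrightarrow> \<bar>f x\<bar> \<le> B"
  shows "\<bar>\<integral>x. f x \<partial>M\<bar> \<le> B"
proof (cases "integrable M f")
  case True
  interpret prob_space M by fact
  have "\<bar>\<integral>x. f x \<partial>M\<bar> \<le> (\<integral>x. \<bar>f x\<bar> \<partial>M)"
    by (rule integral_abs_bound)
  also have "\<dots> \<le> (\<integral>x. B \<partial>M)"
    using True assms(2) by (intro integral_mono) auto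
  finally show ?thesis
    by (simp add: prob_space)
next
  case False
  obtain x where "x \<in> space M"
    using prob_space.not_empty[OF assms(1)] by auto
  then have "0 \<le> B"
    using assms(2)[of x] by linarith
  then show ?thesis
    using False by (simp add: not_integrable_integral_eq)
qed

lemma integrable_bounded:
  fixes f :: "'a \<Rightarrow> real"
  assumes "prob_space M" "f \<in> borel_measurable M" "\<And>x. x \<in> space M \<Longrightarrow> \<bar>f x\<bar> \<le> B"
  shows "integrable M f"
proof -
  interpret prob_space M by fact
  show ?thesis
    using assms(2,3) by (intro integrable_const_bound[of _ B]) auto
qed

lemma kernel_prob_space:
  assumes "\<kappa> \<in> M \<rightarrow>\<^sub>M prob_algebra N" "x \<in> space M"
  shows "prob_space (\<kappa> x)" "sets (\<kappa> x) = sets N" "space (\<kappa> x) = space N"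
  using measurable_space[OF assms] by (auto simp: space_prob_algebra dest: sets_eq_imp_space_eq)

lemma kernel_integral_measurable:
  fixes f :: "'a \<Rightarrow> 'b \<Rightarrow> real"
  assumes f: "(\<lambda>(x, y). f x y) \<in> borel_measurable (M \<Otimes>\<^sub>M N)"
    and \<kappa>: "\<kappa> \<in> M \<rightarrow>\<^sub>M prob_algebra N"
  shows "(\<lambda>x. \<integral>y. f x y \<partial>\<kappa> x) \<in> borel_measurable M"
proof -
  have "(\<lambda>x. distr (\<kappa> x) (M \<Otimes>\<^sub>M N) (Pair x)) \<in> M \<rightarrow>\<^sub>M subprob_algebra (M \<Otimes>\<^sub>M N)"
    using \<kappa> by (intro measurable_prob_algebraD measurable_distr_prob_space2[where M = N]) auto
  from measurable_compose[OF this integral_measurable_subprob_algebra[OF f]]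
  have "(\<lambda>x. \<integral>z. (\<lambda>(x, y). f x y) z \<partial>distr (\<kappa> x) (M \<Otimes>\<^sub>M N) (Pair x)) \<in> borel_measurable M" .
  moreover have "(\<integral>z. (\<lambda>(x, y). f x y) z \<partial>distr (\<kappa> x) (M \<Otimes>\<^sub>M N) (Pair x)) = (\<integral>y. f x y \<partial>\<kappa> x)"
    if x: "x \<in> space M" for x
  proof -
    have "Pair x \<in> \<kappa> x \<rightarrow>\<^sub>M M \<Otimes>\<^sub>M N"
      using x kernel_prob_space(2)[OF \<kappa> x] by (simp cong: measurable_cong_sets)
    then show ?thesis
      using f by (subst integral_distr) auto
  qed
  ultimately show ?thesis
    by (simp cong: measurable_cong)
qed

lemma integral_bind_kernel:
  fixes f :: "'b \<Rightarrow> real"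
  assumes "prob_space M" and \<kappa>: "\<kappa> \<in> M \<rightarrow>\<^sub>M prob_algebra N"
    and f: "f \<in> borel_measurable N" and bounded: "\<And>x. x \<in> space N \<Longrightarrow> \<bar>f x\<bar> \<le> B"
  shows "(\<integral>x. f x \<partial>(M \<bind> \<kappa>)) = (\<integral>x. \<integral>y. f y \<partial>\<kappa> x \<partial>M)"
proof -
  interpret prob_space M by fact
  note \<kappa>' = measurable_prob_algebraD[OF \<kappa>]
  interpret D: prob_space "distr M (subprob_algebra N) \<kappa>"
    using \<kappa>' by (rule prob_space_distr)
  have "(\<integral>x. f x \<partial>(M \<bind> \<kappa>)) = (\<integral>x. f x \<partial>join (distr M (subprob_algebra N) \<kappa>))"
    by (simp add: bind_nonempty''[OF \<kappa>'] not_empty)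
  also have "\<dots> = (\<integral>M'. \<integral>x. f x \<partial>M' \<partial>distr M (subprob_algebra N) \<kappa>)"
    using f bounded
    by (intro integral_join[where B' = 1] D.finite_measure_axioms AE_I2)
       (auto simp: space_subprob_algebra dest: subprob_space.emeasure_space_le_1)
  also have "\<dots> = (\<integral>x. \<integral>y. f y \<partial>\<kappa> x \<partial>M)"
    using f \<kappa>' by (subst integral_distr) auto
  finally show ?thesis .
qed

lemma prob_space_bind_kernel:
  assumes "prob_space M" "\<kappa> \<in> M \<rightarrow>\<^sub>M prob_algebra N"
  shows "prob_space (M \<bind> \<kappa>)" "sets (M \<bind> \<kappa>) = sets N" "space (M \<bind> \<kappa>) = space N"
proof -
  have M: "M \<in> space (prob_algebra M)"
    using assms(1) by (simp add: space_prob_algebra)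
  show "prob_space (M \<bind> \<kappa>)" "sets (M \<bind> \<kappa>) = sets N"
    using prob_space_bind'[OF M assms(2)] sets_bind'[OF M assms(2)] by auto
  then show "space (M \<bind> \<kappa>) = space N"
    by (auto dest: sets_eq_imp_space_eq)
qed

text \<open>The sets over which the integral of \<open>f\<close> vanishes form a Dynkin system as soon as the whole space
  is one of them.\<close>

lemma integral_zero_on_generated:
  fixes f :: "'a \<Rightarrow> real"
  assumes f: "integrable M f" and G: "Int_stable G" "sigma_sets (space M) G \<subseteq> sets M"
    and zero: "\<And>A. A \<in> G \<Longrightarrow> (\<integral>x. indicator A x * f x \<partial>M) = 0" and total: "(\<integral>x. f x \<partial>M) = 0"
    and A: "A \<in> sigma_sets (space M) G"
  shows "(\<integral>x. indicator A x * f x \<partial>M) = 0"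
proof -
  have int: "integrable M (\<lambda>x. indicator B x * f x)" if "B \<in> sigma_sets (space M) G" for B
    using integrable_mult_indicator[OF _ f, of B] G(2) that by auto
  have GP: "G \<subseteq> Pow (space M)"
    using G(2) sets.sets_into_space by (blast intro: sigma_sets.Basic)
  show ?thesis
    using G(1) GP A
  proof (induction rule: sigma_sets_induct_disjoint)
    case (compl B)
    have "(\<integral>x. indicator (space M - B) x * f x \<partial>M) = (\<integral>x. f x - indicator B x * f x \<partial>M)"
      by (intro Bochner_Integration.integral_cong) (auto simp: indicator_def)
    then show ?case
      using compl f int total by simp
  next
    case (union B)
    have B: "B i \<in> sets M" for i
      using union G(2) by auto
    have "set_integrable M (\<Union>i. B i) f"
      using int[OF sigma_sets.Union, of B] union by (auto simp: set_integrable_def)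
    then have "(LINT x:(\<Union>i. B i)|M. f x) = (\<Sum>i. (LINT x:(B i)|M. f x))"
      using B union(1) by (intro lebesgue_integral_countable_add) (auto simp: disjoint_family_on_def)
    then show ?case
      using union by (simp add: set_lebesgue_integral_def)
  qed (use zero in auto)
qed


text \<open>The conditional distribution function at \<open>x\<close> is the infimum, over the rationals \<open>q > x\<close>, of the
  conditional probabilities of \<open>Y \<le> q\<close>, truncated to \<open>[0,1]\<close>. Such an infimum is monotone and right
  continuous in \<open>x\<close> for any family of numbers, and its limits at infinity are forced because \<open>Y\<close> has
  values in \<open>[0,1)\<close>. So it is a distribution function at every point, and the exceptional null sets of
  the conditional probabilities only matter for the value of its integrals.\<close>

lemma real_conditional_distribution:
  fixes Y :: "'a \<Rightarrow> real"
  assumes "prob_space M" and F: "subalgebra M F"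
    and Y[measurable]: "Y \<in> borel_measurable M" and Y01: "\<And>\<omega>. \<omega> \<in> space M \<Longrightarrow> 0 \<le> Y \<omega> \<and> Y \<omega> < 1"
  obtains \<mu> where "\<mu> \<in> F \<rightarrow>\<^sub>M prob_algebra borel"
    "\<And>h B. (\<lambda>(\<omega>, y). h \<omega> y) \<in> borel_measurable (F \<Otimes>\<^sub>M borel) \<Longrightarrow>
      (\<And>\<omega> y. \<omega> \<in> space M \<Longrightarrow> \<bar>h \<omega> y\<bar> \<le> (B::real)) \<Longrightarrow>
      (\<integral>\<omega>. \<integral>y. h \<omega> y \<partial>\<mu> \<omega> \<partial>M) = (\<integral>\<omega>. h \<omega> (Y \<omega>) \<partial>M)"
proof -
  interpret prob_space M by fact
  interpret finite_measure_subalgebra M F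
    by unfold_locales (rule F)
  have spF: "space F = space M" and setsF: "\<And>A. A \<in> sets F \<Longrightarrow> A \<in> sets M"
    using F by (auto simp: subalgebra_def)
  have FM: "f \<in> borel_measurable M" if "f \<in> borel_measurable F" for f :: "'a \<Rightarrow> real"
    using measurable_from_subalg[OF F that] .
  define E where "E q = real_cond_exp M F (indicator {\<omega> \<in> space M. Y \<omega> \<le> q})" for q
  define C where "C q \<omega> = min 1 (max 0 (E q \<omega>))" for q \<omega>
  define G where "G \<omega> x = (if x < 0 then 0 else if 1 \<le> x then 1 else (INF q\<in>{q\<in>\<rat>. x < q}. C q \<omega>))" for \<omega> x
  have C01: "0 \<le> C q \<omega>" "C q \<omega> \<le> 1" for q \<omega>
    by (auto simp: C_def)
  have EF[measurable]: "E q \<in> borel_measurable F" for q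
    by (simp add: E_def)
  have CF[measurable]: "C q \<in> borel_measurable F" for q
    unfolding C_def by measurable
  have ind_int: "integrable M (indicator {\<omega> \<in> space M. Y \<omega> \<le> q} :: 'a \<Rightarrow> real)" for q
    by (intro integrable_const_bound[of _ 1]) auto
  have EC: "AE \<omega> in M. C q \<omega> = E q \<omega>" for q
  proof -
    have "AE \<omega> in M. E q \<omega> \<ge> 0"
      unfolding E_def by (rule real_cond_exp_ge_c[OF ind_int]) auto
    moreover have "AE \<omega> in M. E q \<omega> \<le> 1"
      unfolding E_def by (rule real_cond_exp_le_c[OF ind_int]) auto
    ultimately show ?thesis
      by eventually_elim (simp add: C_def)
  qed
  have CA: "(\<integral>\<omega>. indicator A \<omega> * C q \<omega> \<partial>M) = measure M (A \<inter> {\<omega> \<in> space M. Y \<omega> \<le> q})" if A: "A \<in> sets F" for A q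
  proof -
    have [measurable]: "A \<in> sets M"
      using A setsF by auto
    have [measurable]: "C q \<in> borel_measurable M" "E q \<in> borel_measurable M"
      by (simp_all add: FM)
    have "(\<integral>\<omega>. indicator A \<omega> * C q \<omega> \<partial>M) = (\<integral>\<omega>. indicator A \<omega> * E q \<omega> \<partial>M)"
    proof (rule integral_cong_AE)
      show "AE \<omega> in M. indicator A \<omega> * C q \<omega> = indicator A \<omega> * E q \<omega>"
        using EC[of q] by eventually_elim simp
    qed measurable
    also have "\<dots> = (\<integral>\<omega>. indicator A \<omega> * indicator {\<omega> \<in> space M. Y \<omega> \<le> q} \<omega> \<partial>M)"
      using real_cond_exp_intA[OF ind_int A, of q] by (simp add: E_def set_lebesgue_integral_def)
    also have "\<dots> = (\<integral>\<omega>. indicator (A \<inter> {\<omega> \<in> space M. Y \<omega> \<le> q}) \<omega> \<partial>M)"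
      by (simp add: indicator_inter_arith)
    finally show ?thesis
      using sets.sets_into_space[OF \<open>A \<in> sets M\<close>] by (simp add: Int_absorb2 Int_assoc)
  qed
  have bdd: "bdd_below ((\<lambda>q. C q \<omega>) ` X)" for X \<omega>
    by (rule bdd_belowI2[of _ 0]) (rule C01)
  have nonempty: "{q\<in>\<rat>. x < q} \<noteq> {}" for x :: real
    using Rats_dense_in_real[of x "x + 1"] by auto
  have G_le: "G \<omega> x \<le> C q \<omega>" if "0 \<le> x" "x < 1" "q \<in> \<rat>" "x < q" for \<omega> x q
    using that by (simp add: G_def cINF_lower[OF bdd])
  have G_less: "\<exists>q\<in>\<rat>. x < q \<and> C q \<omega> < c" if "G \<omega> x < c" "0 \<le> x" "x < 1" for \<omega> x c
    using that nonempty[of x] bdd[of \<omega>] by (auto simp: G_def cINF_less_iff)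
  have G_ge: "c \<le> G \<omega> x" if "0 \<le> x" "x < 1" "\<And>q. q \<in> \<rat> \<Longrightarrow> x < q \<Longrightarrow> c \<le> C q \<omega>" for \<omega> x c
    using that nonempty[of x] by (auto simp: G_def intro!: cINF_greatest)
  have G01: "0 \<le> G \<omega> x" "G \<omega> x \<le> 1" for \<omega> x
  proof -
    show "0 \<le> G \<omega> x"
      using G_ge[of x 0 \<omega>] C01 by (cases "0 \<le> x \<and> x < 1") (auto simp: G_def)
    obtain q where "q \<in> \<rat>" "x < q"
      using nonempty[of x] by auto
    then show "G \<omega> x \<le> 1"
      using G_le[of x q \<omega>] C01(2)[of q \<omega>] by (cases "0 \<le> x \<and> x < 1") (auto simp: G_def)
  qed
  have mono: "G \<omega> x \<le> G \<omega> y" if "x \<le> y" for \<omega> x y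
  proof (cases "0 \<le> x \<and> y < 1")
    case True
    then show ?thesis
      using that by (intro G_ge) (auto intro!: G_le)
  next
    case False
    then show ?thesis
      using that G01[of \<omega> x] G01[of \<omega> y] by (auto simp: G_def)
  qed
  have right: "continuous (at_right a) (G \<omega>)" for \<omega> a
    unfolding continuous_within
  proof (rule decreasing_tendsto)
    show "\<forall>\<^sub>F y in at_right a. G \<omega> a \<le> G \<omega> y"
      by (auto simp: eventually_at_filter intro!: always_eventually mono)
    fix c assume c: "G \<omega> a < c"
    consider "a < 0" | "1 \<le> a" | "0 \<le> a" "a < 1" by linarith
    then show "\<forall>\<^sub>F y in at_right a. G \<omega> y < c"
    proof cases
      case 1
      then show ?thesis
        using c by (auto simp: eventually_at_right[of a 0] G_def intro!: exI[of _ 0])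
    next
      case 2
      then show ?thesis
        using c by (auto simp: eventually_at_right[of a "a+1"] G_def intro!: exI[of _ "a+1"])
    next
      case 3
      obtain q where q: "q \<in> \<rat>" "a < q" "C q \<omega> < c"
        using G_less[OF c 3] by auto
      have "G \<omega> y < c" if "a < y" "y < min q 1" for y
        using G_le[of y q \<omega>] q 3 that by simp
      then show ?thesis
        using q 3 unfolding eventually_at_right[of a 1, OF \<open>a < 1\<close>] by (intro exI[of _ "min q 1"]) auto
    qed
  qed
  have bot: "(G \<omega> \<longlongrightarrow> 0) at_bot" for \<omega>
    by (rule tendsto_eventually) (auto simp: eventually_at_bot_linorder G_def intro!: exI[of _ "-1"])
  have top: "(G \<omega> \<longlongrightarrow> 1) at_top" for \<omega>
    by (rule tendsto_eventually) (auto simp: eventually_at_top_linorder G_def intro!: exI[of _ 1])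
  have GF[measurable]: "(\<lambda>\<omega>. G \<omega> x) \<in> borel_measurable F" for x
  proof -
    have "countable {q \<in> \<rat>. x < q}"
      using countable_rat by (rule countable_subset[rotated]) auto
    then have "(\<lambda>\<omega>. INF q\<in>{q\<in>\<rat>. x < q}. C q \<omega>) \<in> borel_measurable F"
      using bdd by (intro borel_measurable_cINF) auto
    then show ?thesis
      unfolding G_def by auto
  qed
  define \<mu> where "\<mu> \<omega> = interval_measure (G \<omega>)" for \<omega>
  interpret \<mu>: real_distribution "\<mu> \<omega>" for \<omega>
    unfolding \<mu>_def by (rule real_distribution_interval_measure[OF mono right bot top])
  have Iic: "emeasure (\<mu> \<omega>) {..x} = ennreal (G \<omega> x)" for \<omega> x
    unfolding \<mu>_def by (rule emeasure_interval_measure_Iic[OF mono right bot])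
  have Int_stable: "Int_stable (range (\<lambda>x::real. {..x}))"
    by (auto simp: Int_stable_def)
  have borel: "sets borel = sigma_sets UNIV (range (\<lambda>x::real. {..x}))"
    by (subst borel_eq_atMost) auto
  have \<mu>[measurable]: "\<mu> \<in> F \<rightarrow>\<^sub>M prob_algebra borel"
    by (rule measurable_prob_algebra_generated[OF borel Int_stable])
       (auto simp: Iic \<mu>.prob_space_axioms)
  \<comment> \<open>Outside a null set the conditional probabilities increase along the rationals, so that the infimum
    is their limit along any sequence of rationals that decreases to \<open>x\<close>.\<close>
  have mono_AE: "AE \<omega> in M. \<forall>p\<in>\<rat>. \<forall>q\<in>\<rat>. p \<le> q \<longrightarrow> C p \<omega> \<le> C q \<omega>"
  proof -
    have "AE \<omega> in M. p \<le> q \<longrightarrow> C p \<omega> \<le> C q \<omega>" for p q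
    proof (cases "p \<le> q")
      case True
      have "AE \<omega> in M. E p \<omega> \<le> E q \<omega>"
        unfolding E_def using True by (intro real_cond_exp_mono ind_int) (auto simp: indicator_def)
      with EC[of p] EC[of q] show ?thesis
        by eventually_elim simp
    qed simp
    then show ?thesis
      by (simp add: AE_ball_countable countable_rat)
  qed
  have G_int: "(\<integral>\<omega>. indicator A \<omega> * G \<omega> x \<partial>M) = measure M (A \<inter> {\<omega> \<in> space M. Y \<omega> \<le> x})"
    if A: "A \<in> sets F" for A x
  proof -
    have [measurable]: "A \<in> sets M"
      using A setsF by auto
    have [measurable]: "(\<lambda>\<omega>. G \<omega> x) \<in> borel_measurable M" "C q \<in> borel_measurable M" for x q
      by (simp_all add: FM)
    consider "x < 0" | "1 \<le> x" | "0 \<le> x" "x < 1" by linarith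
    then show ?thesis
    proof cases
      case 1
      then have "{\<omega> \<in> space M. Y \<omega> \<le> x} = {}"
        using Y01 by force
      with 1 show ?thesis
        by (simp only: G_def) simp
    next
      case 2
      then have "A \<inter> {\<omega> \<in> space M. Y \<omega> \<le> x} = A"
        using Y01 sets.sets_into_space[OF \<open>A \<in> sets M\<close>] by force
      with 2 show ?thesis
        using sets.sets_into_space[OF \<open>A \<in> sets M\<close>] by (simp add: G_def Int_absorb2)
    next
      case 3
      have "\<exists>q\<in>\<rat>. x < q \<and> q < x + inverse (real (Suc n))" for n
        using Rats_dense_in_real[of x "x + inverse (real (Suc n))"] by auto
      then obtain q where q: "\<And>n. q n \<in> \<rat>" "\<And>n. x < q n" "\<And>n. q n < x + inverse (real (Suc n))"
        by metis
      have qx: "q \<longlonglongrightarrow> x"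
      proof (rule real_tendsto_sandwich)
        show "\<forall>\<^sub>F n in sequentially. x \<le> q n" "\<forall>\<^sub>F n in sequentially. q n \<le> x + inverse (real (Suc n))"
          using q by (auto intro!: always_eventually less_imp_le simp del: of_nat_Suc)
        show "(\<lambda>n. x + inverse (real (Suc n))) \<longlonglongrightarrow> x"
          using tendsto_add[OF tendsto_const LIMSEQ_inverse_real_of_nat, of x] by simp
      qed simp
      have "AE \<omega> in M. (\<lambda>n. C (q n) \<omega>) \<longlonglongrightarrow> G \<omega> x"
        using mono_AE
      proof eventually_elim
        case (elim \<omega>)
        note mono_\<omega> = elim
        show ?case
        proof (rule decreasing_tendsto)
          show "\<forall>\<^sub>F n in sequentially. G \<omega> x \<le> C (q n) \<omega>"
            using G_le 3 q by auto
          fix c assume "G \<omega> x < c"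
          then obtain p where p: "p \<in> \<rat>" "x < p" "C p \<omega> < c"
            using G_less 3 by blast
          have "\<forall>\<^sub>F n in sequentially. q n < p"
            using order_tendstoD(2)[OF qx p(2)] .
          then show "\<forall>\<^sub>F n in sequentially. C (q n) \<omega> < c"
          proof eventually_elim
            case (elim n)
            then have "C (q n) \<omega> \<le> C p \<omega>"
              using mono_\<omega> q(1)[of n] p(1) by auto
            with p(3) show ?case
              by simp
          qed
        qed
      qed
      then have "(\<lambda>n. \<integral>\<omega>. indicator A \<omega> * C (q n) \<omega> \<partial>M) \<longlonglongrightarrow> (\<integral>\<omega>. indicator A \<omega> * G \<omega> x \<partial>M)"
      proof (intro integral_dominated_convergence[where w = "\<lambda>_. 1"])
        assume "AE \<omega> in M. (\<lambda>n. C (q n) \<omega>) \<longlonglongrightarrow> G \<omega> x"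
        then show "AE \<omega> in M. (\<lambda>n. indicator A \<omega> * C (q n) \<omega>) \<longlonglongrightarrow> indicator A \<omega> * G \<omega> x"
          by eventually_elim (rule tendsto_mult_left)
      qed (use C01 in \<open>auto simp: indicator_def\<close>)
      moreover have "(\<lambda>n. \<integral>\<omega>. indicator A \<omega> * C (q n) \<omega> \<partial>M) \<longlonglongrightarrow>
          measure M (A \<inter> {\<omega> \<in> space M. Y \<omega> \<le> x})"
      proof -
        have *: "measure M (A \<inter> {\<omega> \<in> space M. Y \<omega> \<le> c}) = (\<integral>\<omega>. indicator (A \<inter> {\<omega> \<in> space M. Y \<omega> \<le> c}) \<omega> \<partial>M)" for c
          using sets.sets_into_space[OF \<open>A \<in> sets M\<close>] by (simp add: Int_absorb2 Int_assoc)
        have "(\<lambda>n. \<integral>\<omega>. indicator (A \<inter> {\<omega> \<in> space M. Y \<omega> \<le> q n}) \<omega> \<partial>M) \<longlonglongrightarrow>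
            (\<integral>\<omega>. (indicator (A \<inter> {\<omega> \<in> space M. Y \<omega> \<le> x}) \<omega> :: real) \<partial>M)"
        proof (intro integral_dominated_convergence[where w = "\<lambda>_. 1"] AE_I2)
          fix \<omega> assume "\<omega> \<in> space M"
          show "(\<lambda>n. indicator (A \<inter> {\<omega> \<in> space M. Y \<omega> \<le> q n}) \<omega>) \<longlonglongrightarrow>
              (indicator (A \<inter> {\<omega> \<in> space M. Y \<omega> \<le> x}) \<omega> :: real)"
          proof (cases "Y \<omega> \<le> x")
            case True
            then have "Y \<omega> \<le> q n" for n
              using q(2)[of n] by simp
            then show ?thesis
              using True by (simp add: indicator_def)
          next
            case False
            then have "\<forall>\<^sub>F n in sequentially. q n < Y \<omega>"
              using order_tendstoD(2)[OF qx] by simp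
            then show ?thesis
              using False by (intro tendsto_eventually) (auto elim!: eventually_mono)
          qed
        qed auto
        then show ?thesis
          unfolding CA[OF A] * .
      qed
      ultimately show ?thesis
        by (rule LIMSEQ_unique)
    qed
  qed
  let ?P = "F \<Otimes>\<^sub>M borel :: ('a \<times> real) measure" and ?k = "\<lambda>\<omega>. distr (\<mu> \<omega>) (F \<Otimes>\<^sub>M borel) (Pair \<omega>)"
  let ?E = "{A \<times> B |A B. A \<in> sets F \<and> B \<in> range (\<lambda>x::real. {..x})}"
  have E_sub: "?E \<subseteq> Pow (space M \<times> UNIV)"
    using sets.sets_into_space[of _ F] unfolding spF by blast
  \<comment> \<open>Products of events of the past with half-lines determine the joint law.\<close>
  have setsP: "sets ?P = sigma_sets (space M \<times> UNIV) ?E"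
  proof -
    have "sets ?P = sets (sigma (space F \<times> space (borel :: real measure)) ?E)"
    proof (rule sets_pair_eq)
      show "sets (borel :: real measure) = sigma_sets (space borel) (range (\<lambda>x::real. {..x}))"
        using borel by simp
      show "sets F = sigma_sets (space F) (sets F)"
        by (rule sets.sigma_sets_eq[symmetric])
      show "countable {space F}" "{space F} \<subseteq> sets F" "\<Union> {space F} = space F"
        by auto
      show "countable (range (\<lambda>n::nat. {..real n}))" "range (\<lambda>n::nat. {..real n}) \<subseteq> range (\<lambda>x::real. {..x})"
        "\<Union> (range (\<lambda>n::nat. {..real n})) = space borel"
        using real_arch_simple by auto
    qed (auto dest: sets.sets_into_space)
    also have "\<dots> = sigma_sets (space M \<times> UNIV) ?E"
      unfolding spF using E_sub by (simp add: sets_measure_of)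
    finally show ?thesis .
  qed
  have k: "?k \<in> M \<rightarrow>\<^sub>M prob_algebra ?P"
  proof (rule measurable_from_subalg[OF F])
    show "?k \<in> F \<rightarrow>\<^sub>M prob_algebra ?P"
      using \<mu> by (intro measurable_distr_prob_space2[where M = borel]) auto
  qed
  have Pair: "Pair \<omega> \<in> \<mu> \<omega> \<rightarrow>\<^sub>M ?P" if "\<omega> \<in> space M" for \<omega>
    using that by (simp add: spF \<mu>_def)
  have idF: "(\<lambda>\<omega>. \<omega>) \<in> M \<rightarrow>\<^sub>M F"
    using F by (auto simp: subalgebra_def measurable_def)
  have YP: "(\<lambda>\<omega>. (\<omega>, Y \<omega>)) \<in> M \<rightarrow>\<^sub>M ?P"
    using idF Y by (rule measurable_Pair)
  have eq: "M \<bind> ?k = distr M ?P (\<lambda>\<omega>. (\<omega>, Y \<omega>))"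
  proof (rule measure_eqI_generator_eq[where E = ?E and \<Omega> = "space M \<times> UNIV"])
    show "Int_stable ?E"
    proof (rule Int_stableI)
      fix R S assume "R \<in> ?E" "S \<in> ?E"
      then obtain A B x y where "R = A \<times> {..x}" "S = B \<times> {..y}" "A \<in> sets F" "B \<in> sets F"
        by blast
      then have "R \<inter> S = (A \<inter> B) \<times> {..min x y}" "A \<inter> B \<in> sets F"
        by auto
      then show "R \<inter> S \<in> ?E"
        by blast
    qed
    show "emeasure (M \<bind> ?k) R = emeasure (distr M ?P (\<lambda>\<omega>. (\<omega>, Y \<omega>))) R" if RE: "R \<in> ?E" for R
    proof -
      obtain A x where R: "R = A \<times> {..x}" and A: "A \<in> sets F"
        using RE by blast
      have RP: "R \<in> sets ?P"
        using A by (simp add: R)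
      have "emeasure (?k \<omega>) R = ennreal (indicator A \<omega> * G \<omega> x)" if "\<omega> \<in> space M" for \<omega>
      proof -
        have "Pair \<omega> -` R \<inter> space (\<mu> \<omega>) = (if \<omega> \<in> A then {..x} else {})"
          by (auto simp: R)
        then show ?thesis
          using emeasure_distr[OF Pair[OF that] RP] by (simp add: Iic)
      qed
      then have "emeasure (M \<bind> ?k) R = (\<integral>\<^sup>+\<omega>. ennreal (indicator A \<omega> * G \<omega> x) \<partial>M)"
        using emeasure_bind[OF not_empty measurable_prob_algebraD[OF k] RP] by (simp cong: nn_integral_cong)
      also have "\<dots> = ennreal (\<integral>\<omega>. indicator A \<omega> * G \<omega> x \<partial>M)"
        using G01 FM[OF GF] setsF[OF A]
        by (intro nn_integral_eq_integral integrable_const_bound[of _ 1]) (auto simp: indicator_def)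
      also have "\<dots> = emeasure M (A \<inter> {\<omega> \<in> space M. Y \<omega> \<le> x})"
        by (simp add: G_int[OF A] emeasure_eq_measure)
      also have "A \<inter> {\<omega> \<in> space M. Y \<omega> \<le> x} = (\<lambda>\<omega>. (\<omega>, Y \<omega>)) -` R \<inter> space M"
        by (auto simp: R)
      finally show ?thesis
        by (simp only: emeasure_distr[OF YP RP])
    qed
    show "sets (M \<bind> ?k) = sigma_sets (space M \<times> UNIV) ?E"
      using prob_space_bind_kernel(2)[OF prob_space_axioms k] setsP by simp
    show "sets (distr M ?P (\<lambda>\<omega>. (\<omega>, Y \<omega>))) = sigma_sets (space M \<times> UNIV) ?E"
      using setsP by simp
    show "range (\<lambda>n::nat. space M \<times> {..real n}) \<subseteq> ?E"
      using sets.top[of F] unfolding spF by blast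
    show "(\<Union>n::nat. space M \<times> {..real n}) = space M \<times> UNIV"
      using real_arch_simple by auto
    show "?E \<subseteq> Pow (space M \<times> UNIV)"
      by (rule E_sub)
    show "emeasure (M \<bind> ?k) (space M \<times> {..real n}) \<noteq> \<infinity>" for n
      using prob_space_bind_kernel(1)[OF prob_space_axioms k]
      by (simp add: finite_measure.emeasure_finite prob_space.finite_measure)
  qed
  have "(\<integral>\<omega>. \<integral>y. h \<omega> y \<partial>\<mu> \<omega> \<partial>M) = (\<integral>\<omega>. h \<omega> (Y \<omega>) \<partial>M)"
    if h: "(\<lambda>(\<omega>, y). h \<omega> y) \<in> borel_measurable ?P"
      and B: "\<And>\<omega> y. \<omega> \<in> space M \<Longrightarrow> \<bar>h \<omega> y\<bar> \<le> B" for h and B :: real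
  proof -
    have "(\<integral>\<omega>. \<integral>y. h \<omega> y \<partial>\<mu> \<omega> \<partial>M) = (\<integral>\<omega>. \<integral>z. (\<lambda>(\<omega>, y). h \<omega> y) z \<partial>?k \<omega> \<partial>M)"
    proof (rule Bochner_Integration.integral_cong)
      fix \<omega> assume "\<omega> \<in> space M"
      from integral_distr[OF Pair[OF this] h]
      show "(\<integral>y. h \<omega> y \<partial>\<mu> \<omega>) = (\<integral>z. (\<lambda>(\<omega>, y). h \<omega> y) z \<partial>?k \<omega>)"
        by simp
    qed simp
    also have "\<dots> = (\<integral>z. (\<lambda>(\<omega>, y). h \<omega> y) z \<partial>(M \<bind> ?k))"
      using B by (intro integral_bind_kernel[OF prob_space_axioms k h, symmetric, of B]) (auto simp: space_pair_measure spF)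
    also have "\<dots> = (\<integral>\<omega>. h \<omega> (Y \<omega>) \<partial>M)"
      unfolding eq using YP h by (simp add: integral_distr)
    finally show ?thesis .
  qed
  note * = this
  show ?thesis
    by (rule that[OF \<mu>], erule *) assumption
qed

text \<open>A measurable retract of an interval inherits conditional distributions from the real line, by
  transport along \<open>e\<close> and \<open>d\<close>. The formula is stated for functions of the past and of \<open>X\<close> jointly,
  because the starting point of the future path is part of the past.\<close>

lemma retract_conditional_distribution:
  fixes e :: "'b \<Rightarrow> real"
  assumes M: "prob_space M" and F: "subalgebra M F" and X[measurable]: "X \<in> M \<rightarrow>\<^sub>M N"
    and e[measurable]: "e \<in> borel_measurable N" and e01: "\<And>x. x \<in> space N \<Longrightarrow> 0 \<le> e x \<and> e x < 1"
    and d[measurable]: "d \<in> borel \<rightarrow>\<^sub>M N" and de: "\<And>x. x \<in> space N \<Longrightarrow> d (e x) = x"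
  obtains \<rho> where "\<rho> \<in> F \<rightarrow>\<^sub>M prob_algebra N"
    "\<And>h B. (\<lambda>(\<omega>, x). h \<omega> x) \<in> borel_measurable (F \<Otimes>\<^sub>M N) \<Longrightarrow>
      (\<And>\<omega> x. \<omega> \<in> space M \<Longrightarrow> x \<in> space N \<Longrightarrow> \<bar>h \<omega> x\<bar> \<le> (B::real)) \<Longrightarrow>
      (\<integral>\<omega>. \<integral>x. h \<omega> x \<partial>\<rho> \<omega> \<partial>M) = (\<integral>\<omega>. h \<omega> (X \<omega>) \<partial>M)"
proof -
  have spF: "space F = space M"
    using F by (simp add: subalgebra_def)
  have XN: "X \<omega> \<in> space N" if "\<omega> \<in> space M" for \<omega>
    using measurable_space[OF X that] .
  obtain \<mu> where \<mu>: "\<mu> \<in> F \<rightarrow>\<^sub>M prob_algebra borel"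
    and \<mu>E: "\<And>h B. (\<lambda>(\<omega>, y). h \<omega> y) \<in> borel_measurable (F \<Otimes>\<^sub>M borel) \<Longrightarrow>
      (\<And>\<omega> y. \<omega> \<in> space M \<Longrightarrow> \<bar>h \<omega> y\<bar> \<le> (B::real)) \<Longrightarrow>
      (\<integral>\<omega>. \<integral>y. h \<omega> y \<partial>\<mu> \<omega> \<partial>M) = (\<integral>\<omega>. h \<omega> (e (X \<omega>)) \<partial>M)"
  proof (rule real_conditional_distribution[OF M F, of "\<lambda>\<omega>. e (X \<omega>)"])
    show "(\<lambda>\<omega>. e (X \<omega>)) \<in> borel_measurable M"
      by measurable
    show "0 \<le> e (X \<omega>) \<and> e (X \<omega>) < 1" if "\<omega> \<in> space M" for \<omega>
      using e01 XN that by simp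
  qed blast
  have \<rho>: "(\<lambda>\<omega>. distr (\<mu> \<omega>) N d) \<in> F \<rightarrow>\<^sub>M prob_algebra N"
    using \<mu> by (rule measurable_compose) (rule measurable_distr_prob_space[OF d])
  have "(\<integral>\<omega>. \<integral>x. h \<omega> x \<partial>distr (\<mu> \<omega>) N d \<partial>M) = (\<integral>\<omega>. h \<omega> (X \<omega>) \<partial>M)"
    if h: "(\<lambda>(\<omega>, x). h \<omega> x) \<in> borel_measurable (F \<Otimes>\<^sub>M N)"
      and B: "\<And>\<omega> x. \<omega> \<in> space M \<Longrightarrow> x \<in> space N \<Longrightarrow> \<bar>h \<omega> x\<bar> \<le> B" for h and B :: real
  proof -
    have "(\<integral>x. h \<omega> x \<partial>distr (\<mu> \<omega>) N d) = (\<integral>y. h \<omega> (d y) \<partial>\<mu> \<omega>)" if "\<omega> \<in> space M" for \<omega>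
    proof (rule integral_distr)
      show "d \<in> \<mu> \<omega> \<rightarrow>\<^sub>M N"
        using d kernel_prob_space(2)[OF \<mu>] that by (simp add: spF cong: measurable_cong_sets)
      show "h \<omega> \<in> borel_measurable N"
        using measurable_Pair2[OF h, of \<omega>] that by (simp add: spF)
    qed
    then have "(\<integral>\<omega>. \<integral>x. h \<omega> x \<partial>distr (\<mu> \<omega>) N d \<partial>M) = (\<integral>\<omega>. \<integral>y. h \<omega> (d y) \<partial>\<mu> \<omega> \<partial>M)"
      by (intro Bochner_Integration.integral_cong) auto
    also have "\<dots> = (\<integral>\<omega>. h \<omega> (d (e (X \<omega>))) \<partial>M)"
    \<comment> \<open>The coded variable is decoded inside of the test function.\<close>
    proof (rule \<mu>E)
      have "(\<lambda>p. (fst p, d (snd p))) \<in> F \<Otimes>\<^sub>M borel \<rightarrow>\<^sub>M F \<Otimes>\<^sub>M N"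
        by measurable
      from measurable_compose[OF this h]
      show "(\<lambda>(\<omega>, y). h \<omega> (d y)) \<in> borel_measurable (F \<Otimes>\<^sub>M borel)"
        by (simp add: case_prod_beta)
      show "\<bar>h \<omega> (d y)\<bar> \<le> B" if "\<omega> \<in> space M" for \<omega> y
        using measurable_space[OF d, of y] that by (intro B) auto
    qed
    also have "\<dots> = (\<integral>\<omega>. h \<omega> (X \<omega>) \<partial>M)"
      using XN de by (intro Bochner_Integration.integral_cong) auto
    finally show ?thesis .
  qed
  note * = this
  show ?thesis
    by (rule that[OF \<rho>], erule *) assumption
qed

section \<open>Coding a sequence of reals by one real\<close>

text \<open>The digits 0 and 1 in base 3 leave a gap between the expansions that differ in the first digit, so
  that the digit is decided by a threshold; \<open>ternary_tail n\<close> shifts an expansion by \<open>n\<close> places. All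
  these maps are Borel.\<close>

definition ternary :: "(nat \<Rightarrow> bool) \<Rightarrow> real" where
  "ternary b = (\<Sum>n. of_bool (b n) / 3 ^ Suc n)"

primrec ternary_tail :: "nat \<Rightarrow> real \<Rightarrow> real" where
  "ternary_tail 0 x = x"
| "ternary_tail (Suc n) x = 3 * ternary_tail n x - of_bool (1/3 \<le> ternary_tail n x)"

lemma ternary_summable: "summable (\<lambda>n. of_bool (b n) / 3 ^ Suc n :: real)"
proof (rule summable_comparison_test')
  show "summable (\<lambda>n. (1/3) ^ n :: real)"
    by (rule summable_geometric) simp
  show "norm (of_bool (b n) / 3 ^ Suc n :: real) \<le> (1/3) ^ n" if "0 \<le> n" for n
    by (simp add: power_divide divide_right_mono field_simps)
qed

lemma ternary_bounds: "0 \<le> ternary b" "ternary b \<le> 1/2"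
proof -
  show "0 \<le> ternary b"
    unfolding ternary_def by (intro suminf_nonneg ternary_summable) simp
  have "(\<lambda>n. (1/3) * (1/3) ^ n :: real) sums ((1/3) * (1 / (1 - 1/3)))"
    by (intro sums_mult geometric_sums) simp
  then have *: "(\<lambda>n. 1 / 3 ^ Suc n :: real) sums (1/2)"
    by (simp add: power_divide)
  show "ternary b \<le> 1/2"
    unfolding ternary_def sums_unique[OF *]
    by (intro suminf_le ternary_summable sums_summable[OF *]) (simp add: divide_right_mono)
qed

lemma ternary_split: "3 * ternary b = of_bool (b 0) + ternary (\<lambda>n. b (Suc n))"
proof -
  have "ternary b = (\<Sum>n. of_bool (b (Suc n)) / 3 ^ Suc (Suc n)) + of_bool (b 0) / 3"
    unfolding ternary_def using suminf_split_head[OF ternary_summable[of b]] by simp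
  also have "(\<Sum>n. of_bool (b (Suc n)) / 3 ^ Suc (Suc n)) = (\<Sum>n. (of_bool (b (Suc n)) / 3 ^ Suc n) / 3 :: real)"
    by simp
  also have "\<dots> = ternary (\<lambda>n. b (Suc n)) / 3"
    unfolding ternary_def using suminf_divide[OF ternary_summable, of "\<lambda>n. b (Suc n)" 3] by simp
  finally show ?thesis
    by simp
qed

lemma ternary_digit: "1/3 \<le> ternary b \<longleftrightarrow> b 0"
  using ternary_split[of b] ternary_bounds[of "\<lambda>n. b (Suc n)"] by (cases "b 0") auto

lemma ternary_tail_ternary: "ternary_tail n (ternary b) = ternary (\<lambda>k. b (n + k))"
proof (induction n)
  case (Suc n)
  then show ?case
    using ternary_split[of "\<lambda>k. b (n + k)"] ternary_digit[of "\<lambda>k. b (n + k)"] by simp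
qed simp

lemma ternary_tail_measurable[measurable]: "ternary_tail n \<in> borel_measurable borel"
proof (induction n)
  case (Suc n)
  have "(\<lambda>x. 3 * ternary_tail n x - of_bool (1/3 \<le> ternary_tail n x)) \<in> borel_measurable borel"
    unfolding of_bool_def using Suc by measurable
  then show ?case
    by simp
qed simp

definition rat_enum :: "nat \<Rightarrow> real" where
  "rat_enum = from_nat_into \<rat>"

lemma range_rat_enum: "range rat_enum = \<rat>"
  unfolding rat_enum_def by (rule range_from_nat_into) (auto simp: countable_rat)

text \<open>A real is determined by the rationals above it. The digits of the code list the comparisons of all
  members of the sequence with all rationals; each member is then the infimum of the rationals above it.
  For a real that is not a code, this infimum may be infinite.\<close>

definition seq_code :: "(nat \<Rightarrow> real) \<Rightarrow> real" where
  "seq_code f = ternary (\<lambda>m. case prod_decode m of (n, k) \<Rightarrow> f n \<le> rat_enum k)"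

definition seq_decode :: "real \<Rightarrow> nat \<Rightarrow> real" where
  "seq_decode x n = real_of_ereal
     (INF k. if 1/3 \<le> ternary_tail (prod_encode (n, k)) x then ereal (rat_enum k) else \<infinity>)"

lemma seq_decode_code: "seq_decode (seq_code f) n = f n"
proof -
  have "(1/3 \<le> ternary_tail (prod_encode (n, k)) (seq_code f)) = (f n \<le> rat_enum k)" for k
    unfolding seq_code_def ternary_tail_ternary ternary_digit by simp
  then have "seq_decode (seq_code f) n = real_of_ereal (INF k. if f n \<le> rat_enum k then ereal (rat_enum k) else \<infinity>)"
    by (simp add: seq_decode_def)
  also have "(INF k. if f n \<le> rat_enum k then ereal (rat_enum k) else \<infinity>) = ereal (f n)"
  proof (rule antisym)
    show "ereal (f n) \<le> (INF k. if f n \<le> rat_enum k then ereal (rat_enum k) else \<infinity>)"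
      by (intro INF_greatest) auto
    show "(INF k. if f n \<le> rat_enum k then ereal (rat_enum k) else \<infinity>) \<le> ereal (f n)"
    proof (rule ereal_le_epsilon2)
      fix e :: real assume "0 < e"
      then obtain q where q: "q \<in> \<rat>" "f n < q" "q < f n + e"
        using Rats_dense_in_real[of "f n" "f n + e"] by auto
      then obtain k where k: "q = rat_enum k"
        using range_rat_enum by (metis imageE)
      have "(INF k. if f n \<le> rat_enum k then ereal (rat_enum k) else \<infinity>) \<le> ereal q"
        using q k by (intro INF_lower2[of k]) auto
      also have "\<dots> \<le> ereal (f n) + ereal e"
        using q by simp
      finally show "(INF k. if f n \<le> rat_enum k then ereal (rat_enum k) else \<infinity>) \<le> ereal (f n) + ereal e" .
    qed
  qed
  finally show ?thesis
    by simp
qed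

lemma seq_code_bounds: "0 \<le> seq_code f" "seq_code f < 1"
  using ternary_bounds[of "\<lambda>m. case prod_decode m of (n, k) \<Rightarrow> f n \<le> rat_enum k"]
  by (auto simp: seq_code_def)

lemma seq_code_measurable:
  assumes "\<And>n. (\<lambda>\<omega>. g \<omega> n) \<in> borel_measurable M"
  shows "(\<lambda>\<omega>. seq_code (g \<omega>)) \<in> borel_measurable M"
proof -
  have "(\<lambda>\<omega>. of_bool (case prod_decode m of (n, k) \<Rightarrow> g \<omega> n \<le> rat_enum k) :: real) \<in> borel_measurable M" for m
    using assms unfolding of_bool_def by (cases "prod_decode m") simp
  then show ?thesis
    unfolding seq_code_def ternary_def by (intro borel_measurable_suminf borel_measurable_divide) auto
qed

lemma seq_decode_measurable: "(\<lambda>x. seq_decode x n) \<in> borel_measurable borel"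
  unfolding seq_decode_def by measurable

section \<open>Martingales as processes with centered increments\<close>

text \<open>The defining integral identity of conditional expectations. In this form the martingale property can be
  pulled through restriction, gluing and conditioning of measures.\<close>

lemma martingale_on_iff:
  assumes M: "prob_space M"
    and F: "\<And>u. u \<in> {r..t} \<Longrightarrow> subalgebra M (F u)"
    and X: "\<And>u. u \<in> {r..t} \<Longrightarrow> X u \<in> borel_measurable (F u)"
    and int: "\<And>u. u \<in> {r..t} \<Longrightarrow> integrable M (X u)"
  shows "martingale_on M F r t X \<longleftrightarrow>
    (\<forall>u v A. r \<le> u \<and> u \<le> v \<and> v \<le> t \<and> A \<in> sets (F u) \<longrightarrow>
      (\<integral>\<omega>. indicator A \<omega> * (X v \<omega> - X u \<omega>) \<partial>M) = 0)"
proof -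
  interpret prob_space M by fact
  have "(AE \<omega> in M. real_cond_exp M (F u) (X v) \<omega> = X u \<omega>) \<longleftrightarrow>
      (\<forall>A\<in>sets (F u). (\<integral>\<omega>. indicator A \<omega> * (X v \<omega> - X u \<omega>) \<partial>M) = 0)"
    if uv: "r \<le> u" "u \<le> v" "v \<le> t" for u v
  proof -
    have u: "u \<in> {r..t}" and v: "v \<in> {r..t}"
      using uv by auto
    interpret finite_measure_subalgebra M "F u"
      by unfold_locales (rule F[OF u])
    have A: "A \<in> sets M" if "A \<in> sets (F u)" for A
      using F[OF u] that by (auto simp: subalgebra_def)
    have Aint: "integrable M (\<lambda>\<omega>. indicator A \<omega> * X w \<omega>)" if "A \<in> sets (F u)" "w \<in> {r..t}" for A w
      using integrable_mult_indicator[OF A[OF that(1)] int[OF that(2)]] by simp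
    have diff: "(\<integral>\<omega>. indicator A \<omega> * (X v \<omega> - X u \<omega>) \<partial>M) =
        (\<integral>\<omega>. indicator A \<omega> * X v \<omega> \<partial>M) - (\<integral>\<omega>. indicator A \<omega> * X u \<omega> \<partial>M)" if "A \<in> sets (F u)" for A
      using Aint[OF that u] Aint[OF that v] by (simp add: right_diff_distrib)
    show ?thesis
    proof
      assume AE: "AE \<omega> in M. real_cond_exp M (F u) (X v) \<omega> = X u \<omega>"
      show "\<forall>A\<in>sets (F u). (\<integral>\<omega>. indicator A \<omega> * (X v \<omega> - X u \<omega>) \<partial>M) = 0"
      proof
        fix B assume B: "B \<in> sets (F u)"
        have "(\<integral>\<omega>. indicator B \<omega> * X v \<omega> \<partial>M) = (\<integral>\<omega>. indicator B \<omega> * real_cond_exp M (F u) (X v) \<omega> \<partial>M)"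
          using real_cond_exp_intA[OF int[OF v] B] by (simp add: set_lebesgue_integral_def)
        also have "\<dots> = (\<integral>\<omega>. indicator B \<omega> * X u \<omega> \<partial>M)"
        proof (rule integral_cong_AE)
          show "AE \<omega> in M. indicator B \<omega> * real_cond_exp M (F u) (X v) \<omega> = indicator B \<omega> * X u \<omega>"
            using AE by eventually_elim simp
        qed (use A[OF B] int[OF u] in \<open>auto intro!: borel_measurable_times borel_measurable_indicator\<close>)
        finally show "(\<integral>\<omega>. indicator B \<omega> * (X v \<omega> - X u \<omega>) \<partial>M) = 0"
          using diff[OF B] by simp
      qed
    next
      assume "\<forall>A\<in>sets (F u). (\<integral>\<omega>. indicator A \<omega> * (X v \<omega> - X u \<omega>) \<partial>M) = 0"
      then show "AE \<omega> in M. real_cond_exp M (F u) (X v) \<omega> = X u \<omega>"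
        using diff int[OF u] int[OF v] X[OF u]
        by (intro real_cond_exp_charact) (auto simp: set_lebesgue_integral_def)
    qed
  qed
  then have "(\<forall>u v. r \<le> u \<and> u \<le> v \<and> v \<le> t \<longrightarrow> (AE \<omega> in M. real_cond_exp M (F u) (X v) \<omega> = X u \<omega>)) \<longleftrightarrow>
    (\<forall>u v. r \<le> u \<and> u \<le> v \<and> v \<le> t \<longrightarrow>
      (\<forall>A\<in>sets (F u). (\<integral>\<omega>. indicator A \<omega> * (X v \<omega> - X u \<omega>) \<partial>M) = 0))"
    by (simp cong: imp_cong)
  moreover have "\<forall>u\<in>{r..t}. subalgebra M (F u) \<and> X u \<in> borel_measurable (F u) \<and> integrable M (X u)"
    using F X int by simp
  ultimately show ?thesis
    unfolding martingale_on_def by blast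
qed

section \<open>Path spaces\<close>

lemma space_path_sigma[simp]: "space (path_sigma \<kappa> r t u) = path_space \<kappa> r t"
  unfolding path_sigma_def by (rule space_measure_of) auto

lemma path_coordinate_measurable:
  assumes "r \<le> v" "v \<le> u"
  shows "(\<lambda>\<omega>. \<omega> v) \<in> borel_measurable (path_sigma \<kappa> r t u)"
proof (rule measurableI)
  fix A :: "(real ^ 'a) set" assume "A \<in> sets borel"
  then show "(\<lambda>\<omega>. \<omega> v) -` A \<inter> space (path_sigma \<kappa> r t u) \<in> sets (path_sigma \<kappa> r t u)"
    unfolding space_path_sigma unfolding path_sigma_def using assms
    by (intro in_measure_of) auto
qed simp

lemma measurable_path_sigma:
  fixes f :: "'a \<Rightarrow> 'n::finite path"
  assumes "\<And>x. x \<in> space M \<Longrightarrow> f x \<in> path_space \<kappa> r t"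
    and "\<And>v. r \<le> v \<Longrightarrow> v \<le> u \<Longrightarrow> (\<lambda>x. f x v) \<in> borel_measurable M"
  shows "f \<in> M \<rightarrow>\<^sub>M path_sigma \<kappa> r t u"
  unfolding path_sigma_def
proof (rule measurable_measure_of)
  show "f \<in> space M \<rightarrow> path_space \<kappa> r t"
    using assms(1) by auto
  fix A :: "'n path set"
  assume "A \<in> {(\<lambda>\<omega>. \<omega> v) -` A \<inter> path_space \<kappa> r t | v A. v \<in> {r..u} \<and> A \<in> sets borel}"
  then obtain v B where "A = (\<lambda>\<omega>. \<omega> v) -` B \<inter> path_space \<kappa> r t" "r \<le> v" "v \<le> u" "B \<in> sets borel"
    by auto
  moreover from this have "f -` A \<inter> space M = (\<lambda>x. f x v) -` B \<inter> space M"
    using assms(1) by auto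
  ultimately show "f -` A \<inter> space M \<in> sets M"
    using measurable_sets[OF assms(2)] by simp
qed auto

lemma subalgebra_path_sigma:
  assumes "u \<le> v"
  shows "subalgebra (path_sigma \<kappa> r t v) (path_sigma \<kappa> r t u)"
proof -
  have "(\<lambda>\<omega>. \<omega>) \<in> path_sigma \<kappa> r t v \<rightarrow>\<^sub>M path_sigma \<kappa> r t u"
    using assms by (intro measurable_path_sigma path_coordinate_measurable) auto
  then have "A \<in> sets (path_sigma \<kappa> r t v)" if "A \<in> sets (path_sigma \<kappa> r t u)" for A
  proof -
    have "(\<lambda>\<omega>. \<omega>) -` A \<inter> path_space \<kappa> r t = A"
      using sets.sets_into_space[OF that] by auto
    then show ?thesis
      using measurable_sets[OF \<open>(\<lambda>\<omega>. \<omega>) \<in> _\<close> that] by simp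
  qed
  then show ?thesis
    by (auto simp: subalgebra_def)
qed

lemma path_sigma_mono:
  "u \<le> v \<Longrightarrow> A \<in> sets (path_sigma \<kappa> r t u) \<Longrightarrow> A \<in> sets (path_sigma \<kappa> r t v)"
  using subalgebra_path_sigma[of u v \<kappa> r t] by (auto simp: subalgebra_def)

lemma measurable_path_sigma_mono:
  "u \<le> v \<Longrightarrow> f \<in> path_sigma \<kappa> r t u \<rightarrow>\<^sub>M N \<Longrightarrow> f \<in> path_sigma \<kappa> r t v \<rightarrow>\<^sub>M N"
  using measurable_from_subalg[OF subalgebra_path_sigma] .

text \<open>An event before \<open>u\<close> cannot separate two paths that agree up to \<open>u\<close>: this holds for the generators
  and passes to the \<open>\<sigma>\<close>-algebra.\<close>

lemma path_sigma_sets_local: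
  assumes "A \<in> sets (path_sigma \<kappa> r t u)" "\<omega> \<in> path_space \<kappa> r t" "\<omega>' \<in> path_space \<kappa> r t"
    and "\<And>v. r \<le> v \<Longrightarrow> v \<le> u \<Longrightarrow> \<omega> v = \<omega>' v"
  shows "\<omega> \<in> A \<longleftrightarrow> \<omega>' \<in> A"
proof -
  have "A \<in> sigma_sets (path_space \<kappa> r t)
      {(\<lambda>\<omega>. \<omega> v) -` A \<inter> path_space \<kappa> r t | v A. v \<in> {r..u} \<and> A \<in> sets borel}"
    using assms(1) unfolding path_sigma_def by (subst (asm) sets_measure_of) auto
  then show ?thesis
    by induction (use assms(2-) in auto)
qed

lemma path_sigma_measurable_local:
  fixes f :: "'n::finite path \<Rightarrow> real"
  assumes "f \<in> borel_measurable (path_sigma \<kappa> r t u)" "\<omega> \<in> path_space \<kappa> r t" "\<omega>' \<in> path_space \<kappa> r t"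
    and "\<And>v. r \<le> v \<Longrightarrow> v \<le> u \<Longrightarrow> \<omega> v = \<omega>' v"
  shows "f \<omega> = f \<omega>'"
proof -
  have "f -` {f \<omega>} \<inter> path_space \<kappa> r t \<in> sets (path_sigma \<kappa> r t u)"
    using measurable_sets[OF assms(1), of "{f \<omega>}"] by simp
  from path_sigma_sets_local[OF this assms(2-4)] show ?thesis
    using assms(2,3) by auto
qed

lemma restrict_path_measurable:
  assumes "r \<le> a" "b \<le> t" "c \<le> u"
  shows "(\<lambda>\<omega>. restrict \<omega> {a..b}) \<in> path_sigma \<kappa> r t u \<rightarrow>\<^sub>M path_sigma \<kappa> a b c"
proof (rule measurable_path_sigma)
  show "restrict \<omega> {a..b} \<in> path_space \<kappa> a b" if "\<omega> \<in> space (path_sigma \<kappa> r t u)" for \<omega>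
    using that assms by (intro restrict_in_path_space) auto
  show "(\<lambda>\<omega>. restrict \<omega> {a..b} v) \<in> borel_measurable (path_sigma \<kappa> r t u)" if "a \<le> v" "v \<le> c" for v
    using that assms path_coordinate_measurable[of r v u \<kappa> t] by (cases "v \<le> b") auto
qed

lemma cadlag_on_cong:
  assumes "\<And>u. u \<in> {r..t} \<Longrightarrow> f u = g u"
  shows "cadlag_on r t f = cadlag_on r t g"
proof -
  have "(f \<longlongrightarrow> f u) (at u within {u<..t}) = (g \<longlongrightarrow> g u) (at u within {u<..t})"
    and "(f \<longlongrightarrow> l) (at u within {r..<u}) = (g \<longlongrightarrow> l) (at u within {r..<u})" if "u \<in> {r..t}" for u l
    by (rule Lim_cong_within; use assms that in auto)+
  then show ?thesis
    unfolding cadlag_on_def by (intro ball_cong refl) blast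
qed

lemma path_space_restrict_iff:
  "restrict f {r..t} \<in> path_space \<kappa> r t \<longleftrightarrow>
    (case \<kappa> of Continuous_Paths \<Rightarrow> continuous_on {r..t} f | Cadlag_Paths \<Rightarrow> cadlag_on r t f)"
  using cadlag_on_cong[of r t "restrict f {r..t}" f]
  by (auto simp: path_space_def split: path_kind.split cong: continuous_on_cong_simp)

definition const_path :: "real \<Rightarrow> real \<Rightarrow> real ^ 'n \<Rightarrow> 'n::finite path" where
  "const_path r t y = (\<lambda>u\<in>{r..t}. y)"

lemma const_path_in_path_space: "const_path r t y \<in> path_space \<kappa> r t"
  unfolding const_path_def path_space_restrict_iff
  by (auto simp: cadlag_on_def split: path_kind.split)

text \<open>At the pasting time the second path is shifted, so it starts where the first one stops: no jump is
  created, and near any other time the pasted path is one of the two up to a constant.\<close>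

lemma paste_in_path_space:
  assumes \<omega>: "\<omega> \<in> path_space \<kappa> r t" and \<omega>': "\<omega>' \<in> path_space \<kappa> s T"
    and le: "r \<le> s" "s \<le> t" "s \<le> T"
  shows "paste r s T \<omega> \<omega>' \<in> path_space \<kappa> r T"
proof -
  let ?g = "\<lambda>u. \<omega>' u + \<omega> s - \<omega>' s" and ?f = "\<lambda>u. if u \<le> s then \<omega> u else \<omega>' u + \<omega> s - \<omega>' s"
  show ?thesis
  proof (cases \<kappa>)
    case Continuous_Paths
    have "continuous_on ({r..s} \<union> {s..T}) ?f"
    proof (rule continuous_on_If)
      show "continuous_on {r..s} \<omega>" "continuous_on {s..T} ?g"
        using \<omega> \<omega>' le Continuous_Paths
        by (auto simp: path_space_def intro!: continuous_intros elim: continuous_on_subset)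
    qed auto
    moreover have "{r..s} \<union> {s..T} = {r..T}"
      using le by auto
    ultimately show ?thesis
      using Continuous_Paths unfolding paste_def path_space_restrict_iff by simp
  next
    case Cadlag_Paths
    have \<omega>c: "cadlag_on r t \<omega>" and \<omega>'c: "cadlag_on s T \<omega>'"
      using \<omega> \<omega>' Cadlag_Paths by (auto simp: path_space_def)
    have "cadlag_on r T ?f"
      unfolding cadlag_on_def
    proof (intro ballI conjI)
      fix u assume u: "u \<in> {r..T}"
      consider "u < s" | "u = s" | "s < u" by linarith
      then show "(?f \<longlongrightarrow> ?f u) (at u within {u<..T})"
      proof cases
        case 1
        then have "(\<omega> \<longlongrightarrow> \<omega> u) (at u within {u<..t})"
          using \<omega>c u le by (auto simp: cadlag_on_def)
        then have "(\<omega> \<longlongrightarrow> \<omega> u) (at u within {u<..s})"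
          using le by (auto elim: tendsto_within_subset)
        then have "(?f \<longlongrightarrow> ?f u) (at u within {u<..s})"
          using 1 by (auto intro: Lim_transform_within[of _ _ _ _ 1])
        moreover have "at u within {u<..T} = at u within {u<..s}"
          using 1 le by (intro at_within_nhd[of u "{..<s}"]) auto
        ultimately show ?thesis by simp
      next
        case 2
        have "(\<omega>' \<longlongrightarrow> \<omega>' s) (at s within {s<..T})"
          using \<omega>'c u 2 by (auto simp: cadlag_on_def)
        then have "(?g \<longlongrightarrow> ?g s) (at s within {s<..T})"
          by (intro tendsto_intros)
        then show ?thesis
          using 2 by (auto intro: Lim_transform_within[of _ _ _ _ 1])
      next
        case 3
        have "(\<omega>' \<longlongrightarrow> \<omega>' u) (at u within {u<..T})"
          using \<omega>'c u 3 by (auto simp: cadlag_on_def)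
        then have "(?g \<longlongrightarrow> ?g u) (at u within {u<..T})"
          by (intro tendsto_intros)
        then show ?thesis
          using 3 by (auto intro: Lim_transform_within[of _ _ _ _ 1])
      qed
      show "\<exists>l. (?f \<longlongrightarrow> l) (at u within {r..<u})"
      proof (cases "u \<le> s")
        case True
        then obtain l where "(\<omega> \<longlongrightarrow> l) (at u within {r..<u})"
          using \<omega>c u le unfolding cadlag_on_def by (meson atLeastAtMost_iff order_trans)
        then have "(?f \<longlongrightarrow> l) (at u within {r..<u})"
          using True by (auto intro: Lim_transform_within[of _ _ _ _ 1])
        then show ?thesis ..
      next
        case False
        then obtain l where "(\<omega>' \<longlongrightarrow> l) (at u within {s..<u})"
          using \<omega>'c u unfolding cadlag_on_def by (meson atLeastAtMost_iff linear)
        then have "(?g \<longlongrightarrow> l + \<omega> s - \<omega>' s) (at u within {s..<u})"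
          by (intro tendsto_intros)
        then have "(?f \<longlongrightarrow> l + \<omega> s - \<omega>' s) (at u within {s..<u})"
          by (rule Lim_transform_within[where d = 1]) auto
        moreover have "at u within {r..<u} = at u within {s..<u}"
          using False le by (intro at_within_nhd[of u "{s<..}"]) auto
        ultimately show ?thesis by auto
      qed
    qed
    then show ?thesis
      using Cadlag_Paths unfolding paste_def path_space_restrict_iff by simp
  qed
qed

lemma paste_measurable:
  assumes le: "r \<le> s" "s \<le> t" "s \<le> w" "w \<le> T"
  shows "(\<lambda>(\<omega>, \<omega>'). paste r s T \<omega> \<omega>') \<in>
    path_sigma \<kappa> r t s \<Otimes>\<^sub>M path_sigma \<kappa> s T w \<rightarrow>\<^sub>M path_sigma \<kappa> r T w"
proof (rule measurable_path_sigma)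
  let ?P = "path_sigma \<kappa> r t s \<Otimes>\<^sub>M path_sigma \<kappa> s T w :: ('a path \<times> 'a path) measure"
  show "(case p of (\<omega>, \<omega>') \<Rightarrow> paste r s T \<omega> \<omega>') \<in> path_space \<kappa> r T" if "p \<in> space ?P" for p
    using that le by (auto simp: space_pair_measure intro!: paste_in_path_space)
  fix v assume v: "r \<le> v" "v \<le> w"
  have 1: "(\<lambda>p. fst p u) \<in> borel_measurable ?P" if "r \<le> u" "u \<le> s" for u
    using that by (intro measurable_compose[OF measurable_fst path_coordinate_measurable])
  have 2: "(\<lambda>p. snd p u) \<in> borel_measurable ?P" if "s \<le> u" "u \<le> w" for u
    using that by (intro measurable_compose[OF measurable_snd path_coordinate_measurable])
  show "(\<lambda>p. (case p of (\<omega>, \<omega>') \<Rightarrow> paste r s T \<omega> \<omega>') v) \<in> borel_measurable ?P"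
    using v le 1[of v] 1[of s] 2[of v] 2[of s]
    by (cases "v \<le> s") (auto simp: paste_def case_prod_beta)
qed

lemma paste_measurable_snd:
  assumes "\<omega> \<in> path_space \<kappa> r t" "r \<le> s" "s \<le> t" "s \<le> w" "w \<le> T"
  shows "paste r s T \<omega> \<in> path_sigma \<kappa> s T w \<rightarrow>\<^sub>M path_sigma \<kappa> r T w"
  using measurable_Pair2[OF paste_measurable[OF assms(2-5)], of \<omega> \<kappa>] assms(1) by simp

lemma paste_before: "r \<le> u \<Longrightarrow> u \<le> s \<Longrightarrow> s \<le> T \<Longrightarrow> paste r s T \<omega> \<omega>' u = \<omega> u"
  by (simp add: paste_def)

lemma paste_after:
  "r \<le> s \<Longrightarrow> s \<le> u \<Longrightarrow> u \<le> T \<Longrightarrow> paste r s T \<omega> \<omega>' u = \<omega>' u + \<omega> s - \<omega>' s"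
  by (simp add: paste_def)

lemma paste_after_eq:
  "r \<le> s \<Longrightarrow> s \<le> u \<Longrightarrow> u \<le> T \<Longrightarrow> \<omega>' s = \<omega> s \<Longrightarrow> paste r s T \<omega> \<omega>' u = \<omega>' u"
  by (simp add: paste_after)

lemma paste_self:
  "\<omega> \<in> path_space \<kappa> r T \<Longrightarrow> r \<le> s \<Longrightarrow> s \<le> T \<Longrightarrow> paste r s T \<omega> (restrict \<omega> {s..T}) = \<omega>"
  by (auto simp: paste_def path_space_def extensional_def)

lemma paste_assoc:
  "r \<le> s \<Longrightarrow> s \<le> t \<Longrightarrow> t \<le> T \<Longrightarrow>
    paste r t T (paste r s T \<omega> \<omega>') \<omega>'' = paste r s T \<omega> (paste s t T \<omega>' \<omega>'')"
  by (auto simp: paste_def)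

section \<open>Weakly continuous families of path measures are kernels\<close>

text \<open>The end point belongs to the set since a path need not be continuous there from the left.\<close>

definition dense_times :: "real \<Rightarrow> real \<Rightarrow> real set" where
  "dense_times r t = insert t (\<rat> \<inter> {r..t})"

lemma countable_dense_times: "countable (dense_times r t)"
  unfolding dense_times_def by (intro countable_insert countable_subset[OF _ countable_rat]) auto

lemma dense_times_subset: "r \<le> t \<Longrightarrow> dense_times r t \<subseteq> {r..t}"
  by (auto simp: dense_times_def)

lemma dense_times_between:
  assumes "r \<le> a" "a < b" "b \<le> t"
  obtains q where "q \<in> dense_times r t" "a < q" "q < b"
  using Rats_dense_in_real[OF assms(2)] assms that by (force simp: dense_times_def)

lemma path_right_continuous:
  assumes "\<omega> \<in> path_space \<kappa> r t" "r \<le> v" "v \<le> t"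
  shows "(\<omega> \<longlongrightarrow> \<omega> v) (at v within {v<..t})"
proof (cases \<kappa>)
  case Continuous_Paths
  then have "(\<omega> \<longlongrightarrow> \<omega> v) (at v within {r..t})"
    using assms by (auto simp: path_space_def continuous_on_def)
  then show ?thesis
    using assms by (auto elim: tendsto_within_subset)
qed (use assms in \<open>auto simp: path_space_def cadlag_on_def\<close>)

lemma tendsto_right_dense:
  fixes f :: "real \<Rightarrow> real"
  assumes "(f \<longlongrightarrow> l) (at v within {v<..t})" "a < l" "r \<le> v" "v < b" "b \<le> t"
  shows "\<exists>q\<in>dense_times r t. v < q \<and> q < b \<and> a < f q"
proof -
  have "\<forall>\<^sub>F x in at v within {v<..t}. a < f x"
    using assms(1,2) by (rule order_tendstoD(1))
  then obtain d where d: "0 < d" "\<And>x. x \<in> {v<..t} \<Longrightarrow> x \<noteq> v \<Longrightarrow> dist x v < d \<Longrightarrow> a < f x"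
    unfolding eventually_at by blast
  obtain q where "q \<in> dense_times r t" "v < q" "q < min b (v + d)"
    using assms d(1) by (elim dense_times_between[of r v "min b (v + d)" t, rotated 3]) auto
  then show ?thesis
    using d(2)[of q] assms by (intro bexI[of _ q]) (auto simp: dist_real_def)
qed

text \<open>Both topologies are used only through this property. For uniform convergence the time change is the
  identity.\<close>

lemma path_topology_near:
  assumes \<omega>: "\<omega> \<in> path_space \<kappa> r t" and d: "0 < d"
  shows "\<exists>V. openin (path_topology \<kappa> r t) V \<and> \<omega> \<in> V \<and>
    (\<forall>\<omega>'\<in>V. \<exists>\<tau>\<in>time_changes r t. \<forall>u\<in>{r..t}. \<bar>\<tau> u - u\<bar> \<le> d \<and> dist (\<omega> u) (\<omega>' (\<tau> u)) \<le> d)"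
proof (cases \<kappa>)
  case Continuous_Paths
  let ?m = "cfunspace (top_of_set {r..t}) (euclidean_metric :: (real ^ 'a) metric)"
  have sp: "mspace ?m = path_space Continuous_Paths r t"
    using topspace_path_topology_continuous[of r t] by (simp add: path_topology_def)
  let ?V = "mball_of ?m \<omega> d"
  have id: "id \<in> time_changes r t"
    by (auto simp: time_changes_def strict_mono_on_def)
  have "\<bar>id u - u\<bar> \<le> d \<and> dist (\<omega> u) (\<omega>' (id u)) \<le> d" if "\<omega>' \<in> ?V" "u \<in> {r..t}" for \<omega>' u
    using mdist_cfunspace_imp_mdist_le[of \<omega> "top_of_set {r..t}" euclidean_metric \<omega>' d u] that d by auto
  then have "\<forall>\<omega>'\<in>?V. \<exists>\<tau>\<in>time_changes r t. \<forall>u\<in>{r..t}. \<bar>\<tau> u - u\<bar> \<le> d \<and> dist (\<omega> u) (\<omega>' (\<tau> u)) \<le> d"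
    using id by blast
  moreover have "openin (mtopology_of ?m) ?V"
    unfolding mtopology_of_def mball_of_def
    by (rule Metric_space.openin_mball) (rule Metric_space_mspace_mdist)
  moreover have "\<omega> \<in> ?V"
  proof -
    have \<omega>': "\<omega> \<in> mspace ?m"
      using \<omega> Continuous_Paths by (simp only: sp)
    then have "mdist ?m \<omega> \<omega> = 0"
      using Metric_space.zero[OF Metric_space_mspace_mdist \<omega>' \<omega>'] by blast
    then have "mdist ?m \<omega> \<omega> < d"
      using d by linarith
    with \<omega>' show ?thesis
      unfolding in_mball_of by blast
  qed
  ultimately show ?thesis
    using Continuous_Paths unfolding path_topology_def by (auto simp only: path_kind.case)
next
  case Cadlag_Paths
  interpret Metric_space "path_space Cadlag_Paths r t" "skorokhod_dist r t :: 'a path \<Rightarrow> _"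
    by (rule Metric_space_skorokhod)
  have \<omega>': "\<omega> \<in> path_space Cadlag_Paths r t"
    using \<omega> Cadlag_Paths by simp
  have "\<exists>\<tau>\<in>time_changes r t. \<forall>u\<in>{r..t}. \<bar>\<tau> u - u\<bar> \<le> d \<and> dist (\<omega> u) (\<omega>' (\<tau> u)) \<le> d"
    if \<omega>': "\<omega>' \<in> mball \<omega> d" for \<omega>'
  proof -
    have D: "\<omega> \<in> path_space Cadlag_Paths r t" "\<omega>' \<in> path_space Cadlag_Paths r t"
      using \<omega>' by auto
    have "Inf (skorokhod_bounds r t \<omega> \<omega>') < d"
      using \<omega>' D by (simp add: in_mball skorokhod_dist_def)
    moreover have "skorokhod_bounds r t \<omega> \<omega>' \<noteq> {}"
      using D by (intro skorokhod_bounds_nonempty) (auto simp: path_space_def)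
    ultimately obtain a where "a \<in> skorokhod_bounds r t \<omega> \<omega>'" "a < d"
      using cInf_lessD by blast
    then show ?thesis
      unfolding skorokhod_bounds_def by (fastforce intro: order_trans)
  qed
  then show ?thesis
    using Cadlag_Paths \<omega>' d unfolding path_topology_def
    by (intro exI[of _ "mball \<omega> d"]) auto
qed

text \<open>Weak continuity says something about these functions, and their measurability for the coordinate
  \<open>\<sigma>\<close>-algebra is known directly, without a comparison with the Borel sets of the topology.\<close>

definition test_functions :: "path_kind \<Rightarrow> real \<Rightarrow> real \<Rightarrow> ('n::finite path \<Rightarrow> real) set" where
  "test_functions \<kappa> r t = {f. continuous_map (path_topology \<kappa> r t) euclideanreal f \<and>
     f \<in> borel_measurable (path_sigma \<kappa> r t t) \<and> (\<forall>\<omega>\<in>path_space \<kappa> r t. 0 \<le> f \<omega> \<and> f \<omega> \<le> 1)}"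

lemma test_functions_mult:
  "f \<in> test_functions \<kappa> r t \<Longrightarrow> g \<in> test_functions \<kappa> r t \<Longrightarrow> (\<lambda>\<omega>. f \<omega> * g \<omega>) \<in> test_functions \<kappa> r t"
  by (auto simp: test_functions_def intro!: continuous_map_real_mult mult_le_one)

lemma test_functions_truncate:
  "f \<in> test_functions \<kappa> r t \<Longrightarrow> (\<lambda>\<omega>. min 1 (real n * f \<omega>)) \<in> test_functions \<kappa> r t"
  by (auto simp: test_functions_def intro!: continuous_map_real_min continuous_map_real_mult)

text \<open>The evaluation at a fixed time is not continuous in the Skorokhod topology, but a weighted supremum
  along the path is: a time change permutes the times over which the supremum is taken and changes the
  weights only slightly. By right continuity the supremum may be taken over countably many times, which
  gives measurability.\<close>

lemma weighted_sup_test: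
  fixes g :: "real ^ 'n::finite \<Rightarrow> real"
  assumes rt: "r \<le> t" and h01: "\<And>u. 0 \<le> h u \<and> h u \<le> 1" and g01: "\<And>x. 0 \<le> g x \<and> g x \<le> 1"
    and g: "uniformly_continuous_on UNIV g"
    and h: "\<And>e. 0 < e \<Longrightarrow> \<exists>d>0. \<forall>\<tau>\<in>time_changes r t. (\<forall>u\<in>{r..t}. \<bar>\<tau> u - u\<bar> \<le> d) \<longrightarrow>
      (\<forall>u\<in>{r..t}. \<bar>h (\<tau> u) - h u\<bar> \<le> e)"
    and h_right: "\<And>u. r \<le> u \<Longrightarrow> u < t \<Longrightarrow> (h \<longlongrightarrow> h u) (at u within {u<..t})"
  shows "(\<lambda>\<omega>. SUP u\<in>{r..t}. h u * g (\<omega> u)) \<in> test_functions \<kappa> r t"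
    and "0 < (SUP u\<in>{r..t}. h u * g (\<omega> u)) \<longleftrightarrow> (\<exists>u\<in>{r..t}. 0 < h u \<and> 0 < g (\<omega> u))"
proof -
  let ?S = "\<lambda>\<omega>. SUP u\<in>{r..t}. h u * g (\<omega> u)"
  have hg01: "0 \<le> h u * g x" "h u * g x \<le> 1" for u x
    using h01 g01 by (auto intro!: mult_le_one)
  have bdd: "bdd_above ((\<lambda>u. h u * g (\<omega> u)) ` X)" for \<omega> X
    using hg01 by (intro bdd_aboveI2[of _ _ 1]) auto
  have ne: "{r..t} \<noteq> {}"
    using rt by simp
  have less_iff: "a < ?S \<omega> \<longleftrightarrow> (\<exists>u\<in>{r..t}. a < h u * g (\<omega> u))" for a \<omega>
    by (rule less_cSUP_iff[OF ne bdd])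
  then show "0 < ?S \<omega> \<longleftrightarrow> (\<exists>u\<in>{r..t}. 0 < h u \<and> 0 < g (\<omega> u))" for \<omega>
    using h01 g01 by (simp add: zero_less_mult_iff) (meson not_less)
  have upper: "h u * g (\<omega> u) \<le> ?S \<omega>" if "u \<in> {r..t}" for u \<omega>
    using that by (rule cSUP_upper[OF _ bdd])
  have S01: "0 \<le> ?S \<omega>" "?S \<omega> \<le> 1" for \<omega>
  proof -
    show "0 \<le> ?S \<omega>"
      using hg01(1)[of r "\<omega> r"] upper[of r \<omega>] rt by simp
    show "?S \<omega> \<le> 1"
      by (rule cSUP_least[OF ne]) (rule hg01(2))
  qed
  have "continuous_map (path_topology \<kappa> r t) euclideanreal ?S"
  proof -
    have "\<exists>V. openin (path_topology \<kappa> r t) V \<and> \<omega> \<in> V \<and> (\<forall>\<omega>'\<in>V. dist (?S \<omega>) (?S \<omega>') < e)"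
      if \<omega>: "\<omega> \<in> path_space \<kappa> r t" and e: "0 < e" for \<omega> e
    proof -
      have "0 < e/4"
        using e by simp
      from h[OF this] obtain d1 where d1: "0 < d1" and hd1: "\<forall>\<tau>\<in>time_changes r t.
          (\<forall>u\<in>{r..t}. \<bar>\<tau> u - u\<bar> \<le> d1) \<longrightarrow> (\<forall>u\<in>{r..t}. \<bar>h (\<tau> u) - h u\<bar> \<le> e/4)"
        by blast
      obtain d2 where d2: "0 < d2" and gd2: "\<And>x y. dist x y < d2 \<Longrightarrow> dist (g x) (g y) < e/4"
        using g e unfolding uniformly_continuous_on_def
        by (metis UNIV_I zero_less_divide_iff zero_less_numeral)
      define d where "d = min d1 (d2/2)"
      have d: "0 < d" "d \<le> d1" "d < d2"
        using d1 d2 by (auto simp: d_def)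
      obtain V where V: "openin (path_topology \<kappa> r t) V" "\<omega> \<in> V" "\<And>\<omega>'. \<omega>' \<in> V \<Longrightarrow>
          \<exists>\<tau>\<in>time_changes r t. \<forall>u\<in>{r..t}. \<bar>\<tau> u - u\<bar> \<le> d \<and> dist (\<omega> u) (\<omega>' (\<tau> u)) \<le> d"
        using path_topology_near[OF \<omega> d(1)] by auto
      have "dist (?S \<omega>) (?S \<omega>') < e" if \<omega>': "\<omega>' \<in> V" for \<omega>'
      proof -
        obtain \<tau> where \<tau>: "\<tau> \<in> time_changes r t"
          and near: "\<And>u. u \<in> {r..t} \<Longrightarrow> \<bar>\<tau> u - u\<bar> \<le> d" "\<And>u. u \<in> {r..t} \<Longrightarrow> dist (\<omega> u) (\<omega>' (\<tau> u)) \<le> d"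
          using V(3)[OF \<omega>'] by auto
        have im: "\<tau> ` {r..t} = {r..t}"
          using \<tau> by (simp add: time_changes_def)
        have close: "\<bar>h (\<tau> u) * g (\<omega>' (\<tau> u)) - h u * g (\<omega> u)\<bar> \<le> e/2" if u: "u \<in> {r..t}" for u
        proof -
          have 1: "\<bar>h (\<tau> u) - h u\<bar> \<le> e/4"
            using bspec[OF hd1 \<tau>] u near(1) d(2) order_trans by blast
          have 2: "\<bar>g (\<omega>' (\<tau> u)) - g (\<omega> u)\<bar> \<le> e/4"
            using gd2[of "\<omega>' (\<tau> u)" "\<omega> u"] near(2)[OF u] d(3) by (simp add: dist_commute dist_real_def abs_minus_commute)
          have "h (\<tau> u) * g (\<omega>' (\<tau> u)) - h u * g (\<omega> u) =
              (h (\<tau> u) - h u) * g (\<omega>' (\<tau> u)) + h u * (g (\<omega>' (\<tau> u)) - g (\<omega> u))"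
            by (simp add: algebra_simps)
          also have "\<bar>\<dots>\<bar> \<le> \<bar>h (\<tau> u) - h u\<bar> * \<bar>g (\<omega>' (\<tau> u))\<bar> + \<bar>h u\<bar> * \<bar>g (\<omega>' (\<tau> u)) - g (\<omega> u)\<bar>"
            by (metis abs_mult abs_triangle_ineq)
          also have "\<dots> \<le> e/4 * 1 + 1 * (e/4)"
            using 1 2 h01[of u] g01[of "\<omega>' (\<tau> u)"] e by (intro add_mono mult_mono) auto
          finally show ?thesis by simp
        qed
        have "?S \<omega> \<le> ?S \<omega>' + e/2"
        proof (rule cSUP_least[OF ne])
          fix u assume u: "u \<in> {r..t}"
          then have "h (\<tau> u) * g (\<omega>' (\<tau> u)) \<le> ?S \<omega>'"
            using im by (intro upper) auto
          then show "h u * g (\<omega> u) \<le> ?S \<omega>' + e/2"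
            using close[OF u] by linarith
        qed
        moreover have "?S \<omega>' \<le> ?S \<omega> + e/2"
        proof (rule cSUP_least[OF ne])
          fix v assume "v \<in> {r..t}"
          then obtain u where u: "u \<in> {r..t}" "v = \<tau> u"
            using im by (metis imageE)
          show "h v * g (\<omega>' v) \<le> ?S \<omega> + e/2"
            unfolding u(2) using close[OF u(1)] upper[OF u(1), of \<omega>] by linarith
        qed
        ultimately show ?thesis
          using e unfolding dist_real_def by linarith
      qed
      with V(1,2) show ?thesis by auto
    qed
    then have "continuous_map (path_topology \<kappa> r t) Met_TC.mtopology ?S"
      unfolding Met_TC.continuous_map_to_metric topspace_path_topology by (simp add: mem_ball)
    then show ?thesis
      by simp
  qed
  moreover have "?S \<in> borel_measurable (path_sigma \<kappa> r t t)"
    unfolding borel_measurable_iff_greater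
  proof
    fix a
    have "(\<exists>u\<in>{r..t}. a < h u * g (\<omega> u)) \<longleftrightarrow> (\<exists>u\<in>dense_times r t. a < h u * g (\<omega> u))"
      if \<omega>: "\<omega> \<in> path_space \<kappa> r t" for \<omega>
    proof
      assume "\<exists>u\<in>{r..t}. a < h u * g (\<omega> u)"
      then obtain u where u: "r \<le> u" "u \<le> t" "a < h u * g (\<omega> u)"
        by auto
      show "\<exists>u\<in>dense_times r t. a < h u * g (\<omega> u)"
      proof (cases "u = t")
        case True
        with u show ?thesis
          by (auto simp: dense_times_def)
      next
        case False
        have "isCont g (\<omega> u)"
          using uniformly_continuous_imp_continuous[OF g] by (simp add: continuous_on_eq_continuous_at)
        from isCont_tendsto_compose[OF this path_right_continuous[OF \<omega> u(1,2)]]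
        have "((\<lambda>v. h v * g (\<omega> v)) \<longlongrightarrow> h u * g (\<omega> u)) (at u within {u<..t})"
          using u False by (intro tendsto_mult h_right) auto
        from tendsto_right_dense[OF this u(3,1), of t] show ?thesis
          using u False by auto
      qed
    qed (use dense_times_subset[OF rt] in auto)
    then have "{\<omega> \<in> space (path_sigma \<kappa> r t t). a < ?S \<omega>} =
        (\<Union>u\<in>dense_times r t. {\<omega> \<in> space (path_sigma \<kappa> r t t). a < h u * g (\<omega> u)})"
      unfolding less_iff by auto
    also have "\<dots> \<in> sets (path_sigma \<kappa> r t t)"
    proof (rule sets.countable_UN'[OF countable_dense_times])
      have [measurable]: "g \<in> borel_measurable borel"
        using uniformly_continuous_imp_continuous[OF g] by (rule borel_measurable_continuous_onI)
      show "(\<lambda>u. {\<omega> \<in> space (path_sigma \<kappa> r t t). a < h u * g (\<omega> u)}) ` dense_times r t \<subseteq> sets (path_sigma \<kappa> r t t)"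
      proof safe
        fix u assume "u \<in> dense_times r t"
        then have [measurable]: "(\<lambda>\<omega>. \<omega> u) \<in> borel_measurable (path_sigma \<kappa> r t t)"
          using dense_times_subset[OF rt] by (intro path_coordinate_measurable) auto
        show "{\<omega> \<in> space (path_sigma \<kappa> r t t). a < h u * g (\<omega> u)} \<in> sets (path_sigma \<kappa> r t t)"
          by measurable
      qed
    qed
    finally show "{\<omega> \<in> space (path_sigma \<kappa> r t t). a < ?S \<omega>} \<in> sets (path_sigma \<kappa> r t t)" .
  qed
  ultimately show "?S \<in> test_functions \<kappa> r t"
    using S01 by (auto simp: test_functions_def)
qed

definition test_sets :: "path_kind \<Rightarrow> real \<Rightarrow> real \<Rightarrow> ('n::finite path) set set" where
  "test_sets \<kappa> r t = (\<lambda>f. {\<omega> \<in> path_space \<kappa> r t. 0 < f \<omega>}) ` test_functions \<kappa> r t"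

lemma Int_stable_test_sets: "Int_stable (test_sets \<kappa> r t)"
proof (rule Int_stableI)
  fix A B :: "'a path set" assume "A \<in> test_sets \<kappa> r t" "B \<in> test_sets \<kappa> r t"
  then obtain f g where fg: "f \<in> test_functions \<kappa> r t" "g \<in> test_functions \<kappa> r t"
    "A = {\<omega> \<in> path_space \<kappa> r t. 0 < f \<omega>}" "B = {\<omega> \<in> path_space \<kappa> r t. 0 < g \<omega>}"
    by (auto simp: test_sets_def)
  have "0 < f \<omega> * g \<omega> \<longleftrightarrow> 0 < f \<omega> \<and> 0 < g \<omega>" if "\<omega> \<in> path_space \<kappa> r t" for \<omega>
  proof -
    have "0 \<le> f \<omega>" "0 \<le> g \<omega>"
      using fg(1,2) that by (auto simp: test_functions_def)
    then show ?thesis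
      by (auto simp: zero_less_mult_iff)
  qed
  then have "A \<inter> B = {\<omega> \<in> path_space \<kappa> r t. 0 < f \<omega> * g \<omega>}"
    using fg by auto
  then show "A \<inter> B \<in> test_sets \<kappa> r t"
    using test_functions_mult[OF fg(1,2)] by (auto simp: test_sets_def)
qed

text \<open>This function is positive exactly on an open half-space.\<close>

lemma uniformly_continuous_halfspace_ramp:
  fixes b :: "real ^ 'n::finite"
  shows "uniformly_continuous_on UNIV (\<lambda>x. min 1 (max 0 (c - x \<bullet> b)))"
proof (cases "b = 0")
  case True
  then show ?thesis by (simp add: uniformly_continuous_on_const)
next
  case False
  show ?thesis
    unfolding uniformly_continuous_on_def
  proof safe
    fix e :: real assume e: "0 < e"
    have "dist (min 1 (max 0 (c - y \<bullet> b))) (min 1 (max 0 (c - x \<bullet> b))) < e"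
      if "dist y x < e / norm b" for x y
    proof -
      have "\<bar>(y - x) \<bullet> b\<bar> \<le> norm (y - x) * norm b"
        by (rule Cauchy_Schwarz_ineq2)
      also have "\<dots> < e"
        using that False by (simp add: dist_norm pos_less_divide_eq)
      finally show ?thesis
        by (auto simp: dist_real_def inner_diff_left min_def max_def)
    qed
    moreover have "0 < e / norm b"
      using e False by simp
    ultimately show "\<exists>d>0. \<forall>x\<in>UNIV. \<forall>x'\<in>UNIV. dist x' x < d \<longrightarrow>
        dist (min 1 (max 0 (c - x' \<bullet> b))) (min 1 (max 0 (c - x \<bullet> b))) < e"
      by blast
  qed
qed

text \<open>By right continuity, a path is in a closed half-space at time \<open>u < t\<close> if and only if it visits every
  larger open half-space in every interval to the right of \<open>u\<close>, and a visit is the positivity of a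
  weighted supremum. The final time has no interval to its right, but all time changes fix it, so there
  the weight may be the indicator of \<open>{t}\<close>.\<close>

lemma sets_path_sigma_test_sets:
  assumes rt: "r \<le> t"
  shows "sets (path_sigma \<kappa> r t t) = sigma_sets (path_space \<kappa> r t) (test_sets \<kappa> r t :: 'n::finite path set set)"
proof
  let ?S = "sigma (path_space \<kappa> r t) (test_sets \<kappa> r t :: 'n path set set)"
  have sub: "test_sets \<kappa> r t \<subseteq> sets (path_sigma \<kappa> r t t :: 'n path measure)"
  proof
    fix A :: "'n path set" assume "A \<in> test_sets \<kappa> r t"
    then obtain f where "f \<in> test_functions \<kappa> r t" and A: "A = {\<omega> \<in> path_space \<kappa> r t. 0 < f \<omega>}"
      by (auto simp: test_sets_def)
    then have "f \<in> borel_measurable (path_sigma \<kappa> r t t)"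
      by (auto simp: test_functions_def)
    with A show "A \<in> sets (path_sigma \<kappa> r t t)"
      using borel_measurable_less[of "\<lambda>_. 0" "path_sigma \<kappa> r t t" f] by simp
  qed
  then show "sigma_sets (path_space \<kappa> r t) (test_sets \<kappa> r t) \<subseteq> sets (path_sigma \<kappa> r t t :: 'n path measure)"
    using sets.sigma_sets_subset[OF sub] by simp
  have pow: "test_sets \<kappa> r t \<subseteq> Pow (path_space \<kappa> r t :: 'n path set)"
    by (auto simp: test_sets_def)
  have sets: "sets ?S = sigma_sets (path_space \<kappa> r t) (test_sets \<kappa> r t)" and space: "space ?S = path_space \<kappa> r t"
    using pow by auto
  have test: "{\<omega> \<in> path_space \<kappa> r t. 0 < f \<omega>} \<in> sets ?S" if "f \<in> test_functions \<kappa> r t" for f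
    using that unfolding sets by (intro sigma_sets.Basic) (auto simp: test_sets_def)
  have "(\<lambda>\<omega>. \<omega> u) \<in> borel_measurable ?S" if u: "r \<le> u" "u \<le> t" for u
    unfolding borel_measurable_iff_halfspace_le
  proof (intro ballI allI)
    fix b :: "real ^ 'n" and a :: real assume "b \<in> Basis"
    define g where "g m x = min 1 (max 0 (a + inverse (real (Suc m)) - x \<bullet> b))" for m x
    have g: "uniformly_continuous_on UNIV (g m)" "0 \<le> g m x \<and> g m x \<le> 1"
      "0 < g m x \<longleftrightarrow> x \<bullet> b < a + inverse (real (Suc m))" for m x
      unfolding g_def using uniformly_continuous_halfspace_ramp by auto
    show "{\<omega> \<in> space ?S. \<omega> u \<bullet> b \<le> a} \<in> sets ?S"
    proof (cases "u = t")
      case True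
      define h :: "real \<Rightarrow> real" where "h = indicator {t}"
      have h01: "0 \<le> h v \<and> h v \<le> 1" for v
        by (simp add: h_def indicator_def)
      have hd: "\<exists>d>0. \<forall>\<tau>\<in>time_changes r t. (\<forall>u\<in>{r..t}. \<bar>\<tau> u - u\<bar> \<le> d) \<longrightarrow>
          (\<forall>u\<in>{r..t}. \<bar>h (\<tau> u) - h u\<bar> \<le> e)" if "0 < e" for e
      proof -
        have "h (\<tau> v) = h v" if \<tau>: "\<tau> \<in> time_changes r t" and v: "v \<in> {r..t}" for \<tau> v
        proof (cases "v = t")
          case False
          then have "\<tau> v < \<tau> t"
            using \<tau> v rt strict_mono_onD[of "{r..t}" \<tau> v t] by (auto simp: time_changes_def)
          then show ?thesis
            using time_changes_endpoint[OF \<tau> rt] False by (simp add: h_def)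
        qed (simp add: time_changes_endpoint[OF \<tau> rt])
        then show ?thesis
          using that by (intro exI[of _ 1]) auto
      qed
      have hr: "(h \<longlongrightarrow> h v) (at v within {v<..t})" if "r \<le> v" "v < t" for v
      proof (rule tendsto_eventually)
        have "\<forall>\<^sub>F w in at v within {v<..t}. w < t"
          using that by (auto simp: eventually_at dist_real_def intro!: exI[of _ "t - v"])
        then show "\<forall>\<^sub>F w in at v within {v<..t}. h w = h v"
          by eventually_elim (use that in \<open>simp add: h_def indicator_def\<close>)
      qed
      have W: "(\<lambda>\<omega>. SUP v\<in>{r..t}. h v * g m (\<omega> v)) \<in> test_functions \<kappa> r t"
        "0 < (SUP v\<in>{r..t}. h v * g m (\<omega> v)) \<longleftrightarrow> (\<exists>v\<in>{r..t}. 0 < h v \<and> 0 < g m (\<omega> v))" for m \<omega>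
        by (rule weighted_sup_test[OF rt h01 g(2) g(1)], erule hd, erule (1) hr)+
      have "{\<omega> \<in> space ?S. \<omega> u \<bullet> b \<le> a} =
          (\<Inter>m. {\<omega> \<in> path_space \<kappa> r t. 0 < (SUP v\<in>{r..t}. h v * g m (\<omega> v))})"
      proof -
        have "(\<forall>m. x < a + inverse (real (Suc m))) \<longleftrightarrow> x \<le> a" for x
        proof
          assume *: "\<forall>m. x < a + inverse (real (Suc m))"
          show "x \<le> a"
          proof (rule ccontr)
            assume "\<not> x \<le> a"
            then obtain m where "inverse (real (Suc m)) < x - a"
              using reals_Archimedean[of "x - a"] by auto
            with * show False
              using spec[OF *, of m] by linarith
          qed
        qed (auto intro: le_less_trans simp del: of_nat_Suc)
        then show ?thesis
          unfolding W(2) g(3) space using rt True by (auto simp: h_def indicator_def simp del: of_nat_Suc)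
      qed
      also have "\<dots> \<in> sets ?S"
        using test[OF W(1)] by (intro sets.countable_INT) auto
      finally show ?thesis .
    next
      case False
      \<comment> \<open>A tent over the interval from \<open>u\<close> to \<open>u + 1 / (k + 1)\<close>.\<close>
      define h :: "nat \<Rightarrow> real \<Rightarrow> real" where
        "h k v = min 1 (max 0 (min (v - u) (u + inverse (real (Suc k)) - v)))" for k v
      have h01: "0 \<le> h k v \<and> h k v \<le> 1" for k v
        by (simp add: h_def)
      have hpos: "0 < h k v \<longleftrightarrow> u < v \<and> v < u + inverse (real (Suc k))" for k v
        by (auto simp: h_def simp del: of_nat_Suc)
      have hd: "\<exists>d>0. \<forall>\<tau>\<in>time_changes r t. (\<forall>u\<in>{r..t}. \<bar>\<tau> u - u\<bar> \<le> d) \<longrightarrow>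
          (\<forall>u\<in>{r..t}. \<bar>h k (\<tau> u) - h k u\<bar> \<le> e)" if "0 < e" for e k
      proof -
        have "\<bar>h k x - h k y\<bar> \<le> \<bar>x - y\<bar>" for x y
        proof -
          have "\<bar>min 1 (max 0 a) - min 1 (max 0 b)\<bar> \<le> \<bar>a - b\<bar>" for a b :: real
            unfolding min_def max_def abs_if by (simp split: if_splits)
          moreover have "\<bar>min (x - u) (c - x) - min (y - u) (c - y)\<bar> \<le> \<bar>x - y\<bar>" for c
            unfolding min_def abs_if by (simp split: if_splits)
          ultimately show ?thesis
            unfolding h_def by (rule order_trans)
        qed
        then show ?thesis
          using that by (intro exI[of _ e]) (meson order_trans)
      qed
      have hr: "(h k \<longlongrightarrow> h k v) (at v within {v<..t})" for k v
        unfolding h_def by (intro tendsto_intros)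
      have W: "(\<lambda>\<omega>. SUP v\<in>{r..t}. h k v * g m (\<omega> v)) \<in> test_functions \<kappa> r t"
        "0 < (SUP v\<in>{r..t}. h k v * g m (\<omega> v)) \<longleftrightarrow> (\<exists>v\<in>{r..t}. 0 < h k v \<and> 0 < g m (\<omega> v))" for k m \<omega>
        by (rule weighted_sup_test[OF rt h01 g(2) g(1)], erule hd, rule hr)+
      have "{\<omega> \<in> space ?S. \<omega> u \<bullet> b \<le> a} =
          (\<Inter>k. \<Inter>m. {\<omega> \<in> path_space \<kappa> r t. 0 < (SUP v\<in>{r..t}. h k v * g m (\<omega> v))})"
      proof (intro set_eqI iffI)
        fix \<omega> assume \<omega>: "\<omega> \<in> {\<omega> \<in> space ?S. \<omega> u \<bullet> b \<le> a}"
        then have lim: "((\<lambda>v. - (\<omega> v \<bullet> b)) \<longlongrightarrow> - (\<omega> u \<bullet> b)) (at u within {u<..t})"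
          unfolding space using u by (intro tendsto_intros path_right_continuous[where \<kappa> = \<kappa>]) auto
        have "\<exists>v\<in>{r..t}. 0 < h k v \<and> 0 < g m (\<omega> v)" for k m
        proof -
          have "- (a + inverse (real (Suc m))) < - (\<omega> u \<bullet> b)"
          proof -
            have "\<omega> u \<bullet> b \<le> a" "0 < inverse (real (Suc m))"
              using \<omega> by auto
            then show ?thesis
              by linarith
          qed
          from tendsto_right_dense[OF lim this u(1), of "min t (u + inverse (real (Suc k)))"] u False
          obtain q where "q \<in> dense_times r t" "u < q" "q < min t (u + inverse (real (Suc k)))"
              "- (a + inverse (real (Suc m))) < - (\<omega> q \<bullet> b)"
            by (auto simp del: of_nat_Suc)
          then show ?thesis
            using dense_times_subset[OF rt] unfolding hpos g(3)
            by (intro bexI[of _ q]) (auto simp del: of_nat_Suc)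
        qed
        then show "\<omega> \<in> (\<Inter>k. \<Inter>m. {\<omega> \<in> path_space \<kappa> r t. 0 < (SUP v\<in>{r..t}. h k v * g m (\<omega> v))})"
          using \<omega> unfolding W(2) space by auto
      next
        fix \<omega> assume "\<omega> \<in> (\<Inter>k. \<Inter>m. {\<omega> \<in> path_space \<kappa> r t. 0 < (SUP v\<in>{r..t}. h k v * g m (\<omega> v))})"
        then have \<omega>: "\<omega> \<in> path_space \<kappa> r t"
          and ex: "\<And>k m. \<exists>v\<in>{r..t}. u < v \<and> v < u + inverse (real (Suc k)) \<and> \<omega> v \<bullet> b < a + inverse (real (Suc m))"
          unfolding W(2) hpos g(3) by auto
        have "\<omega> u \<bullet> b \<le> a"
        proof (rule ccontr)
          assume "\<not> \<omega> u \<bullet> b \<le> a"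
          then obtain m where m: "a + inverse (real (Suc m)) < \<omega> u \<bullet> b"
            using reals_Archimedean[of "\<omega> u \<bullet> b - a"] by (auto simp: algebra_simps)
          have "((\<lambda>v. \<omega> v \<bullet> b) \<longlongrightarrow> \<omega> u \<bullet> b) (at u within {u<..t})"
            using u \<omega> by (intro tendsto_intros path_right_continuous[where \<kappa> = \<kappa>]) auto
          from order_tendstoD(1)[OF this m] obtain d where
            d: "0 < d" "\<And>v. v \<in> {u<..t} \<Longrightarrow> dist v u < d \<Longrightarrow> a + inverse (real (Suc m)) < \<omega> v \<bullet> b"
            unfolding eventually_at by (auto simp del: of_nat_Suc)
          obtain k where k: "inverse (real (Suc k)) < d"
            using reals_Archimedean[OF d(1)] by auto
          obtain v where v: "v \<in> {r..t}" "u < v" "v < u + inverse (real (Suc k))" "\<omega> v \<bullet> b < a + inverse (real (Suc m))"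
            using ex by blast
          then have "a + inverse (real (Suc m)) < \<omega> v \<bullet> b"
            using k by (intro d(2)) (auto simp: dist_real_def simp del: of_nat_Suc)
          with v show False
            by linarith
        qed
        then show "\<omega> \<in> {\<omega> \<in> space ?S. \<omega> u \<bullet> b \<le> a}"
          using \<omega> unfolding space by auto
      qed
      also have "\<dots> \<in> sets ?S"
        using test[OF W(1)] by (intro sets.countable_INT) auto
      finally show ?thesis .
    qed
  qed
  then have "(\<lambda>\<omega>. \<omega>) \<in> ?S \<rightarrow>\<^sub>M path_sigma \<kappa> r t t"
    by (intro measurable_path_sigma) (auto simp: space)
  note id = this
  show "sets (path_sigma \<kappa> r t t) \<subseteq> sigma_sets (path_space \<kappa> r t) (test_sets \<kappa> r t :: 'n path set set)"
  proof
    fix A :: "'n path set" assume A: "A \<in> sets (path_sigma \<kappa> r t t)"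
    then have "(\<lambda>\<omega>. \<omega>) -` A \<inter> space ?S = A"
      using sets.sets_into_space[OF A] by (auto simp: space)
    then show "A \<in> sigma_sets (path_space \<kappa> r t) (test_sets \<kappa> r t)"
      using measurable_sets[OF id A] unfolding sets by simp
  qed
qed

text \<open>The indicator of a test set is the limit of the test functions \<open>min 1 (n * f)\<close>, so the mass of the
  set is a limit of continuous functions of the starting point; the test sets are stable under
  intersection and generate.\<close>

lemma weakly_continuous_kernel:
  fixes Q :: "real ^ 'n::finite \<Rightarrow> 'n path measure"
  assumes wc: "weakly_continuous \<kappa> r t Q" and rt: "r \<le> t"
    and prob: "\<And>y. prob_space (Q y)" and sets: "\<And>y. sets (Q y) = sets (path_sigma \<kappa> r t t)"
  shows "Q \<in> borel \<rightarrow>\<^sub>M prob_algebra (path_sigma \<kappa> r t t)"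
proof (rule measurable_prob_algebra_generated[OF sets_path_sigma_test_sets[OF rt] Int_stable_test_sets])
  show "test_sets \<kappa> r t \<subseteq> Pow (path_space \<kappa> r t)"
    by (auto simp: test_sets_def)
  fix A :: "'n path set" assume A: "A \<in> test_sets \<kappa> r t"
  then obtain f where f: "f \<in> test_functions \<kappa> r t" and A_eq: "A = {\<omega> \<in> path_space \<kappa> r t. 0 < f \<omega>}"
    by (auto simp: test_sets_def)
  have space: "space (Q y) = path_space \<kappa> r t" for y
    using sets_eq_imp_space_eq[OF sets[of y]] by simp
  let ?f = "\<lambda>n \<omega>. min 1 (real n * f \<omega>)"
  have f': "?f n \<in> test_functions \<kappa> r t" for n
    by (rule test_functions_truncate[OF f])
  have meas: "(\<lambda>y. \<integral>\<omega>. ?f n \<omega> \<partial>Q y) \<in> borel_measurable borel" for n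
  proof -
    have "continuous_map (path_topology \<kappa> r t) euclideanreal (?f n)"
      and "\<exists>C. \<forall>\<omega>\<in>path_space \<kappa> r t. \<bar>?f n \<omega>\<bar> \<le> C"
      using f'[of n] by (auto simp: test_functions_def intro!: exI[of _ 1])
    then have "continuous_on UNIV (\<lambda>y. \<integral>\<omega>. ?f n \<omega> \<partial>Q y)"
      using wc unfolding weakly_continuous_def by blast
    then show ?thesis
      by (rule borel_measurable_continuous_onI)
  qed
  have "(\<lambda>n. \<integral>\<omega>. ?f n \<omega> \<partial>Q y) \<longlonglongrightarrow> measure (Q y) A" for y
  proof -
    interpret prob_space "Q y" by (rule prob)
    have fm: "?f n \<in> borel_measurable (Q y)" for n
      using f'[of n] by (simp add: test_functions_def sets cong: measurable_cong_sets)
    have AQ: "A \<in> sets (Q y)"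
      using A sets_path_sigma_test_sets[OF rt, of \<kappa>] by (auto simp: sets)
    have "(\<lambda>n. \<integral>\<omega>. ?f n \<omega> \<partial>Q y) \<longlonglongrightarrow> (\<integral>\<omega>. indicator A \<omega> \<partial>Q y)"
    proof (rule integral_dominated_convergence[where w = "\<lambda>_. 1"])
      show "AE \<omega> in Q y. (\<lambda>n. ?f n \<omega>) \<longlonglongrightarrow> indicator A \<omega>"
      proof (rule AE_I2)
        fix \<omega> assume \<omega>: "\<omega> \<in> space (Q y)"
        show "(\<lambda>n. ?f n \<omega>) \<longlonglongrightarrow> indicator A \<omega>"
        proof (cases "0 < f \<omega>")
          case True
          obtain n where n: "1 < real n * f \<omega>"
            using reals_Archimedean3[OF True] by auto
          have "1 \<le> real m * f \<omega>" if "n \<le> m" for m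
          proof -
            have "real n * f \<omega> \<le> real m * f \<omega>"
              using that True by (intro mult_right_mono) auto
            with n show ?thesis by linarith
          qed
          then have "\<forall>\<^sub>F m in sequentially. ?f m \<omega> = indicator A \<omega>"
            using True \<omega> by (auto simp: eventually_sequentially A_eq space intro!: exI[of _ n])
          then show ?thesis
            by (rule tendsto_eventually)
        next
          case False
          then have "f \<omega> = 0"
            using f \<omega> by (force simp: test_functions_def space)
          then show ?thesis
            using False by (simp add: A_eq)
        qed
      qed
      show "AE \<omega> in Q y. norm (?f n \<omega>) \<le> 1" for n
        using f'[of n] by (auto simp: test_functions_def space)
    qed (use fm AQ in auto)
    then show ?thesis
      using AQ sets.sets_into_space[OF AQ] by (simp add: Int_absorb2)
  qed
  then have "(\<lambda>y. measure (Q y) A) \<in> borel_measurable borel"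
    using meas by (rule borel_measurable_LIMSEQ_real)
  then show "(\<lambda>y. emeasure (Q y) A) \<in> borel_measurable borel"
    using finite_measure.emeasure_eq_measure[OF prob_space.finite_measure[OF prob]] by simp
qed (auto simp: prob sets)

section \<open>Solutions of martingale problems\<close>

text \<open>The martingale property on the times \<open>[a,b]\<close> of a process whose increments are given by \<open>W\<close>.\<close>

definition centered ::
  "'a measure \<Rightarrow> (real \<Rightarrow> 'a measure) \<Rightarrow> (real \<Rightarrow> real \<Rightarrow> 'a \<Rightarrow> real) \<Rightarrow> real \<Rightarrow> real \<Rightarrow> bool" where
  "centered Q F W a b \<longleftrightarrow> (\<forall>u v A. a \<le> u \<and> u \<le> v \<and> v \<le> b \<and> A \<in> sets (F u) \<longrightarrow>
     (\<integral>\<omega>. indicator A \<omega> * W u v \<omega> \<partial>Q) = 0)"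

definition increments :: "path_kind \<Rightarrow> real \<Rightarrow> real \<Rightarrow> (real \<Rightarrow> real \<Rightarrow> 'n::finite path \<Rightarrow> real) \<Rightarrow> bool" where
  "increments \<kappa> r t W \<longleftrightarrow>
     (\<forall>u v. r \<le> u \<and> u \<le> v \<and> v \<le> t \<longrightarrow>
        W u v \<in> borel_measurable (path_sigma \<kappa> r t v) \<and> (\<exists>C. \<forall>\<omega>\<in>path_space \<kappa> r t. \<bar>W u v \<omega>\<bar> \<le> C)) \<and>
     (\<forall>u v w. \<forall>\<omega>\<in>path_space \<kappa> r t. r \<le> u \<and> u \<le> v \<and> v \<le> w \<and> w \<le> t \<longrightarrow> W u w \<omega> = W u v \<omega> + W v w \<omega>)"

lemma incrementsD:
  assumes "increments \<kappa> r t W" "r \<le> u" "u \<le> v" "v \<le> t"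
  shows "W u v \<in> borel_measurable (path_sigma \<kappa> r t v)"
    and "\<exists>C. \<forall>\<omega>\<in>path_space \<kappa> r t. \<bar>W u v \<omega>\<bar> \<le> C"
    and "\<And>\<omega> w. \<omega> \<in> path_space \<kappa> r t \<Longrightarrow> v \<le> w \<Longrightarrow> w \<le> t \<Longrightarrow> W u w \<omega> = W u v \<omega> + W v w \<omega>"
  using assms unfolding increments_def by blast+

lemma space_path_measure:
  "sets Q = sets (path_sigma \<kappa> r t u) \<Longrightarrow> space Q = path_space \<kappa> r t"
  by (metis sets_eq_imp_space_eq space_path_sigma)

lemma subalgebra_path_measure:
  assumes "sets Q = sets (path_sigma \<kappa> r t t)" "u \<le> t"
  shows "subalgebra Q (path_sigma \<kappa> r t u)"
  using subalgebra_path_sigma[OF assms(2), of \<kappa> r t] assms(1) space_path_measure[OF assms(1)]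
  by (auto simp: subalgebra_def)

lemma increments_integrable:
  assumes W: "increments \<kappa> r t W" and uv: "r \<le> u" "u \<le> v" "v \<le> t"
    and Q: "prob_space Q" "sets Q = sets (path_sigma \<kappa> r t t)"
  shows "integrable Q (W u v)"
proof -
  obtain C where C: "\<And>\<omega>. \<omega> \<in> path_space \<kappa> r t \<Longrightarrow> \<bar>W u v \<omega>\<bar> \<le> C"
    using incrementsD(2)[OF W uv] by auto
  have "W u v \<in> borel_measurable Q"
    by (rule measurable_from_subalg[OF subalgebra_path_measure[OF Q(2) uv(3)] incrementsD(1)[OF W uv]])
  then show ?thesis
    using C by (intro integrable_bounded[OF Q(1)]) (auto simp: space_path_measure[OF Q(2)])
qed

lemma martingale_on_iff_centered:
  assumes W: "increments \<kappa> r t W" and Q: "prob_space Q" "sets Q = sets (path_sigma \<kappa> r t t)"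
  shows "martingale_on Q (path_sigma \<kappa> r t) r t (W r) \<longleftrightarrow> centered Q (path_sigma \<kappa> r t) W r t"
proof -
  have "martingale_on Q (path_sigma \<kappa> r t) r t (W r) \<longleftrightarrow>
    (\<forall>u v A. r \<le> u \<and> u \<le> v \<and> v \<le> t \<and> A \<in> sets (path_sigma \<kappa> r t u) \<longrightarrow>
      (\<integral>\<omega>. indicator A \<omega> * (W r v \<omega> - W r u \<omega>) \<partial>Q) = 0)"
    using incrementsD(1)[OF W] increments_integrable[OF W _ _ _ Q] subalgebra_path_measure[OF Q(2)]
    by (intro martingale_on_iff[OF Q(1)]) auto
  moreover have "(\<integral>\<omega>. indicator A \<omega> * (W r v \<omega> - W r u \<omega>) \<partial>Q) = (\<integral>\<omega>. indicator A \<omega> * W u v \<omega> \<partial>Q)"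
    if "r \<le> u" "u \<le> v" "v \<le> t" for u v A
    using incrementsD(3)[OF W _ that(1) _ _ that(2,3)] that
    by (intro Bochner_Integration.integral_cong) (auto simp: space_path_measure[OF Q(2)])
  ultimately show ?thesis
    unfolding centered_def by auto
qed

lemma mp_solution_iff:
  assumes "\<And>k. k \<in> I \<Longrightarrow> increments \<kappa> r t (W k)" "r \<le> t"
  shows "mp_solution \<kappa> r t I (\<lambda>k. W k r) y Q \<longleftrightarrow>
    prob_space Q \<and> sets Q = sets (path_sigma \<kappa> r t t) \<and> (AE \<omega> in Q. \<omega> r = y) \<and>
    (\<forall>k\<in>I. centered Q (path_sigma \<kappa> r t) (W k) r t)"
proof -
  have "measure Q {\<omega> \<in> space Q. \<omega> r = y} = 1 \<longleftrightarrow> (AE \<omega> in Q. \<omega> r = y)"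
    if Q: "prob_space Q" "sets Q = sets (path_sigma \<kappa> r t t)"
  proof -
    interpret prob_space Q by fact
    have "(\<lambda>\<omega>. \<omega> r) \<in> borel_measurable (path_sigma \<kappa> r t t)"
      using assms(2) by (intro path_coordinate_measurable) auto
    then have [measurable]: "(\<lambda>\<omega>. \<omega> r) \<in> borel_measurable Q"
      using Q(2) by (simp cong: measurable_cong_sets)
    have "{\<omega> \<in> space Q. \<omega> r = y} \<in> sets Q"
      by measurable
    from prob_eq_1[OF this] show ?thesis
      by (auto elim: eventually_mono)
  qed
  then show ?thesis
    unfolding mp_solution_def using martingale_on_iff_centered[OF assms(1)] space_path_measure by blast
qed

lemma increments_on_path:
  fixes Z :: "('a, 'b::finite) mp"
  assumes add: "additive_mp \<kappa> T I Z" and bdd: "bounded_mp \<kappa> T I Z" and k: "k \<in> I" and le: "0 \<le> r" "t \<le> T"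
  shows "increments \<kappa> r t (on_path Z k)"
  unfolding increments_def
proof (intro conjI allI impI ballI)
  fix u v assume uv: "r \<le> u \<and> u \<le> v \<and> v \<le> t"
  have "Z k u v \<in> borel_measurable (path_sigma \<kappa> u v v)"
    using add k uv le unfolding additive_mp_def by auto
  then have "(\<lambda>\<omega>. Z k u v (restrict \<omega> {u..v})) \<in> borel_measurable (path_sigma \<kappa> r t v)"
    using uv by (intro measurable_compose[OF restrict_path_measurable]) auto
  then show "on_path Z k u v \<in> borel_measurable (path_sigma \<kappa> r t v)"
    by (simp add: on_path_def[abs_def])
  obtain C where C: "\<And>\<omega>. \<omega> \<in> path_space \<kappa> u v \<Longrightarrow> \<bar>Z k u v \<omega>\<bar> \<le> C"
    using bdd k uv le unfolding bounded_mp_def by (meson order_trans)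
  have "\<bar>on_path Z k u v \<omega>\<bar> \<le> C" if "\<omega> \<in> path_space \<kappa> r t" for \<omega>
    unfolding on_path_def using uv that by (intro C restrict_in_path_space) auto
  then show "\<exists>C. \<forall>\<omega>\<in>path_space \<kappa> r t. \<bar>on_path Z k u v \<omega>\<bar> \<le> C"
    by blast
next
  fix u v w and \<omega> :: "'b path" assume \<omega>: "\<omega> \<in> path_space \<kappa> r t" and uvw: "r \<le> u \<and> u \<le> v \<and> v \<le> w \<and> w \<le> t"
  have "restrict \<omega> {u..w} \<in> path_space \<kappa> u w"
    using uvw \<omega> by (intro restrict_in_path_space) auto
  then have "Z k u w (restrict \<omega> {u..w}) =
      on_path Z k u v (restrict \<omega> {u..w}) + on_path Z k v w (restrict \<omega> {u..w})"
    using add k uvw le unfolding additive_mp_def by auto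
  moreover have "{u..w} \<inter> {u..v} = {u..v}" "{u..w} \<inter> {v..w} = {v..w}"
    using uvw by auto
  ultimately show "on_path Z k u w \<omega> = on_path Z k u v \<omega> + on_path Z k v w \<omega>"
    by (simp add: on_path_def del: Int_atLeastAtMost)
qed

lemma on_path_cong:
  assumes "\<And>x. u \<le> x \<Longrightarrow> x \<le> v \<Longrightarrow> \<omega> x = \<omega>' x"
  shows "on_path Z k u v \<omega> = on_path Z k u v \<omega>'"
proof -
  have "restrict \<omega> {u..v} = restrict \<omega>' {u..v}"
    using assms by (auto simp: restrict_def)
  then show ?thesis
    by (simp add: on_path_def)
qed

section \<open>Gluing\<close>

text \<open>The law of a path that follows \<open>Q\<close> up to time \<open>s\<close> and continues according to \<open>K\<close>, which sees the
  path up to \<open>s\<close>.\<close>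

definition glue :: "path_kind \<Rightarrow> real \<Rightarrow> real \<Rightarrow> real \<Rightarrow> 'n::finite path measure
    \<Rightarrow> ('n path \<Rightarrow> 'n path measure) \<Rightarrow> 'n path measure" where
  "glue \<kappa> r s T Q K = Q \<bind> (\<lambda>\<omega>. distr (K \<omega>) (path_sigma \<kappa> r T T) (paste r s T \<omega>))"

lemma paste_integral_measurable:
  fixes f :: "'n::finite path \<Rightarrow> real"
  assumes le: "r \<le> s" "s \<le> T"
    and K: "K \<in> path_sigma \<kappa> r T s \<rightarrow>\<^sub>M prob_algebra (path_sigma \<kappa> s T T)"
    and f: "f \<in> borel_measurable (path_sigma \<kappa> r T T)"
  shows "(\<lambda>\<omega>. \<integral>\<omega>'. f (paste r s T \<omega> \<omega>') \<partial>K \<omega>) \<in> borel_measurable (path_sigma \<kappa> r T s)"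
proof (rule kernel_integral_measurable[OF _ K])
  show "(\<lambda>(\<omega>, \<omega>'). f (paste r s T \<omega> \<omega>')) \<in> borel_measurable (path_sigma \<kappa> r T s \<Otimes>\<^sub>M path_sigma \<kappa> s T T)"
    using measurable_compose[OF paste_measurable[OF le(1,2,2) order_refl] f] by (simp add: case_prod_beta)
qed

lemma paste_section_measurable:
  assumes "\<omega> \<in> path_space \<kappa> r T" "r \<le> s" "s \<le> T" "sets P = sets (path_sigma \<kappa> s T T)"
  shows "paste r s T \<omega> \<in> P \<rightarrow>\<^sub>M path_sigma \<kappa> r T T"
  using paste_measurable_snd[OF assms(1,2,3,3) order_refl] assms(4) by (simp cong: measurable_cong_sets)

lemma
  assumes le: "r \<le> s" "s \<le> T" and Q: "prob_space Q" "sets Q = sets (path_sigma \<kappa> r T T)"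
    and K: "K \<in> path_sigma \<kappa> r T s \<rightarrow>\<^sub>M prob_algebra (path_sigma \<kappa> s T T)"
  shows prob_space_glue: "prob_space (glue \<kappa> r s T Q K)"
    and sets_glue: "sets (glue \<kappa> r s T Q K) = sets (path_sigma \<kappa> r T T)"
    and integral_glue: "\<And>f B. f \<in> borel_measurable (path_sigma \<kappa> r T T) \<Longrightarrow>
      (\<And>\<omega>. \<omega> \<in> path_space \<kappa> r T \<Longrightarrow> \<bar>f \<omega>\<bar> \<le> (B::real)) \<Longrightarrow>
      (\<integral>\<omega>. f \<omega> \<partial>glue \<kappa> r s T Q K) = (\<integral>\<omega>. \<integral>\<omega>'. f (paste r s T \<omega> \<omega>') \<partial>K \<omega> \<partial>Q)"
proof -
  let ?k = "\<lambda>\<omega>. distr (K \<omega>) (path_sigma \<kappa> r T T) (paste r s T \<omega>)"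
  have "?k \<in> path_sigma \<kappa> r T s \<rightarrow>\<^sub>M prob_algebra (path_sigma \<kappa> r T T)"
    by (rule measurable_distr_prob_space2[OF K paste_measurable[OF le(1,2,2) order_refl]])
  then have "?k \<in> path_sigma \<kappa> r T T \<rightarrow>\<^sub>M prob_algebra (path_sigma \<kappa> r T T)"
    by (rule measurable_path_sigma_mono[OF le(2)])
  then have k: "?k \<in> Q \<rightarrow>\<^sub>M prob_algebra (path_sigma \<kappa> r T T)"
    using Q(2) by (simp cong: measurable_cong_sets)
  show "prob_space (glue \<kappa> r s T Q K)" "sets (glue \<kappa> r s T Q K) = sets (path_sigma \<kappa> r T T)"
    unfolding glue_def using prob_space_bind_kernel[OF Q(1) k] by auto
  fix f :: "'a path \<Rightarrow> real" and B
  assume f: "f \<in> borel_measurable (path_sigma \<kappa> r T T)" and B: "\<And>\<omega>. \<omega> \<in> path_space \<kappa> r T \<Longrightarrow> \<bar>f \<omega>\<bar> \<le> B"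
  have "(\<integral>\<omega>. f \<omega> \<partial>glue \<kappa> r s T Q K) = (\<integral>\<omega>. \<integral>\<omega>'. f \<omega>' \<partial>?k \<omega> \<partial>Q)"
    unfolding glue_def using B by (intro integral_bind_kernel[OF Q(1) k f]) auto
  also have "\<dots> = (\<integral>\<omega>. \<integral>\<omega>'. f (paste r s T \<omega> \<omega>') \<partial>K \<omega> \<partial>Q)"
  proof (rule Bochner_Integration.integral_cong)
    fix \<omega> assume "\<omega> \<in> space Q"
    then have \<omega>: "\<omega> \<in> path_space \<kappa> r T"
      by (simp add: space_path_measure[OF Q(2)])
    have "sets (K \<omega>) = sets (path_sigma \<kappa> s T T)"
      using kernel_prob_space(2)[OF K] \<omega> by simp
    from paste_section_measurable[OF \<omega> le this]
    show "(\<integral>\<omega>'. f \<omega>' \<partial>?k \<omega>) = (\<integral>\<omega>'. f (paste r s T \<omega> \<omega>') \<partial>K \<omega>)"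
      using f by (rule integral_distr)
  qed simp
  finally show "(\<integral>\<omega>. f \<omega> \<partial>glue \<kappa> r s T Q K) = (\<integral>\<omega>. \<integral>\<omega>'. f (paste r s T \<omega> \<omega>') \<partial>K \<omega> \<partial>Q)" .
qed

lemma paste_local:
  fixes f :: "'n::finite path \<Rightarrow> real"
  assumes "f \<in> borel_measurable (path_sigma \<kappa> r T s)" "r \<le> s" "s \<le> T"
    and "\<omega> \<in> path_space \<kappa> r T" "\<omega>' \<in> path_space \<kappa> s T"
  shows "f (paste r s T \<omega> \<omega>') = f \<omega>"
  using assms by (intro path_sigma_measurable_local[OF assms(1)] paste_in_path_space) (auto simp: paste_before)

lemma paste_integral_local:
  fixes f :: "'n::finite path \<Rightarrow> real"
  assumes f: "f \<in> borel_measurable (path_sigma \<kappa> r T s)" and le: "r \<le> s" "s \<le> T"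
    and \<omega>: "\<omega> \<in> path_space \<kappa> r T" and P: "prob_space P" "sets P = sets (path_sigma \<kappa> s T T)"
  shows "(\<integral>\<omega>'. f (paste r s T \<omega> \<omega>') \<partial>P) = f \<omega>"
proof -
  have "(\<integral>\<omega>'. f (paste r s T \<omega> \<omega>') \<partial>P) = (\<integral>\<omega>'. f \<omega> \<partial>P)"
    using paste_local[OF f le \<omega>] by (intro Bochner_Integration.integral_cong) (auto simp: space_path_measure[OF P(2)])
  then show ?thesis
    using prob_space.prob_space[OF P(1)] by simp
qed

text \<open>Before \<open>s\<close> the glued path is the path under \<open>Q\<close>; after \<open>s\<close> the inner integral vanishes for each
  past. An interval that contains \<open>s\<close> is split there, and the event in question is also an event before
  \<open>s\<close>.\<close>

lemma centered_glue:
  fixes W :: "real \<Rightarrow> real \<Rightarrow> 'a::finite path \<Rightarrow> real"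
  assumes le: "r \<le> s" "s \<le> t" "t \<le> T" and Q: "prob_space Q" "sets Q = sets (path_sigma \<kappa> r T T)"
    and K: "K \<in> path_sigma \<kappa> r T s \<rightarrow>\<^sub>M prob_algebra (path_sigma \<kappa> s T T)"
    and W: "increments \<kappa> r T W" and before: "centered Q (path_sigma \<kappa> r T) W r s"
    and after: "\<And>\<omega> u v A. \<omega> \<in> path_space \<kappa> r T \<Longrightarrow> s \<le> u \<Longrightarrow> u \<le> v \<Longrightarrow> v \<le> t \<Longrightarrow>
      A \<in> sets (path_sigma \<kappa> r T u) \<Longrightarrow>
      (\<integral>\<omega>'. indicator A (paste r s T \<omega> \<omega>') * W u v (paste r s T \<omega> \<omega>') \<partial>K \<omega>) = 0"
  shows "centered (glue \<kappa> r s T Q K) (path_sigma \<kappa> r T) W r t"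
proof -
  have sT: "s \<le> T"
    using le by simp
  let ?G = "glue \<kappa> r s T Q K"
  note G = prob_space_glue[OF le(1) sT Q K] sets_glue[OF le(1) sT Q K]
  have meas: "(\<lambda>\<omega>. indicator A \<omega> * W u v \<omega>) \<in> borel_measurable (path_sigma \<kappa> r T v)"
    if "r \<le> u" "u \<le> v" "v \<le> T" "A \<in> sets (path_sigma \<kappa> r T u)" for u v A
    using incrementsD(1)[OF W that(1-3)] path_sigma_mono[OF that(2,4)]
    by (intro borel_measurable_times borel_measurable_indicator)
  have int: "(\<integral>\<omega>. indicator A \<omega> * W u v \<omega> \<partial>?G) =
      (\<integral>\<omega>. \<integral>\<omega>'. indicator A (paste r s T \<omega> \<omega>') * W u v (paste r s T \<omega> \<omega>') \<partial>K \<omega> \<partial>Q)"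
    if uv: "r \<le> u" "u \<le> v" "v \<le> T" and A: "A \<in> sets (path_sigma \<kappa> r T u)" for u v A
  proof -
    obtain C where C: "\<And>\<omega>. \<omega> \<in> path_space \<kappa> r T \<Longrightarrow> \<bar>W u v \<omega>\<bar> \<le> C"
      using incrementsD(2)[OF W uv] by auto
    show ?thesis
    proof (rule integral_glue[OF le(1) sT Q K])
      show "(\<lambda>\<omega>. indicator A \<omega> * W u v \<omega>) \<in> borel_measurable (path_sigma \<kappa> r T T)"
        using meas[OF uv A] by (rule measurable_path_sigma_mono[OF uv(3)])
      show "\<bar>indicator A \<omega> * W u v \<omega>\<bar> \<le> max 0 C" if "\<omega> \<in> path_space \<kappa> r T" for \<omega>
        using C[OF that] by (auto simp: indicator_def intro: order_trans[OF abs_ge_zero])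
    qed
  qed
  have 1: "(\<integral>\<omega>. indicator A \<omega> * W u v \<omega> \<partial>?G) = 0"
    if uv: "r \<le> u" "u \<le> v" "v \<le> s" and A: "A \<in> sets (path_sigma \<kappa> r T u)" for u v A
  proof -
    have f: "(\<lambda>\<omega>. indicator A \<omega> * W u v \<omega>) \<in> borel_measurable (path_sigma \<kappa> r T s)"
      using uv sT by (intro measurable_path_sigma_mono[OF uv(3)] meas A) auto
    have "(\<integral>\<omega>. indicator A \<omega> * W u v \<omega> \<partial>?G) =
        (\<integral>\<omega>. \<integral>\<omega>'. indicator A (paste r s T \<omega> \<omega>') * W u v (paste r s T \<omega> \<omega>') \<partial>K \<omega> \<partial>Q)"
      using uv sT by (intro int A) auto
    also have "\<dots> = (\<integral>\<omega>. indicator A \<omega> * W u v \<omega> \<partial>Q)"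
    proof (rule Bochner_Integration.integral_cong)
      fix \<omega> assume "\<omega> \<in> space Q"
      then have \<omega>: "\<omega> \<in> path_space \<kappa> r T"
        by (simp add: space_path_measure[OF Q(2)])
      show "(\<integral>\<omega>'. indicator A (paste r s T \<omega> \<omega>') * W u v (paste r s T \<omega> \<omega>') \<partial>K \<omega>) = indicator A \<omega> * W u v \<omega>"
        using kernel_prob_space[OF K] \<omega> by (intro paste_integral_local[OF f le(1) sT \<omega>]) auto
    qed simp
    also have "\<dots> = 0"
      using before uv A unfolding centered_def by blast
    finally show ?thesis .
  qed
  have 2: "(\<integral>\<omega>. indicator A \<omega> * W u v \<omega> \<partial>?G) = 0"
    if uv: "s \<le> u" "u \<le> v" "v \<le> t" and A: "A \<in> sets (path_sigma \<kappa> r T u)" for u v A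
  proof -
    have "(\<integral>\<omega>. indicator A \<omega> * W u v \<omega> \<partial>?G) =
        (\<integral>\<omega>. \<integral>\<omega>'. indicator A (paste r s T \<omega> \<omega>') * W u v (paste r s T \<omega> \<omega>') \<partial>K \<omega> \<partial>Q)"
      using uv le by (intro int A) auto
    also have "\<dots> = (\<integral>\<omega>. 0 \<partial>Q)"
      using after[OF _ uv A] by (intro Bochner_Integration.integral_cong) (auto simp: space_path_measure[OF Q(2)])
    finally show ?thesis by simp
  qed
  show ?thesis
    unfolding centered_def
  proof (intro allI impI)
    fix u v and A :: "'a path set"
    assume *: "r \<le> u \<and> u \<le> v \<and> v \<le> t \<and> A \<in> sets (path_sigma \<kappa> r T u)"
    consider "v \<le> s" | "s \<le> u" | "u \<le> s" "s \<le> v" by linarith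
    then show "(\<integral>\<omega>. indicator A \<omega> * W u v \<omega> \<partial>?G) = 0"
    proof cases
      \<comment> \<open>The event is also an event before \<open>s\<close>, so both parts of the increment can be integrated over it.\<close>
      case 3
      have As: "A \<in> sets (path_sigma \<kappa> r T s)"
        using * 3 path_sigma_mono by blast
      have AG: "A \<in> sets ?G"
        using As path_sigma_mono[OF sT] by (auto simp: G(2))
      have "integrable ?G (\<lambda>\<omega>. indicator A \<omega> * W u s \<omega>)" "integrable ?G (\<lambda>\<omega>. indicator A \<omega> * W s v \<omega>)"
        using * 3 le integrable_mult_indicator[OF AG increments_integrable[OF W _ _ _ G]] by auto
      then have "(\<integral>\<omega>. indicator A \<omega> * W u s \<omega> + indicator A \<omega> * W s v \<omega> \<partial>?G) =
          (\<integral>\<omega>. indicator A \<omega> * W u s \<omega> \<partial>?G) + (\<integral>\<omega>. indicator A \<omega> * W s v \<omega> \<partial>?G)"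
        by (rule Bochner_Integration.integral_add)
      also have "\<dots> = 0"
        using 1[of u s A] 2[of s v A] * 3 le As by simp
      also have "(\<integral>\<omega>. indicator A \<omega> * W u s \<omega> + indicator A \<omega> * W s v \<omega> \<partial>?G) = (\<integral>\<omega>. indicator A \<omega> * W u v \<omega> \<partial>?G)"
        using * 3 le incrementsD(3)[OF W, of u s _ v]
        by (intro Bochner_Integration.integral_cong) (auto simp: space_path_measure[OF G(2)] algebra_simps)
      finally show ?thesis .
    qed (use * 1 2 in auto)
  qed
qed

lemma AE_glue_initial:
  assumes le: "r \<le> s" "s \<le> T" and Q: "prob_space Q" "sets Q = sets (path_sigma \<kappa> r T T)"
    and K: "K \<in> path_sigma \<kappa> r T s \<rightarrow>\<^sub>M prob_algebra (path_sigma \<kappa> s T T)"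
    and y: "AE \<omega> in Q. \<omega> r = y"
  shows "AE \<omega> in glue \<kappa> r s T Q K. \<omega> r = y"
proof -
  note G = prob_space_glue[OF le Q K] sets_glue[OF le Q K]
  interpret Q: prob_space Q by fact
  interpret G: prob_space "glue \<kappa> r s T Q K" by (rule G)
  define A where "A = {\<omega> \<in> path_space \<kappa> r T. \<omega> r = y}"
  have AS: "A \<inter> path_space \<kappa> r T = A"
    by (auto simp: A_def)
  have A: "A \<in> sets (path_sigma \<kappa> r T s)"
  proof -
    have [measurable]: "(\<lambda>\<omega>. \<omega> r) \<in> borel_measurable (path_sigma \<kappa> r T s)"
      using le by (intro path_coordinate_measurable) auto
    have "{\<omega> \<in> space (path_sigma \<kappa> r T s). \<omega> r = y} \<in> sets (path_sigma \<kappa> r T s)"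
      by measurable
    then show ?thesis by (simp add: A_def)
  qed
  have AT: "A \<in> sets (path_sigma \<kappa> r T T)"
    using path_sigma_mono[OF le(2) A] .
  have "G.prob A = (\<integral>\<omega>. indicator A \<omega> \<partial>glue \<kappa> r s T Q K)"
    by (simp add: space_path_measure[OF G(2)] AS)
  also have "\<dots> = (\<integral>\<omega>. \<integral>\<omega>'. indicator A (paste r s T \<omega> \<omega>') \<partial>K \<omega> \<partial>Q)"
    using AT by (intro integral_glue[OF le Q K, where B = 1] borel_measurable_indicator) auto
  also have "\<dots> = (\<integral>\<omega>. indicator A \<omega> \<partial>Q)"
    using paste_integral_local[OF borel_measurable_indicator[OF A] le] kernel_prob_space[OF K]
    by (intro Bochner_Integration.integral_cong) (auto simp: space_path_measure[OF Q(2)])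
  also have "\<dots> = Q.prob A"
    by (simp add: space_path_measure[OF Q(2)] AS)
  also have "\<dots> = 1"
    using y AT AE_space by (subst Q.prob_eq_1) (auto simp: Q(2) A_def space_path_measure[OF Q(2)])
  finally show ?thesis
    using AT by (subst (asm) G.prob_eq_1) (auto simp: G(2) A_def elim: eventually_mono)
qed

text \<open>Almost surely the second path starts at the end of the first one, so after \<open>s\<close> the pasted path is
  the second path, without a shift.\<close>

lemma paste_centered:
  assumes \<omega>: "\<omega> \<in> path_space \<kappa> r T" and le: "0 \<le> r" "r \<le> s" "s \<le> u" "u \<le> v" "v \<le> T"
    and P: "prob_space P" "sets P = sets (path_sigma \<kappa> s T T)" "AE \<omega>' in P. \<omega>' s = \<omega> s"
    and Z: "increments \<kappa> r T (on_path Z k)" "increments \<kappa> s T (on_path Z k)" and c: "centered P (path_sigma \<kappa> s T) (on_path Z k) s T"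
    and A: "A \<in> sets (path_sigma \<kappa> r T u)"
  shows "(\<integral>\<omega>'. indicator A (paste r s T \<omega> \<omega>') * on_path Z k u v (paste r s T \<omega> \<omega>') \<partial>P) = 0"
proof -
  have sT: "s \<le> T" and uT: "u \<le> T" and rv: "r \<le> u"
    using le by auto
  let ?A = "paste r s T \<omega> -` A \<inter> path_space \<kappa> s T"
  have "?A \<in> sets (path_sigma \<kappa> s T u)"
    using measurable_sets[OF paste_measurable_snd[OF \<omega> le(2) sT le(3) uT] A] by simp
  then have 0: "(\<integral>\<omega>'. indicator ?A \<omega>' * on_path Z k u v \<omega>' \<partial>P) = 0"
    using c le unfolding centered_def by blast
  have p: "paste r s T \<omega> \<in> P \<rightarrow>\<^sub>M path_sigma \<kappa> r T T"
    by (rule paste_section_measurable[OF \<omega> le(2) sT P(2)])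
  have AT: "A \<in> sets (path_sigma \<kappa> r T T)"
    using path_sigma_mono[OF uT A] .
  have "(\<lambda>\<omega>. indicator A \<omega> * on_path Z k u v \<omega> :: real) \<in> borel_measurable (path_sigma \<kappa> r T T)"
    by (intro borel_measurable_times borel_measurable_indicator AT
        measurable_path_sigma_mono[OF le(5) incrementsD(1)[OF Z(1) rv le(4,5)]])
  note m1 = measurable_compose[OF p this]
  have "?A \<in> sets P"
    using measurable_sets[OF p AT] by (simp add: space_path_measure[OF P(2)])
  moreover have "on_path Z k u v \<in> borel_measurable P"
    using measurable_path_sigma_mono[OF le(5) incrementsD(1)[OF Z(2) le(3-5)]] P(2)
    by (simp cong: measurable_cong_sets)
  ultimately have m2: "(\<lambda>\<omega>'. indicator ?A \<omega>' * on_path Z k u v \<omega>' :: real) \<in> borel_measurable P"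
    by (intro borel_measurable_times borel_measurable_indicator)
  have "(\<integral>\<omega>'. indicator A (paste r s T \<omega> \<omega>') * on_path Z k u v (paste r s T \<omega> \<omega>') \<partial>P) =
      (\<integral>\<omega>'. indicator ?A \<omega>' * on_path Z k u v \<omega>' \<partial>P)"
  proof (rule integral_cong_AE[OF m1 m2])
    show "AE \<omega>' in P. indicator A (paste r s T \<omega> \<omega>') * on_path Z k u v (paste r s T \<omega> \<omega>') =
        indicator ?A \<omega>' * on_path Z k u v \<omega>'"
      using P(3) AE_space
    proof eventually_elim
      case (elim \<omega>')
      have "on_path Z k u v (paste r s T \<omega> \<omega>') = on_path Z k u v \<omega>'"
        using le elim by (intro on_path_cong paste_after_eq) auto
      then show ?case
        using elim by (simp add: indicator_def space_path_measure[OF P(2)])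
    qed
  qed
  with 0 show ?thesis by simp
qed

section \<open>The kernels of the parameters\<close>

locale controlled_mp =
  fixes \<kappa> :: path_kind and T :: real
    and \<Theta> :: "('n::finite, 'e::topological_space) control set"
    and I :: "'k set" and Z :: "('n, 'e) control \<Rightarrow> ('k, 'n) mp"
  assumes hypothesis: "theta_hypothesis \<kappa> T \<Theta> I Z"
    and determined: "\<theta> \<in> \<Theta> \<Longrightarrow> countably_determined \<kappa> T I (Z \<theta>)"
begin

abbreviation law :: "('n, 'e) control \<Rightarrow> real \<Rightarrow> real \<Rightarrow> real ^ 'n \<Rightarrow> 'n path measure" where
  "law \<theta> s t \<equiv> mp_law \<kappa> s t I (\<lambda>k. on_path (Z \<theta>) k s)"

lemma additive: "\<theta> \<in> \<Theta> \<Longrightarrow> additive_mp \<kappa> T I (Z \<theta>)"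
  and bounded: "\<theta> \<in> \<Theta> \<Longrightarrow> bounded_mp \<kappa> T I (Z \<theta>)"
  using hypothesis by (auto simp: theta_hypothesis_def)

lemma on_path_increments:
  "\<theta> \<in> \<Theta> \<Longrightarrow> k \<in> I \<Longrightarrow> 0 \<le> s \<Longrightarrow> t \<le> T \<Longrightarrow> increments \<kappa> s t (on_path (Z \<theta>) k)"
  using increments_on_path[OF additive bounded] by blast

lemma ex1_law:
  assumes "\<theta> \<in> \<Theta>" "0 \<le> s" "s < t" "t \<le> T"
  shows "\<exists>!Q. mp_solution \<kappa> s t I (\<lambda>k. on_path (Z \<theta>) k s) y Q"
  using hypothesis assms unfolding theta_hypothesis_def by blast

lemma law_solution:
  assumes "\<theta> \<in> \<Theta>" "0 \<le> s" "s < t" "t \<le> T"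
  shows "mp_solution \<kappa> s t I (\<lambda>k. on_path (Z \<theta>) k s) y (law \<theta> s t y)"
  unfolding mp_law_def by (rule theI'[OF ex1_law[OF assms]])

lemma law_unique:
  assumes "\<theta> \<in> \<Theta>" "0 \<le> s" "s < t" "t \<le> T" "mp_solution \<kappa> s t I (\<lambda>k. on_path (Z \<theta>) k s) y Q"
  shows "Q = law \<theta> s t y"
  using ex1_law[OF assms(1-4)] assms(5) law_solution[OF assms(1-4)] by blast

lemma on_path_solution_iff:
  assumes "\<theta> \<in> \<Theta>" "0 \<le> s" "s \<le> t" "t \<le> T" "K \<subseteq> I"
  shows "mp_solution \<kappa> s t K (\<lambda>k. on_path (Z \<theta>) k s) y Q \<longleftrightarrow>
    prob_space Q \<and> sets Q = sets (path_sigma \<kappa> s t t) \<and> (AE \<omega> in Q. \<omega> s = y) \<and>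
    (\<forall>k\<in>K. centered Q (path_sigma \<kappa> s t) (on_path (Z \<theta>) k) s t)"
  using assms by (intro mp_solution_iff on_path_increments) auto

lemma
  assumes "\<theta> \<in> \<Theta>" "0 \<le> s" "s < t" "t \<le> T"
  shows prob_space_law: "prob_space (law \<theta> s t y)"
    and sets_law: "sets (law \<theta> s t y) = sets (path_sigma \<kappa> s t t)"
    and law_initial: "AE \<omega> in law \<theta> s t y. \<omega> s = y"
    and law_centered: "k \<in> I \<Longrightarrow> centered (law \<theta> s t y) (path_sigma \<kappa> s t) (on_path (Z \<theta>) k) s t"
  using law_solution[OF assms, of y] on_path_solution_iff[of \<theta> s t I y] assms by auto

lemma law_kernel:
  assumes "\<theta> \<in> \<Theta>" "0 \<le> s" "s < T"
  shows "law \<theta> s T \<in> borel \<rightarrow>\<^sub>M prob_algebra (path_sigma \<kappa> s T T)"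
proof (rule weakly_continuous_kernel)
  show "weakly_continuous \<kappa> s T (law \<theta> s T)"
    using hypothesis assms unfolding theta_hypothesis_def by blast
qed (use assms prob_space_law sets_law in auto)

lemma law_path_kernel:
  assumes "\<theta> \<in> \<Theta>" "0 \<le> r" "r \<le> s" "s < T"
  shows "(\<lambda>\<omega>. law \<theta> s T (\<omega> s)) \<in> path_sigma \<kappa> r T s \<rightarrow>\<^sub>M prob_algebra (path_sigma \<kappa> s T T)"
  using assms by (intro measurable_compose[OF path_coordinate_measurable law_kernel]) auto

lemma law_paste_centered:
  assumes "\<theta> \<in> \<Theta>" "k \<in> I" "0 \<le> r" "r \<le> s" "s < T" "\<omega> \<in> path_space \<kappa> r T"
    and "s \<le> u" "u \<le> v" "v \<le> T" "A \<in> sets (path_sigma \<kappa> r T u)"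
  shows "(\<integral>\<omega>'. indicator A (paste r s T \<omega> \<omega>') * on_path (Z \<theta>) k u v (paste r s T \<omega> \<omega>') \<partial>law \<theta> s T (\<omega> s)) = 0"
proof -
  have s: "0 \<le> s"
    using assms by simp
  note law = assms(1) s assms(5) order_refl
  show ?thesis
    by (rule paste_centered[OF assms(6,3,4,7,8,9) prob_space_law[OF law] sets_law[OF law] law_initial[OF law]
        on_path_increments[OF assms(1,2,3) order_refl] on_path_increments[OF assms(1,2) s order_refl]
        law_centered[OF law assms(2)] assms(10)])
qed

text \<open>The glued measure starts from \<open>y\<close> and solves the same problem. So the Markov property is a consequence
  of uniqueness.\<close>

lemma law_markov:
  assumes \<theta>: "\<theta> \<in> \<Theta>" and le: "0 \<le> s" "s \<le> t" "t < T"
  shows "glue \<kappa> s t T (law \<theta> s T y) (\<lambda>\<omega>. law \<theta> t T (\<omega> t)) = law \<theta> s T y"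
proof (rule law_unique)
  have sT: "s < T" and tT: "t \<le> T"
    using le by auto
  let ?Q = "law \<theta> s T y" and ?K = "\<lambda>\<omega>. law \<theta> t T (\<omega> t)"
  note Q = prob_space_law[OF \<theta> le(1) sT order_refl, of y] sets_law[OF \<theta> le(1) sT order_refl, of y]
  have K: "?K \<in> path_sigma \<kappa> s T t \<rightarrow>\<^sub>M prob_algebra (path_sigma \<kappa> t T T)"
    using le by (intro law_path_kernel \<theta>)
  have "centered (glue \<kappa> s t T ?Q ?K) (path_sigma \<kappa> s T) (on_path (Z \<theta>) k) s T" if k: "k \<in> I" for k
  proof (rule centered_glue[OF le(2) tT order_refl Q K])
    show "increments \<kappa> s T (on_path (Z \<theta>) k)"
      using \<theta> k le by (intro on_path_increments) auto
    show "centered ?Q (path_sigma \<kappa> s T) (on_path (Z \<theta>) k) s t"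
      using law_centered[OF \<theta> le(1) sT order_refl k, of y] tT unfolding centered_def by auto
  qed (use \<theta> k le in \<open>intro law_paste_centered, auto\<close>)
  then show "mp_solution \<kappa> s T I (\<lambda>k. on_path (Z \<theta>) k s) y (glue \<kappa> s t T ?Q ?K)"
    using \<theta> le sT prob_space_glue[OF le(2) tT Q K] sets_glue[OF le(2) tT Q K]
      AE_glue_initial[OF le(2) tT Q K law_initial[OF \<theta> le(1) sT order_refl, of y]]
    by (subst on_path_solution_iff) auto
qed (use \<theta> le in auto)

text \<open>Pasting is associative, so the iterated operator integrates \<open>\<psi>\<close> against the glued law, which is the
  law of \<open>\<theta>\<close> itself. This holds at every path, not only almost surely.\<close>

lemma control_operator_flow:
  fixes \<psi> :: "'n path \<Rightarrow> real"
  assumes \<theta>: "\<theta> \<in> \<Theta>" and le: "0 \<le> r" "r \<le> s" "s \<le> t" "t < T"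
    and \<psi>: "\<psi> \<in> borel_measurable (path_sigma \<kappa> r T T)" "\<And>\<omega>. \<omega> \<in> path_space \<kappa> r T \<Longrightarrow> \<bar>\<psi> \<omega>\<bar> \<le> C"
    and \<omega>: "\<omega> \<in> path_space \<kappa> r T"
  shows "control_operator \<kappa> T I Z r \<theta> s (control_operator \<kappa> T I Z r \<theta> t \<psi>) \<omega> = control_operator \<kappa> T I Z r \<theta> s \<psi> \<omega>"
proof -
  have s: "0 \<le> s" "s < T" "s \<le> T" and t: "0 \<le> t" "t \<le> T" "r \<le> t"
    using le by auto
  let ?Q = "law \<theta> s T (\<omega> s)" and ?K = "\<lambda>\<omega>. law \<theta> t T (\<omega> t)"
  note Q = prob_space_law[OF \<theta> s(1,2) order_refl, of "\<omega> s"] sets_law[OF \<theta> s(1,2) order_refl, of "\<omega> s"]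
  have K: "?K \<in> path_sigma \<kappa> s T t \<rightarrow>\<^sub>M prob_algebra (path_sigma \<kappa> t T T)"
    using le by (intro law_path_kernel \<theta>) auto
  have p: "paste r s T \<omega> \<in> path_sigma \<kappa> s T T \<rightarrow>\<^sub>M path_sigma \<kappa> r T T"
    using paste_measurable_snd[OF \<omega> le(2) s(3) s(3) order_refl] .
  have f: "(\<lambda>\<omega>'. \<psi> (paste r s T \<omega> \<omega>')) \<in> borel_measurable (path_sigma \<kappa> s T T)"
    by (rule measurable_compose[OF p \<psi>(1)])
  have "control_operator \<kappa> T I Z r \<theta> s \<psi> \<omega> = (\<integral>\<omega>'. \<psi> (paste r s T \<omega> \<omega>') \<partial>glue \<kappa> s t T ?Q ?K)"
    by (simp add: control_operator_def law_markov[OF \<theta> s(1) le(3,4)])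
  also have "\<dots> = (\<integral>\<omega>'. \<integral>\<omega>''. \<psi> (paste r s T \<omega> (paste s t T \<omega>' \<omega>'')) \<partial>?K \<omega>' \<partial>?Q)"
    by (intro integral_glue[OF le(3) t(2) Q K f, of C] \<psi>(2) paste_in_path_space[OF \<omega>] le s)
  also have "\<dots> = (\<integral>\<omega>'. control_operator \<kappa> T I Z r \<theta> t \<psi> (paste r s T \<omega> \<omega>') \<partial>?Q)"
  proof (rule integral_cong_AE)
    let ?h = "\<lambda>\<omega>'. \<integral>\<omega>''. \<psi> (paste r s T \<omega> (paste s t T \<omega>' \<omega>'')) \<partial>?K \<omega>'"
    have "?h \<in> borel_measurable (path_sigma \<kappa> s T t)"
      by (rule paste_integral_measurable[OF le(3) t(2) K f])
    from measurable_from_subalg[OF subalgebra_path_measure[OF Q(2) t(2)] this]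
    show "?h \<in> borel_measurable ?Q" .
    have "control_operator \<kappa> T I Z r \<theta> t \<psi> \<in> borel_measurable (path_sigma \<kappa> r T t)"
      unfolding control_operator_def[abs_def]
      using \<theta> le by (intro paste_integral_measurable[OF t(3,2) law_path_kernel \<psi>(1)]) auto
    note this[THEN measurable_path_sigma_mono[OF t(2)]]
    from measurable_compose[OF p this]
    show "(\<lambda>\<omega>'. control_operator \<kappa> T I Z r \<theta> t \<psi> (paste r s T \<omega> \<omega>')) \<in> borel_measurable ?Q"
      by (simp add: Q(2) cong: measurable_cong_sets)
    show "AE \<omega>' in ?Q. ?h \<omega>' = control_operator \<kappa> T I Z r \<theta> t \<psi> (paste r s T \<omega> \<omega>')"
      using law_initial[OF \<theta> s(1,2) order_refl, of "\<omega> s"]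
    proof eventually_elim
      case (elim \<omega>')
      then have "paste r s T \<omega> \<omega>' t = \<omega>' t"
        using le by (intro paste_after_eq) auto
      then show ?case
        unfolding control_operator_def using le by (simp add: paste_assoc)
    qed
  qed
  finally show ?thesis
    by (simp add: control_operator_def[of _ _ _ _ _ _ s])
qed

end

section \<open>The operators of a piecewise control\<close>

locale switched_mp_problem = controlled_mp \<kappa> T \<Theta> I Z
  for \<kappa> T and \<Theta> :: "('n::finite, 'e::topological_space) control set"
    and I :: "'k set" and Z :: "('n, 'e) control \<Rightarrow> ('k, 'n) mp" +
  fixes r :: real and R :: "('n, 'e) switching"
  assumes r0: "0 \<le> r" and rT: "r < T" and R: "is_switching \<kappa> T \<Theta> r R"
begin

abbreviation \<Omega> :: "'n path set" where "\<Omega> \<equiv> path_space \<kappa> r T"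
abbreviation \<F> :: "real \<Rightarrow> 'n path measure" where "\<F> u \<equiv> path_sigma \<kappa> r T u"
abbreviation "\<tau> \<equiv> times R"
abbreviation "N \<equiv> steps R"

lemma times_0[simp]: "\<tau> 0 = r" and times_steps[simp]: "\<tau> N = T"
  using R by (auto simp: is_switching_def)

lemma times_less: "i < N \<Longrightarrow> \<tau> i < \<tau> (Suc i)"
  using R by (auto simp: is_switching_def)

lemma times_mono: "i \<le> j \<Longrightarrow> j \<le> N \<Longrightarrow> \<tau> i \<le> \<tau> j"
  using is_switching_times_mono[OF R] .

lemma times_ge: "i \<le> N \<Longrightarrow> r \<le> \<tau> i" and times_le: "i \<le> N \<Longrightarrow> \<tau> i \<le> T"
  using is_switching_times_bounds[OF R] by auto

lemma times_lessT: "i < N \<Longrightarrow> \<tau> i < T"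
  using times_less[of i] times_le[of "Suc i"] by auto

lemma step_of_time:
  assumes "r \<le> s" "s < T"
  obtains i where "i < N" "\<tau> i \<le> s" "s < \<tau> (Suc i)"
proof -
  have "\<exists>i<m. \<tau> i \<le> s \<and> s < \<tau> (Suc i)" if "m \<le> N" "s < \<tau> m" for m
    using that
  proof (induction m)
    case 0
    then show ?case using assms by simp
  next
    case (Suc m)
    show ?case
    proof (cases "s < \<tau> m")
      case True
      then obtain i where "i < m" "\<tau> i \<le> s \<and> s < \<tau> (Suc i)"
        using Suc by auto
      then show ?thesis by (intro exI[of _ i]) auto
    qed (use Suc in auto)
  qed
  from this[of N] show ?thesis
    using assms that by auto
qed

definition active :: "nat \<Rightarrow> 'n path \<Rightarrow> nat" where
  "active i \<omega> = (THE j. j \<in> labels R i \<and> \<omega> \<in> cells R i j)"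

lemma active_eq:
  assumes "i < N" "j \<in> labels R i" "\<omega> \<in> cells R i j"
  shows "active i \<omega> = j"
proof -
  have "disjoint_family_on (cells R i) (labels R i)"
    using R assms(1) by (auto simp: is_switching_def)
  then show ?thesis
    unfolding active_def using assms(2,3) by (intro the_equality) (auto simp: disjoint_family_on_def)
qed

lemma active_cell:
  assumes "i < N" "\<omega> \<in> \<Omega>"
  shows "active i \<omega> \<in> labels R i" "\<omega> \<in> cells R i (active i \<omega>)"
proof -
  have "(\<Union>j\<in>labels R i. cells R i j) = \<Omega>"
    using R assms(1) by (auto simp: is_switching_def)
  then obtain j where "j \<in> labels R i" "\<omega> \<in> cells R i j"
    using assms(2) by blast
  then show "active i \<omega> \<in> labels R i" "\<omega> \<in> cells R i (active i \<omega>)"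
    using active_eq[OF assms(1)] by auto
qed

lemma cells_measurable:
  "i < N \<Longrightarrow> j \<in> labels R i \<Longrightarrow> cells R i j \<in> sets (\<F> (\<tau> i))"
  using R by (auto simp: is_switching_def)

lemma params_in: "i < N \<Longrightarrow> j \<in> labels R i \<Longrightarrow> params R i j \<in> \<Theta>"
  using R by (auto simp: is_switching_def)

lemma finite_labels: "i < N \<Longrightarrow> finite (labels R i)"
  using R by (auto simp: is_switching_def)

text \<open>The sums over the cells of a partition that define the step operators and the switched family reduce to
  the term of the active parameter.\<close>

lemma sum_cells:
  fixes f :: "nat \<Rightarrow> real"
  assumes "i < N" "\<omega> \<in> \<Omega>"
  shows "(\<Sum>j\<in>labels R i. f j * indicator (cells R i j) \<omega>) = f (active i \<omega>)"
proof -
  have "(\<Sum>j\<in>labels R i. f j * indicator (cells R i j) \<omega>) = (\<Sum>j\<in>labels R i. if j = active i \<omega> then f j else 0)"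
  proof (rule sum.cong)
    fix j assume j: "j \<in> labels R i"
    have "\<omega> \<in> cells R i j \<longleftrightarrow> j = active i \<omega>"
      using active_eq[OF assms(1) j] active_cell(2)[OF assms] by blast
    then show "f j * indicator (cells R i j) \<omega> = (if j = active i \<omega> then f j else 0)"
      by (cases "j = active i \<omega>") simp_all
  qed simp
  then show ?thesis
    using active_cell(1)[OF assms] finite_labels[OF assms(1)] by simp
qed

abbreviation current :: "nat \<Rightarrow> 'n path \<Rightarrow> ('n, 'e) control" where
  "current i \<omega> \<equiv> params R i (active i \<omega>)"

lemma current_in: "i < N \<Longrightarrow> \<omega> \<in> \<Omega> \<Longrightarrow> current i \<omega> \<in> \<Theta>"
  by (intro params_in active_cell)

text \<open>The cells of a step are decided at its beginning.\<close>

lemma active_paste: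
  assumes i: "i < N" "\<tau> i \<le> s" "s \<le> T" and \<omega>: "\<omega> \<in> \<Omega>" "\<omega>' \<in> path_space \<kappa> s T"
  shows "active i (paste r s T \<omega> \<omega>') = active i \<omega>"
proof (rule active_eq[OF i(1)])
  have rs: "r \<le> s"
    using times_ge[of i] i by simp
  show "active i \<omega> \<in> labels R i"
    using active_cell(1)[OF i(1) \<omega>(1)] .
  have "\<omega> \<in> cells R i (active i \<omega>)"
    using active_cell(2)[OF i(1) \<omega>(1)] .
  moreover have "cells R i (active i \<omega>) \<in> sets (\<F> s)"
    using cells_measurable[OF i(1) active_cell(1)[OF i(1) \<omega>(1)]] path_sigma_mono[OF i(2)] by auto
  ultimately show "paste r s T \<omega> \<omega>' \<in> cells R i (active i \<omega>)"
    using path_sigma_sets_local[of _ \<kappa> r T s "paste r s T \<omega> \<omega>'" \<omega>] \<omega> rs i(3)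
    by (auto simp: paste_before intro!: paste_in_path_space)
qed

text \<open>The law of the future of time \<open>s\<close> if the parameter that is active in step \<open>i\<close> were kept up to the
  horizon. The solution follows this law until the end of the step.\<close>

definition step_law :: "nat \<Rightarrow> real \<Rightarrow> 'n path \<Rightarrow> 'n path measure" where
  "step_law i s \<omega> = law (current i \<omega>) s T (\<omega> s)"

lemma step_law_kernel:
  assumes i: "i < N" "\<tau> i \<le> s" "s < T"
  shows "step_law i s \<in> \<F> s \<rightarrow>\<^sub>M prob_algebra (path_sigma \<kappa> s T T)"
proof (rule measurable_piecewise_restrict[where C = "cells R i ` labels R i"])
  show "countable (cells R i ` labels R i)"
    using finite_labels[OF i(1)] by (intro countable_finite) auto
  show "space (\<F> s) \<subseteq> \<Union> (cells R i ` labels R i)"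
    using active_cell[OF i(1)] by auto
  fix A assume "A \<in> cells R i ` labels R i"
  then obtain j where j: "j \<in> labels R i" "A = cells R i j"
    by auto
  have A: "A \<in> sets (\<F> s)"
    using cells_measurable[OF i(1) j(1)] path_sigma_mono[OF i(2)] j(2) by auto
  then show "A \<inter> space (\<F> s) \<in> sets (\<F> s)"
    by (intro sets.Int sets.top)
  have "r \<le> s"
    using times_ge[of i] i by simp
  then have "(\<lambda>\<omega>. law (params R i j) s T (\<omega> s)) \<in> \<F> s \<rightarrow>\<^sub>M prob_algebra (path_sigma \<kappa> s T T)"
    using i j r0 by (intro law_path_kernel params_in)
  then have "(\<lambda>\<omega>. law (params R i j) s T (\<omega> s)) \<in> restrict_space (\<F> s) A \<rightarrow>\<^sub>M prob_algebra (path_sigma \<kappa> s T T)"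
    by (rule measurable_restrict_space1)
  moreover have "step_law i s \<omega> = law (params R i j) s T (\<omega> s)" if "\<omega> \<in> space (restrict_space (\<F> s) A)" for \<omega>
    using that active_eq[OF i(1) j(1)] by (auto simp: step_law_def space_restrict_space j(2))
  ultimately show "step_law i s \<in> restrict_space (\<F> s) A \<rightarrow>\<^sub>M prob_algebra (path_sigma \<kappa> s T T)"
    by (simp cong: measurable_cong)
qed

abbreviation "step_op \<equiv> step_operator \<kappa> T I Z r R"

lemma step_operator_current:
  assumes "i < N" "\<omega> \<in> \<Omega>"
  shows "step_op i s \<psi> \<omega> = control_operator \<kappa> T I Z r (current i \<omega>) s \<psi> \<omega>"
  unfolding step_operator_def
  using assms sum_cells[OF assms, of "\<lambda>j. control_operator \<kappa> T I Z r (params R i j) s \<psi> \<omega>"]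
  by (simp add: mult.commute)

lemma step_operator_integral:
  assumes "i < N" "\<omega> \<in> \<Omega>"
  shows "step_op i s \<psi> \<omega> = (\<integral>\<omega>'. \<psi> (paste r s T \<omega> \<omega>') \<partial>step_law i s \<omega>)"
  unfolding step_operator_current[OF assms] control_operator_def step_law_def ..

lemma bounded_path_functionsD:
  assumes "\<psi> \<in> bounded_path_functions \<kappa> r T u" "u \<le> T"
  shows "\<psi> \<in> borel_measurable (\<F> u)" "\<psi> \<in> borel_measurable (\<F> T)" "\<psi> \<in> extensional \<Omega>"
    "\<exists>C. \<forall>\<omega>\<in>\<Omega>. \<bar>\<psi> \<omega>\<bar> \<le> C"
proof -
  show "\<psi> \<in> borel_measurable (\<F> u)" "\<psi> \<in> extensional \<Omega>" "\<exists>C. \<forall>\<omega>\<in>\<Omega>. \<bar>\<psi> \<omega>\<bar> \<le> C"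
    using assms(1) unfolding bounded_path_functions_def by blast+
  then show "\<psi> \<in> borel_measurable (\<F> T)"
    by (intro measurable_path_sigma_mono[OF assms(2)])
qed

lemma bounded_path_functions_mono:
  "u \<le> v \<Longrightarrow> \<psi> \<in> bounded_path_functions \<kappa> r T u \<Longrightarrow> \<psi> \<in> bounded_path_functions \<kappa> r T v"
  using measurable_path_sigma_mono[of u v \<psi> \<kappa> r T borel] unfolding bounded_path_functions_def by blast

lemma step_law_prob:
  assumes "i < N" "\<tau> i \<le> s" "s < T" "\<omega> \<in> \<Omega>"
  shows "prob_space (step_law i s \<omega>)" "sets (step_law i s \<omega>) = sets (path_sigma \<kappa> s T T)"
    "space (step_law i s \<omega>) = path_space \<kappa> s T"
  using kernel_prob_space[OF step_law_kernel[OF assms(1-3)]] assms(4) by auto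

lemma step_operator_in:
  assumes i: "i < N" "\<tau> i \<le> s" "s < T" and \<psi>: "\<psi> \<in> bounded_path_functions \<kappa> r T T"
  shows "step_op i s \<psi> \<in> bounded_path_functions \<kappa> r T s"
proof -
  have rs: "r \<le> s" "s \<le> T"
    using times_ge[of i] i by auto
  have \<psi>': "\<psi> \<in> borel_measurable (\<F> T)" and "\<exists>C. \<forall>\<omega>\<in>\<Omega>. \<bar>\<psi> \<omega>\<bar> \<le> C"
    using bounded_path_functionsD[OF \<psi>] by auto
  then obtain C where C: "\<And>\<omega>. \<omega> \<in> \<Omega> \<Longrightarrow> \<bar>\<psi> \<omega>\<bar> \<le> C"
    by auto
  have "(\<lambda>\<omega>. \<integral>\<omega>'. \<psi> (paste r s T \<omega> \<omega>') \<partial>step_law i s \<omega>) \<in> borel_measurable (\<F> s)"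
    by (rule paste_integral_measurable[OF rs step_law_kernel[OF i] \<psi>'])
  then have "step_op i s \<psi> \<in> borel_measurable (\<F> s)"
    by (rule measurable_cong[THEN iffD1, rotated]) (simp add: step_operator_integral[OF i(1)])
  moreover have "\<bar>step_op i s \<psi> \<omega>\<bar> \<le> C" if \<omega>: "\<omega> \<in> \<Omega>" for \<omega>
    unfolding step_operator_integral[OF i(1) \<omega>]
    using step_law_prob[OF i \<omega>] \<omega> rs by (intro integral_bounded_le C paste_in_path_space) auto
  moreover have "step_op i s \<psi> \<in> extensional \<Omega>"
    by (simp add: step_operator_def)
  ultimately show ?thesis
    by (auto simp: bounded_path_functions_def)
qed

lemma step_operator_id:
  assumes i: "i < N" "\<tau> i \<le> s" "s < T" and \<psi>: "\<psi> \<in> bounded_path_functions \<kappa> r T s"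
  shows "step_op i s \<psi> = \<psi>"
proof (rule extensionalityI[of _ \<Omega>])
  show "step_op i s \<psi> \<in> extensional \<Omega>" "\<psi> \<in> extensional \<Omega>"
    using \<psi> by (auto simp: step_operator_def bounded_path_functions_def)
  fix \<omega> assume \<omega>: "\<omega> \<in> \<Omega>"
  have rs: "r \<le> s" "s \<le> T"
    using times_ge[of i] i by auto
  show "step_op i s \<psi> \<omega> = \<psi> \<omega>"
    unfolding step_operator_integral[OF i(1) \<omega>]
    by (rule paste_integral_local[OF bounded_path_functionsD(1)[OF \<psi> rs(2)] rs \<omega> step_law_prob(1,2)[OF i \<omega>]])
qed

text \<open>A change of the path after \<open>s\<close> does not change the active parameter, so within one step the operators
  inherit the flow property of the operators of that parameter.\<close>

lemma step_operator_flow: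
  assumes i: "i < N" "\<tau> i \<le> s" "s \<le> t" "t < T" and \<psi>: "\<psi> \<in> bounded_path_functions \<kappa> r T T"
  shows "step_op i s (step_op i t \<psi>) = step_op i s \<psi>"
proof (rule extensionalityI[of _ \<Omega>])
  show "step_op i s (step_op i t \<psi>) \<in> extensional \<Omega>" "step_op i s \<psi> \<in> extensional \<Omega>"
    by (auto simp: step_operator_def)
  fix \<omega> assume \<omega>: "\<omega> \<in> \<Omega>"
  have s: "r \<le> s" "s < T" "s \<le> T"
    using times_ge[of i] i by auto
  have \<psi>': "\<psi> \<in> borel_measurable (\<F> T)" and "\<exists>C. \<forall>\<omega>\<in>\<Omega>. \<bar>\<psi> \<omega>\<bar> \<le> C"
    using bounded_path_functionsD[OF \<psi>] by auto
  then obtain C where C: "\<And>\<omega>. \<omega> \<in> \<Omega> \<Longrightarrow> \<bar>\<psi> \<omega>\<bar> \<le> C"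
    by auto
  have "step_op i s (step_op i t \<psi>) \<omega> = control_operator \<kappa> T I Z r (current i \<omega>) s (step_op i t \<psi>) \<omega>"
    by (rule step_operator_current[OF i(1) \<omega>])
  also have "\<dots> = control_operator \<kappa> T I Z r (current i \<omega>) s (control_operator \<kappa> T I Z r (current i \<omega>) t \<psi>) \<omega>"
    unfolding control_operator_def[of _ _ _ _ _ _ s]
  proof (rule Bochner_Integration.integral_cong)
    fix \<omega>' assume "\<omega>' \<in> space (law (current i \<omega>) s T (\<omega> s))"
    then have \<omega>': "\<omega>' \<in> path_space \<kappa> s T"
      using step_law_prob(3)[OF i(1,2) s(2) \<omega>] by (simp add: step_law_def)
    then have p: "paste r s T \<omega> \<omega>' \<in> \<Omega>"
      using \<omega> s by (intro paste_in_path_space)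
    show "step_op i t \<psi> (paste r s T \<omega> \<omega>') = control_operator \<kappa> T I Z r (current i \<omega>) t \<psi> (paste r s T \<omega> \<omega>')"
      using step_operator_current[OF i(1) p] active_paste[OF i(1,2) s(3) \<omega> \<omega>'] by simp
  qed simp
  also have "\<dots> = control_operator \<kappa> T I Z r (current i \<omega>) s \<psi> \<omega>"
    by (rule control_operator_flow[OF current_in[OF i(1) \<omega>] r0 s(1) i(3,4) \<psi>' C \<omega>])
  also have "\<dots> = step_op i s \<psi> \<omega>"
    by (rule step_operator_current[OF i(1) \<omega>, symmetric])
  finally show "step_op i s (step_op i t \<psi>) \<omega> = step_op i s \<psi> \<omega>" .
qed

text \<open>The composition of the step operators from the horizon back to the beginning of step \<open>i\<close>.\<close>

function from_step :: "nat \<Rightarrow> ('n path \<Rightarrow> real) \<Rightarrow> 'n path \<Rightarrow> real" where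
  "from_step i \<psi> = (if i < N then step_op i (\<tau> i) (from_step (Suc i) \<psi>) else \<psi>)"
  by auto
termination
  by (relation "Wellfounded.measure (\<lambda>(i, _). N - i)") auto

declare from_step.simps[simp del]

lemma from_step_less: "i < N \<Longrightarrow> from_step i \<psi> = step_op i (\<tau> i) (from_step (Suc i) \<psi>)"
  and from_step_last: "from_step N \<psi> = \<psi>"
  by (simp_all add: from_step.simps[of i] from_step.simps[of N])

lemma from_step_in:
  assumes "i \<le> N" "\<psi> \<in> bounded_path_functions \<kappa> r T T"
  shows "from_step i \<psi> \<in> bounded_path_functions \<kappa> r T (\<tau> i)"
  using assms(1)
proof (induction rule: inc_induct)
  case base
  then show ?case using assms(2) by (simp add: from_step_last)
next
  case (step i)
  then show ?case
    using times_le[of "Suc i"] times_lessT[of i] bounded_path_functions_mono[of "\<tau> (Suc i)" T]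
    by (auto simp: from_step_less intro!: step_operator_in)
qed

lemma from_step_id:
  assumes "i \<le> N" "\<psi> \<in> bounded_path_functions \<kappa> r T (\<tau> i)"
  shows "from_step i \<psi> = \<psi>"
proof -
  have "from_step j \<psi> = \<psi>" if "i \<le> j" "j \<le> N" for j
    using that(2,1)
  proof (induction rule: inc_induct)
    case (step j)
    then have "\<psi> \<in> bounded_path_functions \<kappa> r T (\<tau> j)"
      using assms(2) times_mono[of i j] by (auto intro: bounded_path_functions_mono)
    then show ?case
      using step times_lessT[of j] by (simp add: from_step_less step_operator_id)
  qed (simp add: from_step_last)
  then show ?thesis
    using assms(1) by simp
qed

text \<open>The choice is made only before the horizon, where a time belongs to exactly one step (\<open>step_unique\<close>).\<close>

definition chain :: "real \<Rightarrow> ('n path \<Rightarrow> real) \<Rightarrow> 'n path \<Rightarrow> real" where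
  "chain = (\<lambda>s\<in>{r..T}. \<lambda>\<psi>\<in>bounded_path_functions \<kappa> r T T.
     if s = T then \<psi> else (let i = (SOME i. i < N \<and> \<tau> i \<le> s \<and> s < \<tau> (Suc i)) in step_op i s (from_step (Suc i) \<psi>)))"

lemma step_unique:
  assumes "i < N" "\<tau> i \<le> s" "s < \<tau> (Suc i)" "j < N" "\<tau> j \<le> s" "s < \<tau> (Suc j)"
  shows "i = j"
proof (rule ccontr)
  assume "i \<noteq> j"
  then have "Suc i \<le> j \<or> Suc j \<le> i" by auto
  then show False
    using times_mono[of "Suc i" j] times_mono[of "Suc j" i] assms by auto
qed

lemma chain_step:
  assumes "i < N" "\<tau> i \<le> s" "s < \<tau> (Suc i)" "\<psi> \<in> bounded_path_functions \<kappa> r T T"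
  shows "chain s \<psi> = step_op i s (from_step (Suc i) \<psi>)"
proof -
  have "(SOME i. i < N \<and> \<tau> i \<le> s \<and> s < \<tau> (Suc i)) = i"
    using assms step_unique by (intro some_equality) auto
  moreover have "r \<le> s" "s < T"
    using assms times_ge[of i] times_le[of "Suc i"] by auto
  ultimately show ?thesis
    using assms(4) by (simp add: chain_def)
qed

lemma chain_last: "\<psi> \<in> bounded_path_functions \<kappa> r T T \<Longrightarrow> chain T \<psi> = \<psi>"
  using rT by (simp add: chain_def)

lemma from_step_in_T:
  "i \<le> N \<Longrightarrow> \<psi> \<in> bounded_path_functions \<kappa> r T T \<Longrightarrow> from_step i \<psi> \<in> bounded_path_functions \<kappa> r T T"
  using from_step_in[of i \<psi>] times_le[of i] by (auto intro: bounded_path_functions_mono)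

lemma chain_in:
  assumes "r \<le> s" "s \<le> T" "\<psi> \<in> bounded_path_functions \<kappa> r T T"
  shows "chain s \<psi> \<in> bounded_path_functions \<kappa> r T s"
proof (cases "s = T")
  case False
  then obtain i where i: "i < N" "\<tau> i \<le> s" "s < \<tau> (Suc i)"
    using step_of_time[of s] assms by auto
  show ?thesis
    unfolding chain_step[OF i assms(3)] using i False assms by (intro step_operator_in from_step_in_T) auto
qed (use assms chain_last in auto)

text \<open>In the step that contains \<open>t\<close> this is the flow property; the earlier steps see the two functions only
  through their common value at the beginning of that step.\<close>

lemma from_step_chain:
  assumes "m \<le> N" "\<tau> m \<le> t" "t \<le> T" "\<psi> \<in> bounded_path_functions \<kappa> r T T"
  shows "from_step m (chain t \<psi>) = from_step m \<psi>"
proof (cases "t = T")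
  case True
  then show ?thesis
    using chain_last[OF assms(4)] by simp
next
  case False
  have rt: "r \<le> t"
    using times_ge[OF assms(1)] assms(2) by simp
  obtain i where i: "i < N" "\<tau> i \<le> t" "t < \<tau> (Suc i)"
    using step_of_time[OF rt] assms False by auto
  have "chain t \<psi> \<in> bounded_path_functions \<kappa> r T (\<tau> (Suc i))"
    by (rule bounded_path_functions_mono[OF less_imp_le[OF i(3)] chain_in[OF rt assms(3,4)]])
  then have "from_step i (chain t \<psi>) = step_op i (\<tau> i) (chain t \<psi>)"
    using i by (simp add: from_step_less from_step_id)
  also have "\<dots> = step_op i (\<tau> i) (from_step (Suc i) \<psi>)"
    unfolding chain_step[OF i assms(4)]
    using i False assms by (intro step_operator_flow from_step_in_T) auto
  also have "\<dots> = from_step i \<psi>"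
    using i by (simp add: from_step_less)
  finally have base: "from_step i (chain t \<psi>) = from_step i \<psi>" .
  have "m \<le> i"
  proof (rule ccontr)
    assume "\<not> m \<le> i"
    then have "\<tau> (Suc i) \<le> \<tau> m"
      using assms(1) by (intro times_mono) auto
    with i assms(2) show False by simp
  qed
  then show ?thesis
  proof (induction rule: inc_induct)
    case (step j)
    then show ?case
      using i by (simp add: from_step_less)
  qed (rule base)
qed

lemma chain_chain:
  assumes "r \<le> s" "s \<le> t" "t \<le> T" "\<psi> \<in> bounded_path_functions \<kappa> r T T"
  shows "chain s (chain t \<psi>) = chain s \<psi>"
proof (cases "t = T")
  case True
  then show ?thesis
    using chain_last[OF assms(4)] by simp
next
  case False
  then obtain i where i: "i < N" "\<tau> i \<le> s" "s < \<tau> (Suc i)"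
    using step_of_time[of s] assms by auto
  have t: "chain t \<psi> \<in> bounded_path_functions \<kappa> r T T" "chain t \<psi> \<in> bounded_path_functions \<kappa> r T t"
    using chain_in[of t \<psi>] assms bounded_path_functions_mono[of t T] by auto
  show ?thesis
  proof (cases "t < \<tau> (Suc i)")
    case True
    then have "chain t \<psi> \<in> bounded_path_functions \<kappa> r T (\<tau> (Suc i))"
      by (intro bounded_path_functions_mono[OF less_imp_le t(2)])
    then have "chain s (chain t \<psi>) = step_op i s (chain t \<psi>)"
      using i by (simp add: chain_step[OF i t(1)] from_step_id)
    also have "\<dots> = step_op i s (step_op i t (from_step (Suc i) \<psi>))"
      using chain_step[of i t \<psi>] i True assms by simp
    also have "\<dots> = step_op i s (from_step (Suc i) \<psi>)"
      using i False assms by (intro step_operator_flow from_step_in_T) auto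
    finally show ?thesis
      by (simp add: chain_step[OF i assms(4)])
  next
    case False
    then show ?thesis
      using i assms by (simp add: chain_step[OF i] t(1) from_step_chain)
  qed
qed

lemma chain_step_measurable:
  assumes "i < N" "\<tau> i \<le> s" "s < \<tau> (Suc i)" "\<psi> \<in> bounded_path_functions \<kappa> r T (\<tau> (Suc i))"
  shows "chain s \<psi> = step_op i s \<psi>"
proof -
  have "\<psi> \<in> bounded_path_functions \<kappa> r T T"
    using assms times_le[of "Suc i"] by (auto intro: bounded_path_functions_mono)
  then show ?thesis
    using chain_step[OF assms(1-3)] assms by (simp add: from_step_id)
qed

lemma chain_extension_chain: "chain_extension \<kappa> T I Z r R chain"
  unfolding chain_extension_def
proof (intro conjI ballI allI impI)
  show "chain \<in> {r..T} \<rightarrow>\<^sub>E (bounded_path_functions \<kappa> r T T \<rightarrow>\<^sub>E bounded_path_functions \<kappa> r T T)"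
  proof (intro PiE_I)
    fix s and \<psi> :: "'n path \<Rightarrow> real" assume "s \<in> {r..T}" "\<psi> \<in> bounded_path_functions \<kappa> r T T"
    then show "chain s \<psi> \<in> bounded_path_functions \<kappa> r T T"
      using chain_in[of s \<psi>] bounded_path_functions_mono[of s T] by auto
  qed (auto simp: chain_def)
qed (use chain_last chain_step_measurable chain_chain in auto)

text \<open>The operators of an extension are prescribed only on functions of the path up to the end of the current
  step. Going down from the horizon, the value at the beginning of a step is such a function for the step
  before, so the chain rule reduces every operator to the prescribed ones.\<close>

lemma chain_extension_unique:
  assumes E: "chain_extension \<kappa> T I Z r R E"
  shows "E = chain"
proof (rule extensionalityI[of _ "{r..T}"])
  let ?B = "bounded_path_functions \<kappa> r T T"
  have PiE: "E \<in> {r..T} \<rightarrow>\<^sub>E (?B \<rightarrow>\<^sub>E ?B)" and last: "\<And>\<psi>. \<psi> \<in> ?B \<Longrightarrow> E T \<psi> = \<psi>"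
    and step: "\<And>i s \<psi>. i < N \<Longrightarrow> \<tau> i \<le> s \<Longrightarrow> s < \<tau> (Suc i) \<Longrightarrow>
      \<psi> \<in> bounded_path_functions \<kappa> r T (\<tau> (Suc i)) \<Longrightarrow> E s \<psi> = step_op i s \<psi>"
    and rule: "\<And>s t \<psi>. \<psi> \<in> ?B \<Longrightarrow> r \<le> s \<Longrightarrow> s \<le> t \<Longrightarrow> t \<le> T \<Longrightarrow> E s \<psi> = E s (E t \<psi>)"
    using E unfolding chain_extension_def by (blast, blast, simp, blast)
  show "E \<in> extensional {r..T}" "chain \<in> extensional {r..T}"
    using PiE by (auto simp: PiE_def chain_def)
  have E_step: "E s \<psi> = step_op i s (E (\<tau> (Suc i)) \<psi>)"
    if "i < N" "\<tau> i \<le> s" "s < \<tau> (Suc i)" "\<psi> \<in> ?B" "E (\<tau> (Suc i)) \<psi> \<in> bounded_path_functions \<kappa> r T (\<tau> (Suc i))" for i s \<psi>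
    using rule[of \<psi> s "\<tau> (Suc i)"] step[OF that(1-3,5)] that times_ge[of i] times_le[of "Suc i"] by simp
  have E_times: "E (\<tau> i) \<psi> = from_step i \<psi>" if "i \<le> N" "\<psi> \<in> ?B" for i \<psi>
    using that(1)
  proof (induction rule: inc_induct)
    case base
    then show ?case using last[OF that(2)] by (simp add: from_step_last)
  next
    case (step i)
    then show ?case
      using E_step[of i "\<tau> i" \<psi>] that(2) times_less[of i] from_step_in[of "Suc i" \<psi>] by (simp add: from_step_less)
  qed
  fix s assume s: "s \<in> {r..T}"
  show "E s = chain s"
  proof (rule extensionalityI[of _ ?B])
    show "E s \<in> extensional ?B" "chain s \<in> extensional ?B"
      using PiE s by (auto simp: PiE_def chain_def)
    fix \<psi> :: "'n path \<Rightarrow> real" assume \<psi>: "\<psi> \<in> ?B"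
    show "E s \<psi> = chain s \<psi>"
    proof (cases "s = T")
      case False
      then obtain i where i: "i < N" "\<tau> i \<le> s" "s < \<tau> (Suc i)"
        using step_of_time[of s] s by auto
      then show ?thesis
        using E_step[OF i \<psi>] E_times[of "Suc i" \<psi>] \<psi> from_step_in[of "Suc i" \<psi>] chain_step[OF i \<psi>] by simp
    qed (simp add: last \<psi> chain_last)
  qed
qed

end

section \<open>Existence of a solution\<close>

lemma bounded_sum_exists:
  fixes f :: "'a \<Rightarrow> 'b \<Rightarrow> real"
  assumes "finite S" "\<And>i. i \<in> S \<Longrightarrow> \<exists>C. \<forall>\<omega>\<in>X. \<bar>f i \<omega>\<bar> \<le> C"
  shows "\<exists>C. \<forall>\<omega>\<in>X. \<bar>\<Sum>i\<in>S. f i \<omega>\<bar> \<le> C"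
  using assms
proof (induction S rule: finite_induct)
  case (insert i S)
  obtain B where B: "\<And>\<omega>. \<omega> \<in> X \<Longrightarrow> \<bar>\<Sum>i\<in>S. f i \<omega>\<bar> \<le> B"
    using insert by auto
  obtain C where C: "\<And>\<omega>. \<omega> \<in> X \<Longrightarrow> \<bar>f i \<omega>\<bar> \<le> C"
    using insert.prems[of i] by blast
  have "\<bar>\<Sum>i\<in>insert i S. f i \<omega>\<bar> \<le> C + B" if "\<omega> \<in> X" for \<omega>
    using insert(1,2) B[OF that] C[OF that] by simp
  then show ?case
    by blast
qed auto

context switched_mp_problem
begin

abbreviation W :: "'k \<Rightarrow> real \<Rightarrow> real \<Rightarrow> 'n path \<Rightarrow> real" where
  "W \<equiv> switched_mp Z R"

lemma on_path_refl:
  assumes "\<theta> \<in> \<Theta>" "k \<in> I" "\<omega> \<in> \<Omega>" "r \<le> u" "u \<le> T"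
  shows "on_path (Z \<theta>) k u u \<omega> = 0"
  using additive_mp_on_path[OF additive[OF assms(1)] assms(2,3) r0 assms(4) order_refl order_refl assms(5)] by simp

text \<open>A step that begins after \<open>v\<close> contributes increments over a single point, which vanish; so the cells
  of later steps, which are not events before \<open>v\<close>, do not matter.\<close>

lemma switched_mp_increments:
  assumes k: "k \<in> I"
  shows "increments \<kappa> r T (W k)"
  unfolding increments_def
proof (intro conjI allI impI ballI)
  fix u v assume uv: "r \<le> u \<and> u \<le> v \<and> v \<le> T"
  let ?t = "\<lambda>i j \<omega>. on_path (Z (params R i j)) k (proj_step R i u) (proj_step R i v) \<omega> * indicator (cells R i j) \<omega>"
  have inc: "increments \<kappa> r T (on_path (Z (params R i j)) k)" if "i < N" "j \<in> labels R i" for i j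
    using that by (intro on_path_increments params_in k r0) auto
  have proj: "r \<le> proj_step R i u" "proj_step R i u \<le> proj_step R i v" "proj_step R i v \<le> T" if "i < N" for i
    using that uv times_ge[of i] times_le[of i] times_le[of "Suc i"] times_less[of i]
    by (auto simp: proj_step_def min_def max_def)
  have "?t i j \<in> borel_measurable (\<F> v)" if i: "i < N" and j: "j \<in> labels R i" for i j
  proof (cases "\<tau> i \<le> v")
    case True
    then have "proj_step R i v \<le> v"
      by (simp add: proj_step_def)
    then have "on_path (Z (params R i j)) k (proj_step R i u) (proj_step R i v) \<in> borel_measurable (\<F> v)"
      using incrementsD(1)[OF inc[OF i j] proj[OF i]] by (rule measurable_path_sigma_mono)
    moreover have "cells R i j \<in> sets (\<F> v)"
      using cells_measurable[OF i j] by (rule path_sigma_mono[OF True])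
    ultimately show ?thesis
      by (intro borel_measurable_times borel_measurable_indicator)
  next
    case False
    then have "proj_step R i u = \<tau> i" "proj_step R i v = \<tau> i"
      using uv times_less[OF i] by (auto simp: proj_step_def)
    then have "?t i j \<omega> = 0" if "\<omega> \<in> space (\<F> v)" for \<omega>
      using that on_path_refl[OF params_in[OF i j] k _ times_ge times_le, of \<omega> i] i by simp
    then have "?t i j \<in> borel_measurable (\<F> v) \<longleftrightarrow> (\<lambda>_. 0 :: real) \<in> borel_measurable (\<F> v)"
      by (rule measurable_cong)
    then show ?thesis
      by simp
  qed
  then show "W k u v \<in> borel_measurable (\<F> v)"
    unfolding switched_mp_def[abs_def] by (intro borel_measurable_sum) auto
  have "\<exists>C. \<forall>\<omega>\<in>\<Omega>. \<bar>?t i j \<omega>\<bar> \<le> C" if i: "i < N" and j: "j \<in> labels R i" for i j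
  proof -
    obtain C where C: "\<And>\<omega>. \<omega> \<in> \<Omega> \<Longrightarrow> \<bar>on_path (Z (params R i j)) k (proj_step R i u) (proj_step R i v) \<omega>\<bar> \<le> C"
      using incrementsD(2)[OF inc[OF i j] proj[OF i]] by auto
    have "\<bar>?t i j \<omega>\<bar> \<le> C" if "\<omega> \<in> \<Omega>" for \<omega>
      using C[OF that] by (auto simp: indicator_def intro: order_trans[OF abs_ge_zero])
    then show ?thesis
      by blast
  qed
  then show "\<exists>C. \<forall>\<omega>\<in>\<Omega>. \<bar>W k u v \<omega>\<bar> \<le> C"
    unfolding switched_mp_def using finite_labels by (intro bounded_sum_exists) auto
next
  fix u v w \<omega> assume "\<omega> \<in> \<Omega>" "r \<le> u \<and> u \<le> v \<and> v \<le> w \<and> w \<le> T"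
  then show "W k u w \<omega> = W k u v \<omega> + W k v w \<omega>"
    using switched_mp_additive[OF R _ k _ r0] additive by blast
qed

lemma switched_mp_current:
  assumes k: "k \<in> I" and i: "i < N" and le: "\<tau> i \<le> u" "u \<le> v" "v \<le> \<tau> (Suc i)" and \<omega>: "\<omega> \<in> \<Omega>"
  shows "W k u v \<omega> = on_path (Z (current i \<omega>)) k u v \<omega>"
proof -
  have add: "\<forall>\<theta>\<in>\<Theta>. additive_mp \<kappa> T I (Z \<theta>)"
    using additive by blast
  have b: "r \<le> \<tau> i" "v \<le> T"
    using times_ge[of i] times_le[of "Suc i"] i le by auto
  have *: "W k (\<tau> i) w \<omega> = on_path (Z (current i \<omega>)) k (\<tau> i) w \<omega>" if "\<tau> i \<le> w" "w \<le> \<tau> (Suc i)" for w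
    unfolding switched_mp_on_step[OF R add k \<omega> r0 i that] by (rule sum_cells[OF i \<omega>])
  have "W k (\<tau> i) v \<omega> = W k (\<tau> i) u \<omega> + W k u v \<omega>"
    using switched_mp_additive[OF R add k \<omega> r0 b(1) le(1,2) b(2)] .
  moreover have "on_path (Z (current i \<omega>)) k (\<tau> i) v \<omega> =
      on_path (Z (current i \<omega>)) k (\<tau> i) u \<omega> + on_path (Z (current i \<omega>)) k u v \<omega>"
    by (rule additive_mp_on_path[OF additive[OF current_in[OF i \<omega>]] k \<omega> r0 b(1) le(1,2) b(2)])
  ultimately show ?thesis
    using *[of u] *[of v] le by simp
qed

lemma step_law_centered:
  assumes k: "k \<in> I" and i: "i < N" and le: "\<tau> i \<le> s" "s \<le> u" "u \<le> v" "v \<le> \<tau> (Suc i)" "s < T"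
    and \<omega>: "\<omega> \<in> \<Omega>" and A: "A \<in> sets (\<F> u)"
  shows "(\<integral>\<omega>'. indicator A (paste r s T \<omega> \<omega>') * W k u v (paste r s T \<omega> \<omega>') \<partial>step_law i s \<omega>) = 0"
proof -
  have rs: "r \<le> s" "v \<le> T"
    using times_ge[of i] times_le[of "Suc i"] i le by auto
  have "(\<integral>\<omega>'. indicator A (paste r s T \<omega> \<omega>') * W k u v (paste r s T \<omega> \<omega>') \<partial>step_law i s \<omega>) =
      (\<integral>\<omega>'. indicator A (paste r s T \<omega> \<omega>') * on_path (Z (current i \<omega>)) k u v (paste r s T \<omega> \<omega>') \<partial>step_law i s \<omega>)"
  proof (rule Bochner_Integration.integral_cong)
    fix \<omega>' assume "\<omega>' \<in> space (step_law i s \<omega>)"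
    then have \<omega>': "\<omega>' \<in> path_space \<kappa> s T"
      using step_law_prob(3)[OF i le(1,5) \<omega>] by simp
    then have p: "paste r s T \<omega> \<omega>' \<in> \<Omega>"
      using rs le by (intro paste_in_path_space[OF \<omega>]) auto
    have "W k u v (paste r s T \<omega> \<omega>') = on_path (Z (current i (paste r s T \<omega> \<omega>'))) k u v (paste r s T \<omega> \<omega>')"
      using le by (intro switched_mp_current k i p) auto
    then show "indicator A (paste r s T \<omega> \<omega>') * W k u v (paste r s T \<omega> \<omega>') =
        indicator A (paste r s T \<omega> \<omega>') * on_path (Z (current i \<omega>)) k u v (paste r s T \<omega> \<omega>')"
      using active_paste[OF i le(1) less_imp_le[OF le(5)] \<omega> \<omega>'] by simp
  qed simp
  also have "\<dots> = 0"
    unfolding step_law_def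
    by (rule law_paste_centered[OF current_in[OF i \<omega>] k r0 rs(1) le(5) \<omega> le(2,3) rs(2) A])
  finally show ?thesis .
qed

lemma switched_solution_iff:
  "mp_solution \<kappa> r T I (\<lambda>k. W k r) y Q \<longleftrightarrow>
    prob_space Q \<and> sets Q = sets (\<F> T) \<and> (AE \<omega> in Q. \<omega> r = y) \<and> (\<forall>k\<in>I. centered Q \<F> (W k) r T)"
  using rT by (intro mp_solution_iff switched_mp_increments) auto

text \<open>Any measure that starts from \<open>y\<close> will do before the first step, for instance a constant path. At the
  beginning of each step the future is replaced by the law of the active parameter.\<close>

lemma switched_solution_upto:
  assumes "i \<le> N"
  shows "\<exists>Q. prob_space Q \<and> sets Q = sets (\<F> T) \<and> (AE \<omega> in Q. \<omega> r = y) \<and> (\<forall>k\<in>I. centered Q \<F> (W k) r (\<tau> i))"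
  using assms
proof (induction i)
  case 0
  let ?Q = "return (\<F> T) (const_path r T y)"
  have c: "const_path r T y \<in> space (\<F> T)"
    by (simp add: const_path_in_path_space)
  have "AE \<omega> in ?Q. \<omega> r = y"
  proof -
    have [measurable]: "(\<lambda>\<omega>. \<omega> r) \<in> borel_measurable (\<F> T)"
      using rT by (intro path_coordinate_measurable) auto
    show ?thesis
      using c rT by (subst AE_return) (auto simp: const_path_def)
  qed
  moreover have "centered ?Q \<F> (W k) r (\<tau> 0)" if k: "k \<in> I" for k
    unfolding centered_def
  proof (intro allI impI)
    fix u v and A :: "'n path set" assume *: "r \<le> u \<and> u \<le> v \<and> v \<le> \<tau> 0 \<and> A \<in> sets (\<F> u)"
    then have "u = r" "v = r"
      by auto
    then have "W k u v \<omega> = 0" if "\<omega> \<in> \<Omega>" for \<omega>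
      using incrementsD(3)[OF switched_mp_increments[OF k], of r r \<omega> r] that rT by simp
    then have "(\<integral>\<omega>. indicator A \<omega> * W k u v \<omega> \<partial>?Q) = (\<integral>\<omega>. 0 \<partial>?Q)"
      by (intro Bochner_Integration.integral_cong) auto
    then show "(\<integral>\<omega>. indicator A \<omega> * W k u v \<omega> \<partial>?Q) = 0"
      by simp
  qed
  ultimately show ?case
    using prob_space_return[OF c] by (intro exI[of _ ?Q]) auto
next
  case (Suc i)
  then obtain Q where Q: "prob_space Q" "sets Q = sets (\<F> T)" and y: "AE \<omega> in Q. \<omega> r = y"
    and c: "\<And>k. k \<in> I \<Longrightarrow> centered Q \<F> (W k) r (\<tau> i)"
    by auto
  have i: "i < N" "r \<le> \<tau> i" "\<tau> i \<le> T" "\<tau> i < T"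
    using Suc times_ge[of i] times_lessT[of i] by auto
  note K = step_law_kernel[OF i(1) order_refl i(4)]
  have "centered (glue \<kappa> r (\<tau> i) T Q (step_law i (\<tau> i))) \<F> (W k) r (\<tau> (Suc i))" if k: "k \<in> I" for k
    using times_less[OF i(1)] times_le[of "Suc i"] Suc i
    by (intro centered_glue[OF i(2) _ _ Q K switched_mp_increments[OF k] c[OF k]] step_law_centered[OF k i(1)]) auto
  then show ?case
    using prob_space_glue[OF i(2,3) Q K] sets_glue[OF i(2,3) Q K] AE_glue_initial[OF i(2,3) Q K y] by blast
qed

lemma switched_solution_exists: "\<exists>Q. mp_solution \<kappa> r T I (\<lambda>k. W k r) y Q"
  unfolding switched_solution_iff using switched_solution_upto[of N y] by simp

end

section \<open>Path spaces are measurable retracts of the real line\<close>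

text \<open>For each threshold, the lengths of the chains along which \<open>f\<close> makes large moves are bounded. For a
  countable \<open>D\<close> this involves countably many values and quantifiers, and for a dense set \<open>D\<close> of times in a
  compact interval it amounts to the existence of one-sided limits along \<open>D\<close> at every time.\<close>

definition regular_on :: "real set \<Rightarrow> (real \<Rightarrow> 'b::metric_space) \<Rightarrow> bool" where
  "regular_on D f \<longleftrightarrow> (\<forall>n. \<exists>m. \<forall>xs\<in>lists D. sorted_wrt (<) xs \<longrightarrow>
     successively (\<lambda>p q. inverse (real (Suc n)) < dist (f p) (f q)) xs \<longrightarrow> length xs \<le> m)"

definition equicont_on :: "real set \<Rightarrow> (real \<Rightarrow> 'b::metric_space) \<Rightarrow> bool" where
  "equicont_on D f \<longleftrightarrow> (\<forall>n. \<exists>m. \<forall>p\<in>D. \<forall>q\<in>D.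
     dist p q < inverse (real (Suc m)) \<longrightarrow> dist (f p) (f q) \<le> inverse (real (Suc n)))"

lemma successively_cong_set:
  "(\<And>x. x \<in> set xs \<Longrightarrow> f x = g x) \<Longrightarrow>
    successively (\<lambda>p q. e < dist (f p) (f q)) xs = successively (\<lambda>p q. e < dist (g p) (g q)) xs"
  by (induction xs rule: induct_list012) auto

lemma regular_on_cong:
  assumes "\<And>x. x \<in> D \<Longrightarrow> f x = g x"
  shows "regular_on D f = regular_on D g"
proof -
  have "successively (\<lambda>p q. e < dist (f p) (f q)) xs = successively (\<lambda>p q. e < dist (g p) (g q)) xs"
    if "xs \<in> lists D" for xs e
    using assms that by (intro successively_cong_set) auto
  then show ?thesis
    unfolding regular_on_def by (simp cong: ball_cong)
qed

lemma cadlag_on_oscillation: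
  assumes "cadlag_on r t \<omega>" "u \<in> {r..t}" "0 < e"
  obtains d where "0 < d"
    "\<And>p q. p \<in> {r..t} \<Longrightarrow> q \<in> {r..t} \<Longrightarrow> u < p \<Longrightarrow> u < q \<Longrightarrow> p < u + d \<Longrightarrow> q < u + d \<Longrightarrow> dist (\<omega> p) (\<omega> q) < e"
    "\<And>p q. p \<in> {r..t} \<Longrightarrow> q \<in> {r..t} \<Longrightarrow> p < u \<Longrightarrow> q < u \<Longrightarrow> u - d < p \<Longrightarrow> u - d < q \<Longrightarrow> dist (\<omega> p) (\<omega> q) < e"
proof -
  obtain l where lims: "(\<omega> \<longlongrightarrow> \<omega> u) (at u within {u<..t})" "(\<omega> \<longlongrightarrow> l) (at u within {r..<u})"
    using assms(1,2) unfolding cadlag_on_def by blast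
  have e2: "0 < e/2"
    using assms(3) by simp
  from tendstoD[OF lims(1) e2] obtain d1 where
    d1: "0 < d1" "\<And>v. v \<in> {u<..t} \<Longrightarrow> dist v u < d1 \<Longrightarrow> dist (\<omega> v) (\<omega> u) < e/2"
    unfolding eventually_at by auto
  from tendstoD[OF lims(2) e2] obtain d2 where
    d2: "0 < d2" "\<And>v. v \<in> {r..<u} \<Longrightarrow> dist v u < d2 \<Longrightarrow> dist (\<omega> v) l < e/2"
    unfolding eventually_at by auto
  show ?thesis
  proof (rule that[of "min d1 d2"])
    show "0 < min d1 d2"
      using d1 d2 by simp
    show "dist (\<omega> p) (\<omega> q) < e" if "p \<in> {r..t}" "q \<in> {r..t}" "u < p" "u < q" "p < u + min d1 d2" "q < u + min d1 d2" for p q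
      using d1(2)[of p] d1(2)[of q] that dist_triangle_half_l[of "\<omega> p" "\<omega> u" e "\<omega> q"] by (auto simp: dist_real_def dist_commute)
    show "dist (\<omega> p) (\<omega> q) < e" if "p \<in> {r..t}" "q \<in> {r..t}" "p < u" "q < u" "u - min d1 d2 < p" "u - min d1 d2 < q" for p q
      using d2(2)[of p] d2(2)[of q] that dist_triangle_half_l[of "\<omega> p" l e "\<omega> q"] by (auto simp: dist_real_def dist_commute)
  qed
qed

text \<open>By compactness, finitely many neighbourhoods cover the interval, such that the path moves less than the
  threshold to the left and to the right of each centre. The left part, the centre and the right part are
  order convex, so each of them contains at most one element of a chain.\<close>

lemma regular_on_cadlag:
  assumes \<omega>: "cadlag_on r t \<omega>" and D: "D \<subseteq> {r..t}"
  shows "regular_on D \<omega>"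
  unfolding regular_on_def
proof
  fix n
  define e where "e = inverse (real (Suc n))"
  have e: "0 < e"
    by (simp add: e_def)
  define G where "G u d \<longleftrightarrow> 0 < d \<and>
      (\<forall>p\<in>{r..t}. \<forall>q\<in>{r..t}. u < p \<and> u < q \<and> p < u + d \<and> q < u + d \<longrightarrow> dist (\<omega> p) (\<omega> q) < e) \<and>
      (\<forall>p\<in>{r..t}. \<forall>q\<in>{r..t}. p < u \<and> q < u \<and> u - d < p \<and> u - d < q \<longrightarrow> dist (\<omega> p) (\<omega> q) < e)" for u d
  have "\<forall>u\<in>{r..t}. \<exists>d. G u d"
  proof
    fix u assume "u \<in> {r..t}"
    then show "\<exists>d. G u d"
      unfolding G_def by (rule cadlag_on_oscillation[OF \<omega> _ e]) blast
  qed
  from bchoice[OF this] obtain d where G: "\<And>u. u \<in> {r..t} \<Longrightarrow> G u (d u)"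
    by blast
  have d: "0 < d u" if "u \<in> {r..t}" for u
    using G[OF that] by (simp add: G_def)
  have right: "dist (\<omega> p) (\<omega> q) < e" if "u \<in> {r..t}" "p \<in> {r..t}" "q \<in> {r..t}" "u < p" "u < q" "p < u + d u" "q < u + d u" for u p q
    using G[OF that(1)] that unfolding G_def by blast
  have left: "dist (\<omega> p) (\<omega> q) < e" if "u \<in> {r..t}" "p \<in> {r..t}" "q \<in> {r..t}" "p < u" "q < u" "u - d u < p" "u - d u < q" for u p q
    using G[OF that(1)] that unfolding G_def by blast
  have "{r..t} \<subseteq> (\<Union>u\<in>{r..t}. ball u (d u))"
    using d by auto
  then obtain C where C: "C \<subseteq> {r..t}" "finite C" "{r..t} \<subseteq> (\<Union>u\<in>C. ball u (d u))"
    using compactE_image[OF compact_Icc, of "{r..t}" "\<lambda>u. ball u (d u)" r t] by (metis open_ball)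
  have "\<forall>x\<in>{r..t}. \<exists>c. c \<in> C \<and> dist c x < d c"
  proof
    fix x assume "x \<in> {r..t}"
    then have "x \<in> (\<Union>u\<in>C. ball u (d u))"
      using C(3) by (rule rev_subsetD)
    then show "\<exists>c. c \<in> C \<and> dist c x < d c"
      by auto
  qed
  from bchoice[OF this] obtain c where c: "\<And>x. x \<in> {r..t} \<Longrightarrow> c x \<in> C \<and> dist (c x) x < d (c x)"
    by blast
  \<comment> \<open>The sign tells which part of the neighbourhood the point is in.\<close>
  define piece where "piece x = (c x, sgn (x - c x))" for x
  have "length xs \<le> card (C \<times> {-1, 0, 1::real})"
    if xs: "xs \<in> lists D" "sorted_wrt (<) xs" "successively (\<lambda>p q. e < dist (\<omega> p) (\<omega> q)) xs" for xs
  proof -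
    have in_D: "xs ! i \<in> {r..t}" if "i < length xs" for i
      using xs(1) that D by (auto simp: subset_eq)
    have "piece (xs ! i) \<noteq> piece (xs ! j)" if ij: "i < j" "j < length xs" for i j
    proof
      assume eq: "piece (xs ! i) = piece (xs ! j)"
      let ?x = "xs ! i" and ?y = "xs ! j" and ?z = "xs ! Suc i"
      \<comment> \<open>The successor of \<open>?x\<close> in the chain lies between \<open>?x\<close> and \<open>?y\<close>, hence in the same part.\<close>
      have xz: "?x < ?z" "?z \<le> ?y"
        using xs(2) ij by (auto simp: sorted_wrt_iff_nth_less) (metis Suc_lessI less_eq_real_def)
      have far: "e < dist (\<omega> ?x) (\<omega> ?z)"
        using xs(3) ij by (auto simp: successively_conv_nth)
      have cs: "c ?y = c ?x" "sgn (?y - c ?x) = sgn (?x - c ?x)"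
        using eq by (auto simp: piece_def)
      have mem: "c ?x \<in> {r..t}" "?x \<in> {r..t}" "?z \<in> {r..t}"
        using c[OF in_D[of i]] C(1) in_D[of i] in_D[of "Suc i"] ij by auto
      have near: "dist (c ?x) ?x < d (c ?x)" "dist (c ?x) ?y < d (c ?x)"
        using c[OF in_D[of i]] c[OF in_D[of j]] ij cs by auto
      consider "?x < c ?x" "?y < c ?x" | "?x > c ?x" "?y > c ?x" | "?x = c ?x" "?y = c ?x"
        using cs(2) by (auto simp: sgn_real_def split: if_splits)
      then show False
      proof cases
        case 1
        then have "dist (\<omega> ?x) (\<omega> ?z) < e"
          using near xz by (intro left[OF mem]) (auto simp: dist_real_def)
        with far show False by simp
      next
        case 2
        then have "dist (\<omega> ?x) (\<omega> ?z) < e"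
          using near xz by (intro right[OF mem]) (auto simp: dist_real_def)
        with far show False by simp
      qed (use xz in auto)
    qed
    then have "inj_on (\<lambda>i. piece (xs ! i)) {..<length xs}"
      by (intro inj_onI) (metis lessThan_iff linorder_neqE_nat)
    moreover have "(\<lambda>i. piece (xs ! i)) ` {..<length xs} \<subseteq> C \<times> {-1, 0, 1}"
    proof -
      have "sgn y \<in> {-1, 0, 1}" for y :: real
        by (simp add: sgn_real_def)
      then show ?thesis
        using c in_D unfolding piece_def by blast
    qed
    ultimately have "card {..<length xs} \<le> card (C \<times> {-1, 0, 1::real})"
      using C(2) by (intro card_inj_on_le) auto
    then show ?thesis
      by simp
  qed
  then show "\<exists>m. \<forall>xs\<in>lists D. sorted_wrt (<) xs \<longrightarrow>
      successively (\<lambda>p q. inverse (real (Suc n)) < dist (\<omega> p) (\<omega> q)) xs \<longrightarrow> length xs \<le> m"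
    unfolding e_def by blast
qed

text \<open>The sets \<open>S d\<close> are the points of \<open>D\<close> within distance \<open>d\<close> on one side of some time. If \<open>f\<close> were not
  Cauchy there, then beyond any point there would be two points whose values are far apart, so one of them
  is far from the value at the given point: a chain could be continued forever.\<close>

lemma regular_on_Cauchy:
  fixes f :: "real \<Rightarrow> 'b::metric_space" and S :: "real \<Rightarrow> real set"
  assumes reg: "regular_on D f" and e: "0 < e"
    and S: "\<And>d. 0 < d \<Longrightarrow> S d \<subseteq> D" "\<And>d. 0 < d \<Longrightarrow> S d \<noteq> {}"
    and side: "(\<forall>d x. 0 < d \<longrightarrow> x \<in> S d \<longrightarrow> (\<exists>d'>0. \<forall>y\<in>S d'. y < x)) \<or>
      (\<forall>d x. 0 < d \<longrightarrow> x \<in> S d \<longrightarrow> (\<exists>d'>0. \<forall>y\<in>S d'. x < y))"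
  shows "\<exists>d>0. \<forall>p\<in>S d. \<forall>q\<in>S d. dist (f p) (f q) \<le> e"
proof (rule ccontr)
  assume neg: "\<not> ?thesis"
  obtain n where n: "inverse (real (Suc n)) < e/2"
    using reals_Archimedean[of "e/2"] e by auto
  define c where "c = inverse (real (Suc n))"
  obtain m where m: "\<And>xs. xs \<in> lists D \<Longrightarrow> sorted_wrt (<) xs \<Longrightarrow>
      successively (\<lambda>p q. c < dist (f p) (f q)) xs \<Longrightarrow> length xs \<le> m"
    using reg unfolding regular_on_def c_def by blast
  have far: "\<exists>y\<in>S d. c < dist (f y) (f x)" if "0 < d" for d x
  proof -
    obtain p q where pq: "p \<in> S d" "q \<in> S d" "e < dist (f p) (f q)"
    proof -
      have "\<not> (\<forall>p\<in>S d. \<forall>q\<in>S d. dist (f p) (f q) \<le> e)"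
        using neg \<open>0 < d\<close> by blast
      then show ?thesis
        using that by (auto simp: not_le)
    qed
    have "c < dist (f p) (f x) \<or> c < dist (f q) (f x)"
      using pq(3) n dist_triangle[of "f p" "f q" "f x"] dist_commute[of "f x" "f q"] unfolding c_def[symmetric] by linarith
    then show ?thesis
      using pq(1,2) by blast
  qed
  from side show False
  proof
    assume below: "\<forall>d x. 0 < d \<longrightarrow> x \<in> S d \<longrightarrow> (\<exists>d'>0. \<forall>y\<in>S d'. y < x)"
    have "\<exists>x xs d. 0 < d \<and> x \<in> S d \<and> x # xs \<in> lists D \<and> sorted_wrt (<) (x # xs) \<and>
        successively (\<lambda>p q. c < dist (f p) (f q)) (x # xs) \<and> length xs = k" for k
    proof (induction k)
      case 0
      obtain x where "x \<in> S 1"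
        using S(2)[of 1] by auto
      then show ?case
        using S(1)[of 1] by (intro exI[of _ x] exI[of _ "[]"] exI[of _ 1]) auto
    next
      case (Suc k)
      then obtain x xs d where *: "0 < d" "x \<in> S d" "x # xs \<in> lists D" "sorted_wrt (<) (x # xs)"
        "successively (\<lambda>p q. c < dist (f p) (f q)) (x # xs)" "length xs = k"
        by blast
      obtain d' where d': "0 < d'" "\<forall>y\<in>S d'. y < x"
        using below *(1,2) by blast
      obtain y where y: "y \<in> S d'" "c < dist (f y) (f x)"
        using far[OF d'(1)] by blast
      have "y \<in> D" "\<forall>z\<in>set (x # xs). y < z"
        using y(1) d' S(1) *(4) by force+
      then show ?case
        using * d' y by (intro exI[of _ y] exI[of _ "x # xs"] exI[of _ d']) auto
    qed
    from this[of m] obtain x xs where "x # xs \<in> lists D" "sorted_wrt (<) (x # xs)"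
      "successively (\<lambda>p q. c < dist (f p) (f q)) (x # xs)" and l: "length xs = m"
      by blast
    then have "length (x # xs) \<le> m"
      by (intro m)
    with l show False
      by simp
  next
    assume above: "\<forall>d x. 0 < d \<longrightarrow> x \<in> S d \<longrightarrow> (\<exists>d'>0. \<forall>y\<in>S d'. x < y)"
    have "\<exists>x xs d. 0 < d \<and> x \<in> S d \<and> xs @ [x] \<in> lists D \<and> sorted_wrt (<) (xs @ [x]) \<and>
        successively (\<lambda>p q. c < dist (f p) (f q)) (xs @ [x]) \<and> length xs = k" for k
    proof (induction k)
      case 0
      obtain x where "x \<in> S 1"
        using S(2)[of 1] by auto
      then show ?case
        using S(1)[of 1] by (intro exI[of _ x] exI[of _ "[]"] exI[of _ 1]) auto
    next
      case (Suc k)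
      then obtain x xs d where *: "0 < d" "x \<in> S d" "xs @ [x] \<in> lists D" "sorted_wrt (<) (xs @ [x])"
        "successively (\<lambda>p q. c < dist (f p) (f q)) (xs @ [x])" "length xs = k"
        by blast
      obtain d' where d': "0 < d'" "\<forall>y\<in>S d'. x < y"
        using above *(1,2) by blast
      obtain y where y: "y \<in> S d'" "c < dist (f y) (f x)"
        using far[OF d'(1)] by blast
      have "y \<in> D" "\<forall>z\<in>set (xs @ [x]). z < y"
        using y(1) d' S(1) *(4) by (force simp: sorted_wrt_append)+
      then show ?case
        using * d' y
        by (intro exI[of _ y] exI[of _ "xs @ [x]"] exI[of _ d'])
           (auto simp: sorted_wrt_append successively_append_iff dist_commute)
    qed
    from this[of m] obtain x xs where "xs @ [x] \<in> lists D" "sorted_wrt (<) (xs @ [x])"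
      "successively (\<lambda>p q. c < dist (f p) (f q)) (xs @ [x])" and l: "length xs = m"
      by blast
    then have "length (xs @ [x]) \<le> m"
      by (intro m)
    with l show False
      by simp
  qed
qed

lemma Cauchy_selection:
  fixes f :: "'a \<Rightarrow> 'b::complete_space"
  assumes "\<And>e. 0 < e \<Longrightarrow> \<exists>S. (\<forall>p\<in>S. \<forall>q\<in>S. dist (f p) (f q) \<le> e) \<and> (\<forall>\<^sub>F n in sequentially. x n \<in> S)"
  shows "convergent (\<lambda>n. f (x n))"
proof -
  have "Cauchy (\<lambda>n. f (x n))"
  proof (rule metric_CauchyI)
    fix e :: real assume "0 < e"
    then obtain S where S: "\<And>p q. p \<in> S \<Longrightarrow> q \<in> S \<Longrightarrow> dist (f p) (f q) \<le> e/2"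
      "\<forall>\<^sub>F n in sequentially. x n \<in> S"
      using assms[of "e/2"] by auto
    then obtain M where M: "\<And>n. M \<le> n \<Longrightarrow> x n \<in> S"
      unfolding eventually_sequentially by blast
    then show "\<exists>M. \<forall>m\<ge>M. \<forall>n\<ge>M. dist (f (x m)) (f (x n)) < e"
    proof (intro exI[of _ M] allI impI)
      fix m n assume "M \<le> m" "M \<le> n"
      then have "dist (f (x m)) (f (x n)) \<le> e/2"
        by (intro S(1) M)
      with \<open>0 < e\<close> show "dist (f (x m)) (f (x n)) < e"
        by linarith
    qed
  qed
  then show ?thesis
    by (rule Cauchy_convergent)
qed

text \<open>At the end point the sequence is constant: the value there need not be a limit of values at other times.\<close>

definition right_approx :: "real \<Rightarrow> real \<Rightarrow> real \<Rightarrow> nat \<Rightarrow> real" where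
  "right_approx r t u n = (if u = t then t
     else SOME q. q \<in> dense_times r t \<and> u < q \<and> q < min t (u + inverse (real (Suc n))))"

lemma right_approx:
  assumes "r \<le> u" "u < t"
  shows "right_approx r t u n \<in> dense_times r t" "u < right_approx r t u n"
    "right_approx r t u n < t" "right_approx r t u n < u + inverse (real (Suc n))"
proof -
  have "u < min t (u + inverse (real (Suc n)))" "min t (u + inverse (real (Suc n))) \<le> t"
    using assms by auto
  then obtain q where "q \<in> dense_times r t" "u < q" "q < min t (u + inverse (real (Suc n)))"
    using dense_times_between[OF assms(1)] by blast
  then have "\<exists>q. q \<in> dense_times r t \<and> u < q \<and> q < min t (u + inverse (real (Suc n)))"
    by blast
  from someI_ex[OF this] have "right_approx r t u n \<in> dense_times r t \<and> u < right_approx r t u n \<and>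
      right_approx r t u n < min t (u + inverse (real (Suc n)))"
    using assms by (simp add: right_approx_def)
  then show "right_approx r t u n \<in> dense_times r t" "u < right_approx r t u n"
    "right_approx r t u n < t" "right_approx r t u n < u + inverse (real (Suc n))"
    by auto
qed

lemma right_approx_end[simp]: "right_approx r t t n = t"
  by (simp add: right_approx_def)

lemma right_approx_dense: "r \<le> u \<Longrightarrow> u \<le> t \<Longrightarrow> right_approx r t u n \<in> dense_times r t"
  using right_approx(1)[of r u t n] by (cases "u = t") (auto simp: dense_times_def)

lemma right_approx_lim:
  assumes "r \<le> u" "u \<le> t"
  shows "right_approx r t u \<longlonglongrightarrow> u"
proof (cases "u = t")
  case False
  then have ut: "u < t"
    using assms by simp
  show ?thesis
  proof (rule real_tendsto_sandwich)
    show "\<forall>\<^sub>F n in sequentially. u \<le> right_approx r t u n"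
      "\<forall>\<^sub>F n in sequentially. right_approx r t u n \<le> u + inverse (real (Suc n))"
      using right_approx[OF assms(1) ut] by (auto intro!: always_eventually less_imp_le simp del: of_nat_Suc)
    show "(\<lambda>n. u + inverse (real (Suc n))) \<longlonglongrightarrow> u"
      using tendsto_add[OF tendsto_const LIMSEQ_inverse_real_of_nat, of u] by simp
  qed simp
next
  case True
  then have "right_approx r t u = (\<lambda>_. u)"
    by (simp add: fun_eq_iff)
  then show ?thesis
    by simp
qed

definition right_extension :: "real \<Rightarrow> real \<Rightarrow> (real \<Rightarrow> 'b::t2_space) \<Rightarrow> real \<Rightarrow> 'b" where
  "right_extension r t f u = lim (\<lambda>n. f (right_approx r t u n))"

lemma regular_right_Cauchy:
  assumes "regular_on (dense_times r t) f" "r \<le> u" "u < t" "0 < e"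
  obtains d where "0 < d" "d \<le> t - u"
    "\<And>p q. p \<in> dense_times r t \<Longrightarrow> q \<in> dense_times r t \<Longrightarrow> u < p \<Longrightarrow> u < q \<Longrightarrow> p < u + d \<Longrightarrow> q < u + d \<Longrightarrow> dist (f p) (f q) \<le> e"
proof -
  let ?S = "\<lambda>d. {q \<in> dense_times r t. u < q \<and> q < u + min d (t - u)}"
  have "\<exists>d>0. \<forall>p\<in>?S d. \<forall>q\<in>?S d. dist (f p) (f q) \<le> e"
  proof (rule regular_on_Cauchy[OF assms(1,4)])
    show "?S d \<noteq> {}" if "0 < d" for d
    proof -
      have "u < u + min d (t - u)" "u + min d (t - u) \<le> t"
        using assms that by auto
      then show ?thesis
        using dense_times_between[OF assms(2), of "u + min d (t - u)" t] by blast
    qed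
    have "\<exists>d'>0. \<forall>y\<in>?S d'. y < x" if "0 < d" "x \<in> ?S d" for d x
      using that by (intro exI[of _ "x - u"]) auto
    then show "(\<forall>d x. 0 < d \<longrightarrow> x \<in> ?S d \<longrightarrow> (\<exists>d'>0. \<forall>y\<in>?S d'. y < x)) \<or>
      (\<forall>d x. 0 < d \<longrightarrow> x \<in> ?S d \<longrightarrow> (\<exists>d'>0. \<forall>y\<in>?S d'. x < y))"
      by blast
  qed auto
  then obtain d where "0 < d" "\<forall>p\<in>?S d. \<forall>q\<in>?S d. dist (f p) (f q) \<le> e"
    by blast
  then show ?thesis
    using assms by (intro that[of "min d (t - u)"]) auto
qed

lemma regular_left_Cauchy:
  assumes "regular_on (dense_times r t) f" "r < u" "u \<le> t" "0 < e"
  obtains d where "0 < d" "d \<le> u - r"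
    "\<And>p q. p \<in> dense_times r t \<Longrightarrow> q \<in> dense_times r t \<Longrightarrow> p < u \<Longrightarrow> q < u \<Longrightarrow> u - d < p \<Longrightarrow> u - d < q \<Longrightarrow> dist (f p) (f q) \<le> e"
proof -
  let ?S = "\<lambda>d. {q \<in> dense_times r t. q < u \<and> u - min d (u - r) < q}"
  have "\<exists>d>0. \<forall>p\<in>?S d. \<forall>q\<in>?S d. dist (f p) (f q) \<le> e"
  proof (rule regular_on_Cauchy[OF assms(1,4)])
    show "?S d \<noteq> {}" if "0 < d" for d
    proof -
      have "u - min d (u - r) < u" "r \<le> u - min d (u - r)"
        using assms that by auto
      then show ?thesis
        using dense_times_between[of r "u - min d (u - r)" u t] assms(3) by blast
    qed
    have "\<exists>d'>0. \<forall>y\<in>?S d'. x < y" if "0 < d" "x \<in> ?S d" for d x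
      using that by (intro exI[of _ "u - x"]) auto
    then show "(\<forall>d x. 0 < d \<longrightarrow> x \<in> ?S d \<longrightarrow> (\<exists>d'>0. \<forall>y\<in>?S d'. y < x)) \<or>
      (\<forall>d x. 0 < d \<longrightarrow> x \<in> ?S d \<longrightarrow> (\<exists>d'>0. \<forall>y\<in>?S d'. x < y))"
      by blast
  qed auto
  then obtain d where "0 < d" "\<forall>p\<in>?S d. \<forall>q\<in>?S d. dist (f p) (f q) \<le> e"
    by blast
  then show ?thesis
    using assms by (intro that[of "min d (u - r)"]) auto
qed

lemma right_extension_lim:
  fixes f :: "real \<Rightarrow> 'b::complete_space"
  assumes reg: "regular_on (dense_times r t) f" and u: "r \<le> u" "u \<le> t"
  shows "(\<lambda>n. f (right_approx r t u n)) \<longlonglongrightarrow> right_extension r t f u"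
proof -
  have "convergent (\<lambda>n. f (right_approx r t u n))"
  proof (cases "u = t")
    case True
    then show ?thesis by (simp add: convergent_const)
  next
    case False
    then have ut: "u < t" using u by simp
    show ?thesis
    proof (rule Cauchy_selection[where f = f and x = "right_approx r t u"])
      fix e :: real assume "0 < e"
      from regular_right_Cauchy[OF reg u(1) ut this] obtain d where d: "0 < d"
        "\<And>p q. p \<in> dense_times r t \<Longrightarrow> q \<in> dense_times r t \<Longrightarrow> u < p \<Longrightarrow> u < q \<Longrightarrow> p < u + d \<Longrightarrow> q < u + d \<Longrightarrow> dist (f p) (f q) \<le> e"
        by metis
      have "\<forall>\<^sub>F n in sequentially. right_approx r t u n < u + d"
        using order_tendstoD(2)[OF right_approx_lim[OF u], of "u + d"] d(1) by simp
      then have "\<forall>\<^sub>F n in sequentially. right_approx r t u n \<in> {q \<in> dense_times r t. u < q \<and> q < u + d}"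
        by eventually_elim (use right_approx[OF u(1) ut] in auto)
      then show "\<exists>S. (\<forall>p\<in>S. \<forall>q\<in>S. dist (f p) (f q) \<le> e) \<and> (\<forall>\<^sub>F n in sequentially. right_approx r t u n \<in> S)"
        using d(2) by (intro exI[of _ "{q \<in> dense_times r t. u < q \<and> q < u + d}"]) auto
    qed
  qed
  then show ?thesis
    unfolding right_extension_def by (simp add: convergent_LIMSEQ_iff)
qed

lemma right_extension_near:
  fixes f :: "real \<Rightarrow> 'b::complete_space"
  assumes reg: "regular_on (dense_times r t) f" and u: "r \<le> u" "u < t" "u < b"
    and near: "\<And>q. q \<in> dense_times r t \<Longrightarrow> u < q \<Longrightarrow> q < b \<Longrightarrow> dist (f q) c \<le> e"
  shows "dist (right_extension r t f u) c \<le> e"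
proof (rule tendsto_upperbound)
  show "(\<lambda>n. dist (f (right_approx r t u n)) c) \<longlonglongrightarrow> dist (right_extension r t f u) c"
    using right_extension_lim[OF reg u(1)] u by (intro tendsto_intros) auto
  have "\<forall>\<^sub>F n in sequentially. right_approx r t u n < b"
    using order_tendstoD(2)[OF right_approx_lim, of r u t b] u by simp
  then show "\<forall>\<^sub>F n in sequentially. dist (f (right_approx r t u n)) c \<le> e"
    by eventually_elim (use right_approx[OF u(1,2)] near in auto)
qed simp

text \<open>The extension inherits the one-sided oscillation bounds of \<open>f\<close>, since its values are limits of
  values of \<open>f\<close> at arbitrarily close later times.\<close>

lemma right_extension_cadlag:
  fixes f :: "real \<Rightarrow> real ^ 'n::finite"
  assumes reg: "regular_on (dense_times r t) f"
  shows "cadlag_on r t (right_extension r t f)"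
  unfolding cadlag_on_def
proof (intro ballI conjI)
  let ?F = "right_extension r t f"
  fix u assume u: "u \<in> {r..t}"
  show "(?F \<longlongrightarrow> ?F u) (at u within {u<..t})"
  proof (rule tendstoI)
    fix e :: real assume e: "0 < e"
    show "\<forall>\<^sub>F v in at u within {u<..t}. dist (?F v) (?F u) < e"
    proof (cases "u = t")
      case False
      then have ut: "r \<le> u" "u < t" using u by auto
      have e2: "0 < e/2" using e by simp
      from regular_right_Cauchy[OF reg ut e2] obtain d where d: "0 < d" "d \<le> t - u"
        "\<And>p q. p \<in> dense_times r t \<Longrightarrow> q \<in> dense_times r t \<Longrightarrow> u < p \<Longrightarrow> u < q \<Longrightarrow> p < u + d \<Longrightarrow> q < u + d \<Longrightarrow> dist (f p) (f q) \<le> e/2"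
        by metis
      have Fu: "dist (f q) (?F u) \<le> e/2" if "q \<in> dense_times r t" "u < q" "q < u + d" for q
        using right_extension_near[OF reg ut, of "u + d" "f q" "e/2"] d that by (simp add: dist_commute)
      have "dist (?F v) (?F u) \<le> e/2" if "u < v" "v < u + d" for v
        using that ut d Fu by (intro right_extension_near[OF reg, of v "u + d"]) auto
      note near = this
      have "dist (?F v) (?F u) < e" if "v \<in> {u<..t}" "dist v u < d" for v
      proof -
        have "dist (?F v) (?F u) \<le> e/2"
          using that by (intro near) (auto simp: dist_real_def)
        with e show ?thesis by linarith
      qed
      then show ?thesis
        using d(1) unfolding eventually_at by blast
    qed (simp add: eventually_at_filter)
  qed
  show "\<exists>l. (?F \<longlongrightarrow> l) (at u within {r..<u})"
  proof (cases "u = r")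
    case False
    then have ru: "r < u" "u \<le> t" using u by auto
    have "\<exists>q. q \<in> dense_times r t \<and> u - inverse (real (Suc n)) < q \<and> q < u" for n
    proof -
      have "max r (u - inverse (real (Suc n))) < u"
        using ru by simp
      then obtain q where "q \<in> dense_times r t" "max r (u - inverse (real (Suc n))) < q" "q < u"
        using dense_times_between[of r "max r (u - inverse (real (Suc n)))" u t] ru by auto
      then show ?thesis by auto
    qed
    then obtain x where x: "\<And>n. x n \<in> dense_times r t" "\<And>n. u - inverse (real (Suc n)) < x n" "\<And>n. x n < u"
      by metis
    have xu: "x \<longlonglongrightarrow> u"
    proof (rule real_tendsto_sandwich)
      show "\<forall>\<^sub>F n in sequentially. u - inverse (real (Suc n)) \<le> x n" "\<forall>\<^sub>F n in sequentially. x n \<le> u"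
        using x by (auto intro!: always_eventually less_imp_le simp del: of_nat_Suc)
      show "(\<lambda>n. u - inverse (real (Suc n))) \<longlonglongrightarrow> u"
        using tendsto_diff[OF tendsto_const LIMSEQ_inverse_real_of_nat, of u] by simp
    qed simp
    have C: "\<exists>d>0. d \<le> u - r \<and> (\<forall>p\<in>dense_times r t. \<forall>q\<in>dense_times r t. p < u \<longrightarrow> q < u \<longrightarrow> u - d < p \<longrightarrow> u - d < q \<longrightarrow> dist (f p) (f q) \<le> e)"
      if "0 < e" for e
      by (rule regular_left_Cauchy[OF reg ru that]) blast
    have ev: "\<forall>\<^sub>F n in sequentially. u - d < x n" if "0 < d" for d
      using order_tendstoD(1)[OF xu, of "u - d"] that by simp
    have "convergent (\<lambda>n. f (x n))"
    proof (rule Cauchy_selection[where f = f and x = x])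
      fix e :: real assume "0 < e"
      then obtain d where d: "0 < d" "\<And>p q. p \<in> dense_times r t \<Longrightarrow> q \<in> dense_times r t \<Longrightarrow> p < u \<Longrightarrow> q < u \<Longrightarrow> u - d < p \<Longrightarrow> u - d < q \<Longrightarrow> dist (f p) (f q) \<le> e"
        using C by metis
      have "\<forall>\<^sub>F n in sequentially. x n \<in> {q \<in> dense_times r t. q < u \<and> u - d < q}"
        using ev[OF d(1)] by eventually_elim (use x in auto)
      then show "\<exists>S. (\<forall>p\<in>S. \<forall>q\<in>S. dist (f p) (f q) \<le> e) \<and> (\<forall>\<^sub>F n in sequentially. x n \<in> S)"
        using d(2) by (intro exI[of _ "{q \<in> dense_times r t. q < u \<and> u - d < q}"]) auto
    qed
    then obtain l where l: "(\<lambda>n. f (x n)) \<longlonglongrightarrow> l"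
      by (auto simp: convergent_def)
    have "(?F \<longlongrightarrow> l) (at u within {r..<u})"
    proof (rule tendstoI)
      fix e :: real assume e: "0 < e"
      then obtain d where d: "0 < d" "d \<le> u - r" "\<And>p q. p \<in> dense_times r t \<Longrightarrow> q \<in> dense_times r t \<Longrightarrow> p < u \<Longrightarrow> q < u \<Longrightarrow> u - d < p \<Longrightarrow> u - d < q \<Longrightarrow> dist (f p) (f q) \<le> e/2"
        using C[of "e/2"] by auto
      have fl: "dist (f q) l \<le> e/2" if q: "q \<in> dense_times r t" "q < u" "u - d < q" for q
      proof (rule tendsto_upperbound)
        show "(\<lambda>n. dist (f q) (f (x n))) \<longlonglongrightarrow> dist (f q) l"
          by (intro tendsto_intros l)
        show "\<forall>\<^sub>F n in sequentially. dist (f q) (f (x n)) \<le> e/2"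
          using ev[OF d(1)] by eventually_elim (use d(3) q x in auto)
      qed simp
      have "dist (?F v) l \<le> e/2" if "u - d < v" "v < u" for v
        using that ru d fl by (intro right_extension_near[OF reg, of v u]) auto
      note near = this
      have "dist (?F v) l < e" if "v \<in> {r..<u}" "dist v u < d" for v
      proof -
        have "dist (?F v) l \<le> e/2"
          using that by (intro near) (auto simp: dist_real_def)
        with e show ?thesis by linarith
      qed
      then show "\<forall>\<^sub>F v in at u within {r..<u}. dist (?F v) l < e"
        using d(1) unfolding eventually_at by blast
    qed
    then show ?thesis ..
  qed simp
qed

lemma right_extension_continuous:
  fixes f :: "real \<Rightarrow> real ^ 'n::finite"
  assumes reg: "regular_on (dense_times r t) f" and eq: "equicont_on (dense_times r t) f"
  shows "continuous_on {r..t} (right_extension r t f)"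
  unfolding continuous_on_iff
proof (intro ballI allI impI)
  let ?F = "right_extension r t f"
  fix u and e :: real assume u: "u \<in> {r..t}" and e: "0 < e"
  obtain n where n: "inverse (real (Suc n)) < e"
    using reals_Archimedean[OF e] by auto
  obtain m where m: "\<And>p q. p \<in> dense_times r t \<Longrightarrow> q \<in> dense_times r t \<Longrightarrow>
      dist p q < inverse (real (Suc m)) \<Longrightarrow> dist (f p) (f q) \<le> inverse (real (Suc n))"
    using eq unfolding equicont_on_def by blast
  have "dist (?F v) (?F u) < e" if v: "v \<in> {r..t}" and vu: "dist v u < inverse (real (Suc m))" for v
  proof -
    have "(\<lambda>n. dist (f (right_approx r t v n)) (f (right_approx r t u n))) \<longlonglongrightarrow> dist (?F v) (?F u)"
      using u v by (intro tendsto_dist right_extension_lim[OF reg]) auto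
    moreover have "\<forall>\<^sub>F n in sequentially. dist (right_approx r t v n) (right_approx r t u n) < inverse (real (Suc m))"
    proof (rule order_tendstoD(2)[OF _ vu])
      show "(\<lambda>n. dist (right_approx r t v n) (right_approx r t u n)) \<longlonglongrightarrow> dist v u"
        using u v by (intro tendsto_dist right_approx_lim) auto
    qed
    then have "\<forall>\<^sub>F k in sequentially. dist (f (right_approx r t v k)) (f (right_approx r t u k)) \<le> inverse (real (Suc n))"
      by eventually_elim (use u v in \<open>auto intro!: m right_approx_dense simp del: of_nat_Suc\<close>)
    ultimately have "dist (?F v) (?F u) \<le> inverse (real (Suc n))"
      by (rule tendsto_upperbound) simp
    with n show ?thesis by simp
  qed
  then show "\<exists>d>0. \<forall>v\<in>{r..t}. dist v u < d \<longrightarrow> dist (?F v) (?F u) < e"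
    by (intro exI[of _ "inverse (real (Suc m))"]) auto
qed

lemma path_space_cadlag:
  assumes "\<omega> \<in> path_space \<kappa> r t"
  shows "cadlag_on r t \<omega>"
proof (cases \<kappa>)
  case Continuous_Paths
  then have c: "(\<omega> \<longlongrightarrow> \<omega> u) (at u within {r..t})" if "u \<in> {r..t}" for u
    using assms that by (auto simp: path_space_def continuous_on_def)
  show ?thesis
    unfolding cadlag_on_def
  proof (intro ballI conjI exI)
    fix u assume u: "u \<in> {r..t}"
    show "(\<omega> \<longlongrightarrow> \<omega> u) (at u within {u<..t})" "(\<omega> \<longlongrightarrow> \<omega> u) (at u within {r..<u})"
      by (rule tendsto_within_subset[OF c[OF u]]; use u in auto)+
  qed
qed (use assms in \<open>simp add: path_space_def\<close>)

definition path_regular :: "path_kind \<Rightarrow> real \<Rightarrow> real \<Rightarrow> 'n::finite path \<Rightarrow> bool" where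
  "path_regular \<kappa> r t f \<longleftrightarrow> regular_on (dense_times r t) f \<and>
     (\<kappa> = Continuous_Paths \<longrightarrow> equicont_on (dense_times r t) f)"

lemma path_regular_extension:
  assumes "path_regular \<kappa> r t f"
  shows "restrict (right_extension r t f) {r..t} \<in> path_space \<kappa> r t"
  using assms unfolding path_space_restrict_iff path_regular_def
  by (auto split: path_kind.split intro!: right_extension_cadlag right_extension_continuous)

lemma path_regular_path:
  assumes \<omega>: "\<omega> \<in> path_space \<kappa> r t" and rt: "r \<le> t" and f: "\<And>q. q \<in> dense_times r t \<Longrightarrow> f q = \<omega> q"
  shows "path_regular \<kappa> r t f"
  unfolding path_regular_def
proof (intro conjI impI)
  note D = dense_times_subset[OF rt]
  show "regular_on (dense_times r t) f"
    using regular_on_cadlag[OF path_space_cadlag[OF \<omega>] D] regular_on_cong[of "dense_times r t" f \<omega>] f by simp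
  assume "\<kappa> = Continuous_Paths"
  then have "uniformly_continuous_on {r..t} \<omega>"
    using \<omega> by (intro compact_uniformly_continuous) (auto simp: path_space_def)
  then have uc: "\<exists>d>0. \<forall>x\<in>{r..t}. \<forall>x'\<in>{r..t}. dist x' x < d \<longrightarrow> dist (\<omega> x') (\<omega> x) < e" if "0 < e" for e
    using that unfolding uniformly_continuous_on_def by blast
  show "equicont_on (dense_times r t) f"
    unfolding equicont_on_def
  proof
    fix n
    obtain d where d: "0 < d" "\<And>x x'. x \<in> {r..t} \<Longrightarrow> x' \<in> {r..t} \<Longrightarrow> dist x' x < d \<Longrightarrow> dist (\<omega> x') (\<omega> x) < inverse (real (Suc n))"
      using uc[of "inverse (real (Suc n))"] by auto
    obtain m where m: "inverse (real (Suc m)) < d"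
      using reals_Archimedean[OF d(1)] by auto
    have "dist (f p) (f q) \<le> inverse (real (Suc n))"
      if "p \<in> dense_times r t" "q \<in> dense_times r t" "dist p q < inverse (real (Suc m))" for p q
    proof -
      have "dist (\<omega> p) (\<omega> q) < inverse (real (Suc n))"
        using that D m by (intro d(2)) auto
      then show ?thesis
        using f that by simp
    qed
    then show "\<exists>m. \<forall>p\<in>dense_times r t. \<forall>q\<in>dense_times r t.
        dist p q < inverse (real (Suc m)) \<longrightarrow> dist (f p) (f q) \<le> inverse (real (Suc n))"
      by blast
  qed
qed

lemma right_extension_path:
  assumes \<omega>: "\<omega> \<in> path_space \<kappa> r t" and f: "\<And>q. q \<in> dense_times r t \<Longrightarrow> f q = \<omega> q"
  shows "restrict (right_extension r t f) {r..t} = \<omega>"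
proof (rule extensionalityI[of _ "{r..t}"])
  show "\<omega> \<in> extensional {r..t}"
    using \<omega> by (simp add: path_space_def)
  fix u assume u: "u \<in> {r..t}"
  have "(\<lambda>n. \<omega> (right_approx r t u n)) \<longlonglongrightarrow> \<omega> u"
  proof (cases "u = t")
    case False
    then have ut: "u < t" "r \<le> u" "u \<le> t" using u by auto
    have "filterlim (right_approx r t u) (at u within {u<..t}) sequentially"
      using right_approx[OF ut(2,1)] right_approx_lim[OF ut(2,3)]
      by (auto simp: filterlim_at less_imp_le less_imp_neq[symmetric] intro!: always_eventually)
    with path_right_continuous[OF \<omega> ut(2,3)] show ?thesis
      by (rule filterlim_compose)
  qed simp
  moreover have "f (right_approx r t u n) = \<omega> (right_approx r t u n)" for n
    using u by (intro f right_approx_dense) auto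
  ultimately show "restrict (right_extension r t f) {r..t} u = \<omega> u"
    using u by (simp add: right_extension_def limI)
qed simp

definition path_index :: "real \<Rightarrow> real \<Rightarrow> nat \<Rightarrow> real \<times> (real ^ 'n::finite)" where
  "path_index r t = from_nat_into (dense_times r t \<times> Basis)"

text \<open>A path is determined by its coordinates at the dense times.\<close>

definition path_code :: "real \<Rightarrow> real \<Rightarrow> 'n::finite path \<Rightarrow> real" where
  "path_code r t \<omega> = seq_code (\<lambda>n. case path_index r t n of (q, b) \<Rightarrow> \<omega> q \<bullet> b)"

definition decoded_value :: "real \<Rightarrow> real \<Rightarrow> real \<Rightarrow> 'n::finite path" where
  "decoded_value r t x q = (\<Sum>b\<in>Basis. seq_decode x (to_nat_on (dense_times r t \<times> (Basis :: (real ^ 'n) set)) (q, b)) *\<^sub>R b)"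

text \<open>Reals whose decoded values do not extend to a path are sent to a constant path, so that every real
  number is decoded to a path.\<close>

definition path_decode :: "path_kind \<Rightarrow> real \<Rightarrow> real \<Rightarrow> real \<Rightarrow> 'n::finite path" where
  "path_decode \<kappa> r t x = (if path_regular \<kappa> r t (decoded_value r t x :: 'n path)
     then restrict (right_extension r t (decoded_value r t x)) {r..t} else const_path r t 0)"

lemma countable_path_index: "countable (dense_times r t \<times> (Basis :: (real ^ 'n::finite) set))"
  by (intro countable_SIGMA countable_dense_times countable_finite) auto

lemma decoded_value_code:
  fixes \<omega> :: "'n::finite path"
  assumes "q \<in> dense_times r t"
  shows "decoded_value r t (path_code r t \<omega>) q = \<omega> q"
proof -
  have "path_index r t (to_nat_on (dense_times r t \<times> Basis) (q, b)) = (q, b)" if "b \<in> Basis" for b :: "real ^ 'n"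
    unfolding path_index_def using countable_path_index assms that by (intro from_nat_into_to_nat_on) auto
  then show ?thesis
    unfolding decoded_value_def path_code_def seq_decode_code by (simp add: euclidean_representation)
qed

lemma path_decode_code:
  assumes "\<omega> \<in> path_space \<kappa> r t" "r \<le> t"
  shows "path_decode \<kappa> r t (path_code r t \<omega>) = \<omega>"
  unfolding path_decode_def
  using path_regular_path[OF assms, of "decoded_value r t (path_code r t \<omega>)"]
    right_extension_path[OF assms(1), of "decoded_value r t (path_code r t \<omega>)"]
  by (simp add: decoded_value_code)

lemma path_code_measurable:
  assumes "r \<le> t"
  shows "(path_code r t :: 'n::finite path \<Rightarrow> real) \<in> borel_measurable (path_sigma \<kappa> r t t)"
  unfolding path_code_def[abs_def]
proof (rule seq_code_measurable)
  fix n
  have ne: "dense_times r t \<times> (Basis :: (real ^ 'n) set) \<noteq> {}"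
    by (auto simp: dense_times_def)
  obtain q and b :: "real ^ 'n" where qb: "path_index r t n = (q, b)" "q \<in> dense_times r t"
    using from_nat_into[OF ne, of n] unfolding path_index_def by (metis mem_Times_iff prod.collapse)
  have [measurable]: "(\<lambda>\<omega>. \<omega> q) \<in> borel_measurable (path_sigma \<kappa> r t t :: 'n path measure)"
    using qb(2) dense_times_subset[OF assms] by (intro path_coordinate_measurable) auto
  show "(\<lambda>\<omega>. case path_index r t n of (q, b) \<Rightarrow> \<omega> q \<bullet> b) \<in> borel_measurable (path_sigma \<kappa> r t t :: 'n path measure)"
    unfolding qb by simp
qed

lemma decoded_value_measurable[measurable]: "(\<lambda>x. decoded_value r t x q) \<in> borel_measurable borel"
  unfolding decoded_value_def by (intro borel_measurable_sum borel_measurable_scaleR seq_decode_measurable) auto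

lemma pred_countable_Ball:
  assumes "countable X" "\<And>i. i \<in> X \<Longrightarrow> Measurable.pred M (\<lambda>x. P x i)"
  shows "Measurable.pred M (\<lambda>x. \<forall>i\<in>X. P x i)"
proof (cases "X = {}")
  case False
  then have "{x \<in> space M. \<forall>i\<in>X. P x i} = (\<Inter>i\<in>X. {x \<in> space M. P x i})"
    by auto
  also have "\<dots> \<in> sets M"
    using assms False by (intro sets.countable_INT') (auto simp: pred_def)
  finally show ?thesis
    by (simp add: pred_def)
qed simp

lemma path_regular_measurable:
  "Measurable.pred borel (\<lambda>x. path_regular \<kappa> r t (decoded_value r t x :: 'n::finite path))"
proof -
  have succ: "Measurable.pred borel (\<lambda>x. successively (\<lambda>p q. e < dist (decoded_value r t x p :: real ^ 'n) (decoded_value r t x q)) xs)" for e xs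
    by (induction xs rule: induct_list012) simp_all
  have c: "countable (lists (dense_times r t))"
    by (intro countable_lists countable_dense_times)
  show ?thesis
    unfolding path_regular_def regular_on_def equicont_on_def
    by (intro pred_intros_logic pred_intros_countable pred_countable_Ball[OF c]
        pred_countable_Ball[OF countable_dense_times] pred_intros_imp' succ) measurable
qed

lemma path_decode_measurable:
  assumes "r \<le> t"
  shows "(path_decode \<kappa> r t :: real \<Rightarrow> 'n::finite path) \<in> borel \<rightarrow>\<^sub>M path_sigma \<kappa> r t t"
proof (rule measurable_path_sigma)
  show "path_decode \<kappa> r t x \<in> path_space \<kappa> r t" for x
    by (simp add: path_decode_def path_regular_extension const_path_in_path_space)
  fix v assume v: "r \<le> v" "v \<le> t"
  have [measurable]: "Measurable.pred borel (\<lambda>x. path_regular \<kappa> r t (decoded_value r t x :: 'n path))"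
    by (rule path_regular_measurable)
  have [measurable]: "(\<lambda>x. right_extension r t (decoded_value r t x :: 'n path) v) \<in> borel_measurable borel"
    unfolding right_extension_def by (intro borel_measurable_lim_metric) measurable
  have "(\<lambda>x. path_decode \<kappa> r t x v) = (\<lambda>x. if path_regular \<kappa> r t (decoded_value r t x :: 'n path)
      then right_extension r t (decoded_value r t x :: 'n path) v else 0)"
    using v unfolding path_decode_def const_path_def by (intro ext) simp
  also have "\<dots> \<in> borel_measurable borel"
    by measurable
  finally show "(\<lambda>x. path_decode \<kappa> r t x v :: real ^ 'n) \<in> borel_measurable borel" .
qed

lemma path_code_bounds: "0 \<le> path_code r t \<omega> \<and> path_code r t \<omega> < 1"
  by (simp add: path_code_def seq_code_bounds)

section \<open>Conditions that determine a law\<close>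

text \<open>The path that is frozen at time \<open>t\<close>. It serves to evaluate functions of longer paths on shorter ones.\<close>

definition stop :: "real \<Rightarrow> real \<Rightarrow> real \<Rightarrow> 'n::finite path \<Rightarrow> 'n path" where
  "stop r t T \<omega> = paste r t T \<omega> (const_path t T 0)"

lemma stop_in_path_space:
  "\<omega> \<in> path_space \<kappa> r t \<Longrightarrow> r \<le> t \<Longrightarrow> t \<le> T \<Longrightarrow> stop r t T \<omega> \<in> path_space \<kappa> r T"
  unfolding stop_def by (intro paste_in_path_space[where t = t] const_path_in_path_space) auto

lemma stop_before: "r \<le> v \<Longrightarrow> v \<le> t \<Longrightarrow> t \<le> T \<Longrightarrow> stop r t T \<omega> v = \<omega> v"
  by (simp add: stop_def paste_before)

lemma stop_after: "r \<le> t \<Longrightarrow> t \<le> v \<Longrightarrow> v \<le> T \<Longrightarrow> stop r t T \<omega> v = \<omega> t"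
  by (simp add: stop_def paste_after const_path_def)

lemma stop_measurable:
  assumes "r \<le> t" "t \<le> T" "w \<le> u \<or> t \<le> u" "w \<le> T"
  shows "stop r t T \<in> path_sigma \<kappa> r t u \<rightarrow>\<^sub>M path_sigma \<kappa> r T w"
proof (rule measurable_path_sigma)
  show "stop r t T \<omega> \<in> path_space \<kappa> r T" if "\<omega> \<in> space (path_sigma \<kappa> r t u)" for \<omega>
    using that assms by (auto intro: stop_in_path_space)
  fix v assume v: "r \<le> v" "v \<le> w"
  show "(\<lambda>\<omega>. stop r t T \<omega> v) \<in> borel_measurable (path_sigma \<kappa> r t u)"
  proof (cases "v \<le> t")
    case True
    then show ?thesis
      using v assms by (auto simp: stop_before intro!: path_coordinate_measurable)
  next
    case False
    then show ?thesis
      using v assms by (auto simp: stop_after intro!: path_coordinate_measurable)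
  qed
qed

lemma rational_levels_generate:
  fixes h :: "'a \<Rightarrow> real"
  shows "h \<in> borel_measurable (sigma \<Omega> {{\<omega> \<in> \<Omega>. h \<omega> \<le> p} | p. p \<in> \<rat>})"
  unfolding borel_measurable_iff_le
proof
  fix a :: real
  let ?S = "sigma \<Omega> {{\<omega> \<in> \<Omega>. h \<omega> \<le> p} | p. p \<in> \<rat>}"
  have sets: "{\<omega> \<in> \<Omega>. h \<omega> \<le> p} \<in> sets ?S" if "p \<in> \<rat>" for p
    by (rule in_measure_of) (use that in blast)+
  have c: "countable {p\<in>\<rat>. a < p}"
    by (rule countable_subset[OF _ countable_rat]) auto
  have sp: "space ?S = \<Omega>"
    by (rule space_measure_of) auto
  have "h \<omega> \<le> a \<longleftrightarrow> (\<forall>p\<in>{p\<in>\<rat>. a < p}. h \<omega> \<le> p)" for \<omega>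
  proof
    assume *: "\<forall>p\<in>{p\<in>\<rat>. a < p}. h \<omega> \<le> p"
    show "h \<omega> \<le> a"
    proof (rule ccontr)
      assume "\<not> h \<omega> \<le> a"
      then obtain p where "p \<in> \<rat>" "a < p" "p < h \<omega>"
        using Rats_dense_in_real[of a "h \<omega>"] by auto
      with * show False by force
    qed
  qed auto
  moreover have "{p\<in>\<rat>. a < p} \<noteq> {}"
    using Rats_dense_in_real[of a "a + 1"] by auto
  ultimately have "{\<omega> \<in> space ?S. h \<omega> \<le> a} = (\<Inter>p\<in>{p\<in>\<rat>. a < p}. {\<omega> \<in> \<Omega>. h \<omega> \<le> p})"
    by (auto simp: sp)
  also have "\<dots> \<in> sets ?S"
    using sets \<open>{p\<in>\<rat>. a < p} \<noteq> {}\<close> by (intro sets.countable_INT' c) auto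
  finally show "{\<omega> \<in> space ?S. h \<omega> \<le> a} \<in> sets ?S" .
qed

text \<open>For rational levels, a countable family of events before \<open>u\<close> that is stable under intersection and
  generates all of them, because the path up to \<open>u\<close> can be recovered from its code.\<close>

definition level_sets :: "path_kind \<Rightarrow> real \<Rightarrow> real \<Rightarrow> real \<Rightarrow> real \<Rightarrow> 'n::finite path set" where
  "level_sets \<kappa> s t u p = {\<omega> \<in> path_space \<kappa> s t. path_code s u (restrict \<omega> {s..u}) \<le> p}"

lemma level_sets_measurable:
  assumes "s \<le> u" "u \<le> t"
  shows "level_sets \<kappa> s t u p \<in> sets (path_sigma \<kappa> s t u)"
proof -
  have "(\<lambda>\<omega>. path_code s u (restrict \<omega> {s..u})) \<in> borel_measurable (path_sigma \<kappa> s t u)"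
    using assms by (intro measurable_compose[OF restrict_path_measurable path_code_measurable]) auto
  then have "{\<omega> \<in> space (path_sigma \<kappa> s t u). path_code s u (restrict \<omega> {s..u}) \<le> p} \<in> sets (path_sigma \<kappa> s t u)"
    unfolding borel_measurable_iff_le by blast
  then show ?thesis
    by (simp add: level_sets_def)
qed

lemma level_sets_generate:
  fixes A :: "'n::finite path set"
  assumes le: "s \<le> u" "u \<le> t" and A: "A \<in> sets (path_sigma \<kappa> s t u)"
  shows "A \<in> sigma_sets (path_space \<kappa> s t) (level_sets \<kappa> s t u ` \<rat>)"
proof -
  let ?\<Omega> = "path_space \<kappa> s t :: 'n path set"
  let ?h = "\<lambda>\<omega> :: 'n path. path_code s u (restrict \<omega> {s..u})"
  have G: "level_sets \<kappa> s t u ` \<rat> = {{\<omega> \<in> ?\<Omega>. ?h \<omega> \<le> p} | p. p \<in> \<rat>}"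
    by (auto simp: level_sets_def)
  have "stop s u t \<in> path_sigma \<kappa> s u u \<rightarrow>\<^sub>M path_sigma \<kappa> s t u"
    using le by (intro stop_measurable) auto
  then have "(\<lambda>x. stop s u t (path_decode \<kappa> s u x)) \<in> borel \<rightarrow>\<^sub>M path_sigma \<kappa> s t u"
    using path_decode_measurable[OF le(1)] by (rule measurable_compose[rotated])
  from measurable_sets[OF this A]
  have C: "(\<lambda>x. stop s u t (path_decode \<kappa> s u x)) -` A \<in> sets borel"
    by simp
  have "A = ?h -` ((\<lambda>x. stop s u t (path_decode \<kappa> s u x)) -` A) \<inter> ?\<Omega>"
  proof -
    have "\<omega> \<in> A \<longleftrightarrow> stop s u t (path_decode \<kappa> s u (?h \<omega>)) \<in> A" if \<omega>: "\<omega> \<in> ?\<Omega>" for \<omega>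
    proof -
      have r: "restrict \<omega> {s..u} \<in> path_space \<kappa> s u"
        using \<omega> le by (intro restrict_in_path_space) auto
      then have "path_decode \<kappa> s u (?h \<omega>) = restrict \<omega> {s..u}"
        using le by (intro path_decode_code)
      moreover have "\<omega> \<in> A \<longleftrightarrow> stop s u t (restrict \<omega> {s..u}) \<in> A"
        using \<omega> le r by (intro path_sigma_sets_local[OF A] stop_in_path_space) (auto simp: stop_before)
      ultimately show ?thesis
        by simp
    qed
    then show ?thesis
      using sets.sets_into_space[OF A] by auto
  qed
  also have "\<dots> \<in> sigma_sets ?\<Omega> (level_sets \<kappa> s t u ` \<rat>)"
  proof -
    have sub: "{{\<omega> \<in> ?\<Omega>. ?h \<omega> \<le> p} | p. p \<in> \<rat>} \<subseteq> Pow ?\<Omega>"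
      by auto
    show ?thesis
      using measurable_sets[OF rational_levels_generate[of ?h ?\<Omega>] C]
      unfolding G space_measure_of[OF sub] sets_measure_of[OF sub] .
  qed
  finally show ?thesis .
qed

lemma Int_stable_level_sets: "Int_stable (level_sets \<kappa> s t u ` \<rat>)"
proof (rule Int_stableI_image)
  fix p q :: real assume "p \<in> \<rat>" "q \<in> \<rat>"
  then show "\<exists>c\<in>\<rat>. level_sets \<kappa> s t u p \<inter> level_sets \<kappa> s t u q = level_sets \<kappa> s t u c"
    by (intro bexI[of _ "min p q"]) (auto simp: level_sets_def min_def)
qed

lemma AE_zero_of_integrals:
  fixes f :: "'a \<Rightarrow> real"
  assumes Q: "prob_space Q" "subalgebra Q F" and f: "f \<in> borel_measurable F" "integrable Q f"
    and zero: "\<And>A. A \<in> sets F \<Longrightarrow> (\<integral>\<omega>. indicator A \<omega> * f \<omega> \<partial>Q) = 0"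
  shows "AE \<omega> in Q. f \<omega> = 0"
proof -
  interpret prob_space Q by fact
  interpret finite_measure_subalgebra Q F
    by unfold_locales (rule Q(2))
  have "AE \<omega> in Q. real_cond_exp Q F f \<omega> = 0"
    using zero f by (intro real_cond_exp_charact) (auto simp: set_lebesgue_integral_def)
  moreover have "AE \<omega> in Q. real_cond_exp Q F f \<omega> = f \<omega>"
    using f by (rule real_cond_exp_F_meas[rotated])
  ultimately show ?thesis
    by eventually_elim simp
qed

context controlled_mp
begin

lemma on_path_restrict:
  "a \<le> u \<Longrightarrow> v \<le> b \<Longrightarrow> on_path Y k u v (restrict \<omega> {a..b}) = on_path Y k u v \<omega>"
  by (intro on_path_cong) auto

text \<open>The restriction of a solution solves the problem on the shorter interval, where solutions are unique, too.\<close>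

lemma restrict_law:
  assumes \<theta>: "\<theta> \<in> \<Theta>" and le: "0 \<le> s" "s < t" "t \<le> T"
  shows "distr (law \<theta> s T y) (path_sigma \<kappa> s t t) (\<lambda>\<omega>. restrict \<omega> {s..t}) = law \<theta> s t y"
proof (rule law_unique[OF \<theta> le])
  have sT: "s < T" and st: "s \<le> t"
    using le by auto
  let ?P = "law \<theta> s T y" and ?r = "\<lambda>\<omega> :: 'n path. restrict \<omega> {s..t}"
  note law = \<theta> le(1) sT order_refl
  note P = prob_space_law[OF law, of y] sets_law[OF law, of y]
  have r: "?r \<in> path_sigma \<kappa> s T u \<rightarrow>\<^sub>M path_sigma \<kappa> s t u" for u
    using le by (intro restrict_path_measurable) auto
  have "?r \<in> path_sigma \<kappa> s T T \<rightarrow>\<^sub>M path_sigma \<kappa> s t t"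
    by (rule measurable_path_sigma_mono[OF le(3) r])
  then have rP: "?r \<in> ?P \<rightarrow>\<^sub>M path_sigma \<kappa> s t t"
    by (simp add: P(2) cong: measurable_cong_sets)
  have "centered (distr ?P (path_sigma \<kappa> s t t) ?r) (path_sigma \<kappa> s t) (on_path (Z \<theta>) k) s t" if k: "k \<in> I" for k
    unfolding centered_def
  proof (intro allI impI)
    fix u v and A :: "'n path set" assume *: "s \<le> u \<and> u \<le> v \<and> v \<le> t \<and> A \<in> sets (path_sigma \<kappa> s t u)"
    have "on_path (Z \<theta>) k u v \<in> borel_measurable (path_sigma \<kappa> s t v)"
      using * le by (intro incrementsD(1)[OF on_path_increments[OF \<theta> k le(1,3)]]) auto
    then have "on_path (Z \<theta>) k u v \<in> borel_measurable (path_sigma \<kappa> s t t)"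
      by (rule measurable_path_sigma_mono[rotated]) (use * in auto)
    moreover have "A \<in> sets (path_sigma \<kappa> s t t)"
      using * by (auto intro: path_sigma_mono[of u])
    ultimately have "(\<integral>\<omega>. indicator A \<omega> * on_path (Z \<theta>) k u v \<omega> \<partial>distr ?P (path_sigma \<kappa> s t t) ?r) =
        (\<integral>\<omega>. indicator A (?r \<omega>) * on_path (Z \<theta>) k u v (?r \<omega>) \<partial>?P)"
      by (intro integral_distr[OF rP] borel_measurable_times borel_measurable_indicator)
    also have "\<dots> = (\<integral>\<omega>. indicator (?r -` A \<inter> path_space \<kappa> s T) \<omega> * on_path (Z \<theta>) k u v \<omega> \<partial>?P)"
      using * by (intro Bochner_Integration.integral_cong)
        (auto simp: on_path_restrict space_path_measure[OF P(2)] indicator_def)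
    also have "\<dots> = 0"
      using law_centered[OF law k, of y] * le measurable_sets[OF r[of u], of A] unfolding centered_def by simp
    finally show "(\<integral>\<omega>. indicator A \<omega> * on_path (Z \<theta>) k u v \<omega> \<partial>distr ?P (path_sigma \<kappa> s t t) ?r) = 0" .
  qed
  moreover have "AE \<omega> in distr ?P (path_sigma \<kappa> s t t) ?r. \<omega> s = y"
  proof -
    have [measurable]: "(\<lambda>\<omega>. \<omega> s) \<in> borel_measurable (path_sigma \<kappa> s t t :: 'n path measure)"
      using st by (intro path_coordinate_measurable) auto
    have "{\<omega> \<in> space (path_sigma \<kappa> s t t :: 'n path measure). \<omega> s = y} \<in> sets (path_sigma \<kappa> s t t)"
      by measurable
    then show ?thesis
      using law_initial[OF law, of y] st by (subst AE_distr_iff[OF rP]) auto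
  qed
  ultimately show "mp_solution \<kappa> s t I (\<lambda>k. on_path (Z \<theta>) k s) y (distr ?P (path_sigma \<kappa> s t t) ?r)"
    using prob_space.prob_space_distr[OF P(1) rP] \<theta> le by (subst on_path_solution_iff) auto
qed

lemma on_path_right_approx:
  assumes \<theta>: "\<theta> \<in> \<Theta>" and k: "k \<in> I" and le: "0 \<le> s" "s \<le> v" "v \<le> t" "t \<le> T" and \<omega>: "\<omega> \<in> path_space \<kappa> s t"
  shows "(\<lambda>n. on_path (Z \<theta>) k s (right_approx s t v n) \<omega>) \<longlonglongrightarrow> on_path (Z \<theta>) k s v \<omega>"
proof (cases "v = t")
  case False
  then have vt: "v < t" using le by simp
  let ?\<omega> = "stop s t T \<omega>"
  have "?\<omega> \<in> path_space \<kappa> s T"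
    using \<omega> le by (intro stop_in_path_space) auto
  then have "((\<lambda>u. on_path (Z \<theta>) k s u ?\<omega>) \<longlongrightarrow> on_path (Z \<theta>) k s v ?\<omega>) (at_right v)"
    using additive[OF \<theta>] k le vt unfolding additive_mp_def by auto
  moreover have "filterlim (right_approx s t v) (at_right v) sequentially"
    using right_approx(2)[OF le(2) vt] right_approx_lim[OF le(2,3)]
    by (auto simp: filterlim_at less_imp_neq[symmetric] intro!: always_eventually)
  ultimately have "(\<lambda>n. on_path (Z \<theta>) k s (right_approx s t v n) ?\<omega>) \<longlonglongrightarrow> on_path (Z \<theta>) k s v ?\<omega>"
    by (rule filterlim_compose)
  moreover have "on_path (Z \<theta>) k s u ?\<omega> = on_path (Z \<theta>) k s u \<omega>" if "u \<le> t" for u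
    using that le by (intro on_path_cong stop_before) auto
  ultimately show ?thesis
    using right_approx(3)[OF le(2) vt] le by (simp add: less_imp_le)
qed simp

text \<open>For dense times the events of a countable generator suffice. The other times follow by right continuity
  and dominated convergence. A bound that is uniform in time is available because, at dense times, the
  process is the conditional expectation of its bounded final value.\<close>

lemma centered_from_countable:
  assumes \<theta>: "\<theta> \<in> \<Theta>" and k: "k \<in> I" and le: "0 \<le> s" "s < t" "t \<le> T"
    and P: "prob_space P" "sets P = sets (path_sigma \<kappa> s t t)"
    and zero: "\<And>u v p. u \<in> dense_times s t \<Longrightarrow> v \<in> dense_times s t \<Longrightarrow> u \<le> v \<Longrightarrow> p \<in> \<rat> \<Longrightarrow>
      (\<integral>\<omega>. indicator (level_sets \<kappa> s t u p) \<omega> * on_path (Z \<theta>) k u v \<omega> \<partial>P) = 0"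
  shows "centered P (path_sigma \<kappa> s t) (on_path (Z \<theta>) k) s t"
proof -
  interpret prob_space P by fact
  let ?W = "on_path (Z \<theta>) k"
  have st: "s \<le> t" using le by simp
  note D = dense_times_subset[OF st]
  note spP = space_path_measure[OF P(2)]
  note inc = on_path_increments[OF \<theta> k le(1,3)]
  have sets_P: "A \<in> sets P" if "A \<in> sets (path_sigma \<kappa> s t u)" "u \<le> t" for A u
    using path_sigma_mono[OF that(2,1)] P(2) by simp
  have int: "integrable P (?W u v)" if "s \<le> u" "u \<le> v" "v \<le> t" for u v
    by (rule increments_integrable[OF inc that P])
  have dense: "(\<integral>\<omega>. indicator A \<omega> * ?W u v \<omega> \<partial>P) = 0"
    if uv: "u \<in> dense_times s t" "v \<in> dense_times s t" "u \<le> v" and A: "A \<in> sets (path_sigma \<kappa> s t u)" for u v A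
  proof (rule integral_zero_on_generated)
    have u: "s \<le> u" "u \<le> t" "s \<le> v" "v \<le> t"
      using uv D by auto
    show "integrable P (?W u v)"
      using u uv by (intro int)
    show "Int_stable (level_sets \<kappa> s t u ` \<rat> :: 'n path set set)"
      by (rule Int_stable_level_sets)
    have "level_sets \<kappa> s t u ` \<rat> \<subseteq> sets P"
      using level_sets_measurable[OF u(1,2)] sets_P u by blast
    then show "sigma_sets (space P) (level_sets \<kappa> s t u ` \<rat>) \<subseteq> sets P"
      by (rule sets.sigma_sets_subset)
    show "A \<in> sigma_sets (space P) (level_sets \<kappa> s t u ` \<rat>)"
      unfolding spP by (rule level_sets_generate[OF u(1,2) A])
    show "(\<integral>\<omega>. indicator B \<omega> * ?W u v \<omega> \<partial>P) = 0" if "B \<in> level_sets \<kappa> s t u ` \<rat>" for B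
      using zero uv that by auto
    \<comment> \<open>Codes are below 1, so this level set is the whole space.\<close>
    have "level_sets \<kappa> s t u 1 = (path_space \<kappa> s t :: 'n path set)"
      using path_code_bounds less_imp_le unfolding level_sets_def by blast
    then have "(\<integral>\<omega>. ?W u v \<omega> \<partial>P) = (\<integral>\<omega>. indicator (level_sets \<kappa> s t u 1) \<omega> * ?W u v \<omega> \<partial>P)"
      by (intro Bochner_Integration.integral_cong) (auto simp: spP)
    then show "(\<integral>\<omega>. ?W u v \<omega> \<partial>P) = 0"
      using zero[OF uv, of 1] by simp
  qed
  obtain C where C: "\<And>\<omega>. \<omega> \<in> path_space \<kappa> s t \<Longrightarrow> \<bar>?W s t \<omega>\<bar> \<le> C"
    using incrementsD(2)[OF inc order_refl st order_refl] by auto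
  have bound: "AE \<omega> in P. \<bar>?W s v \<omega>\<bar> \<le> C" if v: "v \<in> dense_times s t" for v
  proof -
    have v': "s \<le> v" "v \<le> t"
      using v D by auto
    interpret finite_measure_subalgebra P "path_sigma \<kappa> s t v"
      by unfold_locales (rule subalgebra_path_measure[OF P(2) v'(2)])
    have "AE \<omega> in P. real_cond_exp P (path_sigma \<kappa> s t v) (?W s t) \<omega> = ?W s v \<omega>"
    proof (rule real_cond_exp_charact)
      show "integrable P (?W s t)" "integrable P (?W s v)" "?W s v \<in> borel_measurable (path_sigma \<kappa> s t v)"
        using v' st by (auto intro!: int incrementsD(1)[OF inc])
      fix A :: "'n path set" assume A: "A \<in> sets (path_sigma \<kappa> s t v)"
      have "A \<in> sets P"
        using sets_P[OF A v'(2)] .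
      note ints = integrable_mult_indicator[OF this int[of s v]] integrable_mult_indicator[OF this int[of v t]]
      have "(\<integral>\<omega>. indicator A \<omega> * ?W s t \<omega> \<partial>P) = (\<integral>\<omega>. indicator A \<omega> * ?W s v \<omega> + indicator A \<omega> * ?W v t \<omega> \<partial>P)"
        using incrementsD(3)[OF inc order_refl v' _ v'(2) order_refl]
        by (intro Bochner_Integration.integral_cong) (auto simp: spP distrib_left)
      also have "\<dots> = (\<integral>\<omega>. indicator A \<omega> * ?W s v \<omega> \<partial>P) + (\<integral>\<omega>. indicator A \<omega> * ?W v t \<omega> \<partial>P)"
        using ints v' by (intro Bochner_Integration.integral_add) auto
      also have "(\<integral>\<omega>. indicator A \<omega> * ?W v t \<omega> \<partial>P) = 0"
        using v v'(2) A by (intro dense) (auto simp: dense_times_def)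
      finally show "(\<integral>\<omega>\<in>A. ?W s t \<omega> \<partial>P) = (\<integral>\<omega>\<in>A. ?W s v \<omega> \<partial>P)"
        by (simp add: set_lebesgue_integral_def)
    qed
    moreover have "AE \<omega> in P. real_cond_exp P (path_sigma \<kappa> s t v) (?W s t) \<omega> \<le> C"
    proof (rule real_cond_exp_le_c)
      show "AE \<omega> in P. ?W s t \<omega> \<le> C"
        using C spP by (intro AE_I2) (simp add: abs_le_iff)
    qed (use int st in auto)
    moreover have "AE \<omega> in P. real_cond_exp P (path_sigma \<kappa> s t v) (?W s t) \<omega> \<ge> - C"
    proof (rule real_cond_exp_ge_c)
      show "AE \<omega> in P. ?W s t \<omega> \<ge> - C"
        using C spP by (intro AE_I2) (metis abs_le_D2 minus_le_iff)
    qed (use int st in auto)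
    ultimately show ?thesis
      by eventually_elim auto
  qed
  show ?thesis
    unfolding centered_def
  proof (intro allI impI)
    fix u v and A :: "'n path set" assume *: "s \<le> u \<and> u \<le> v \<and> v \<le> t \<and> A \<in> sets (path_sigma \<kappa> s t u)"
    show "(\<integral>\<omega>. indicator A \<omega> * ?W u v \<omega> \<partial>P) = 0"
    proof (cases "u = v")
      case True
      have "?W u v \<omega> = 0" if "\<omega> \<in> path_space \<kappa> s t" for \<omega>
        using incrementsD(3)[OF inc, of u u \<omega> u] that * True by simp
      then have "(\<integral>\<omega>. indicator A \<omega> * ?W u v \<omega> \<partial>P) = (\<integral>\<omega>. 0 \<partial>P)"
        by (intro Bochner_Integration.integral_cong) (auto simp: spP)
      then show ?thesis
        by simp
    next
      case False
      let ?a = "right_approx s t"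
      have uv: "s \<le> u" "u < v" "u \<le> t" "s \<le> v" "v \<le> t" "u < t"
        using * False by auto
      have A: "A \<in> sets P"
        using * uv by (intro sets_P[of _ u]) auto
      have aD: "?a u n \<in> dense_times s t" "?a v n \<in> dense_times s t" for n
        using uv by (auto intro: right_approx_dense)
      have av: "v \<le> ?a v n" for n
        using right_approx(2)[of s v t n] uv by (cases "v = t") auto
      have eq: "?W s (?a v n) \<omega> - ?W s (?a u n) \<omega> = ?W (?a u n) (?a v n) \<omega>"
        if "\<omega> \<in> path_space \<kappa> s t" "?a u n < v" for \<omega> n
        using incrementsD(3)[OF inc order_refl, of "?a u n" \<omega> "?a v n"] that aD[of n] av[of n] D by (auto simp: subset_eq)
      have lim: "(\<lambda>n. \<integral>\<omega>. indicator A \<omega> * (?W s (?a v n) \<omega> - ?W s (?a u n) \<omega>) \<partial>P) \<longlonglongrightarrow>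
          (\<integral>\<omega>. indicator A \<omega> * (?W s v \<omega> - ?W s u \<omega>) \<partial>P)"
      proof (rule integral_dominated_convergence[where w = "\<lambda>_. C + C"])
        have "?W s w \<in> borel_measurable P" if "s \<le> w" "w \<le> t" for w
          using int[of s w] that by auto
        then show "(\<lambda>\<omega>. indicator A \<omega> * (?W s v \<omega> - ?W s u \<omega>)) \<in> borel_measurable P"
          "(\<lambda>\<omega>. indicator A \<omega> * (?W s (?a v n) \<omega> - ?W s (?a u n) \<omega>)) \<in> borel_measurable P" for n
          using A uv aD[THEN subsetD[OF D]]
          by (auto intro!: borel_measurable_times borel_measurable_indicator borel_measurable_diff)
        show "AE \<omega> in P. (\<lambda>n. indicator A \<omega> * (?W s (?a v n) \<omega> - ?W s (?a u n) \<omega>)) \<longlonglongrightarrow>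
            indicator A \<omega> * (?W s v \<omega> - ?W s u \<omega>)"
          using uv le by (intro AE_I2 tendsto_intros on_path_right_approx \<theta> k) (auto simp: spP)
        show "AE \<omega> in P. norm (indicator A \<omega> * (?W s (?a v n) \<omega> - ?W s (?a u n) \<omega>)) \<le> C + C" for n
          using bound[OF aD(1)[of n]] bound[OF aD(2)[of n]]
          by eventually_elim (auto simp: indicator_def)
      qed simp
      have ev: "\<forall>\<^sub>F n in sequentially. (\<integral>\<omega>. indicator A \<omega> * (?W s (?a v n) \<omega> - ?W s (?a u n) \<omega>) \<partial>P) = 0"
      proof -
        have "\<forall>\<^sub>F n in sequentially. ?a u n < v"
          using order_tendstoD(2)[OF right_approx_lim[OF uv(1,3)] uv(2)] .
        then show ?thesis
        proof eventually_elim
          case (elim n)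
          have "(\<integral>\<omega>. indicator A \<omega> * (?W s (?a v n) \<omega> - ?W s (?a u n) \<omega>) \<partial>P) =
              (\<integral>\<omega>. indicator A \<omega> * ?W (?a u n) (?a v n) \<omega> \<partial>P)"
            using eq elim by (intro Bochner_Integration.integral_cong) (auto simp: spP)
          also have "\<dots> = 0"
          proof (rule dense[OF aD])
            show "?a u n \<le> ?a v n"
              using elim av[of n] by simp
            show "A \<in> sets (path_sigma \<kappa> s t (?a u n))"
              using * by (intro path_sigma_mono[OF less_imp_le[OF right_approx(2)[OF uv(1,6)]]]) simp
          qed
          finally show ?case .
        qed
      qed
      have "(\<integral>\<omega>. indicator A \<omega> * (?W s v \<omega> - ?W s u \<omega>) \<partial>P) = 0"
        by (rule LIMSEQ_unique[OF lim tendsto_eventually[OF ev]])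
      moreover have "(\<integral>\<omega>. indicator A \<omega> * (?W s v \<omega> - ?W s u \<omega>) \<partial>P) = (\<integral>\<omega>. indicator A \<omega> * ?W u v \<omega> \<partial>P)"
        using incrementsD(3)[OF inc order_refl uv(1,3) _ less_imp_le[OF uv(2)] uv(5)]
        by (intro Bochner_Integration.integral_cong) (auto simp: spP)
      ultimately show ?thesis
        by simp
    qed
  qed
qed

end

section \<open>Uniqueness of the solution and conditional expectations\<close>

context switched_mp_problem
begin

text \<open>A function of the path up to \<open>t\<close> does not notice that the future is replaced by a path frozen at \<open>t\<close>.\<close>

lemma restrict_local:
  fixes \<psi> :: "'n path \<Rightarrow> real"
  assumes \<psi>: "\<psi> \<in> borel_measurable (\<F> t)" and le: "r \<le> s" "s \<le> t" "t \<le> T"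
    and \<omega>: "\<omega> \<in> \<Omega>" "\<omega>' \<in> path_space \<kappa> s T"
  shows "\<psi> (paste r s T \<omega> (stop s t T (restrict \<omega>' {s..t}))) = \<psi> (paste r s T \<omega> \<omega>')"
proof (rule path_sigma_measurable_local[OF \<psi>])
  have sT: "s \<le> T" using le by simp
  have rp: "restrict \<omega>' {s..t} \<in> path_space \<kappa> s t"
    using le by (intro restrict_in_path_space[OF \<omega>(2)]) auto
  show "paste r s T \<omega> (stop s t T (restrict \<omega>' {s..t})) \<in> \<Omega>"
    by (intro paste_in_path_space[OF \<omega>(1)] stop_in_path_space[OF rp] le sT)
  show "paste r s T \<omega> \<omega>' \<in> \<Omega>"
    by (intro paste_in_path_space[OF \<omega>] le sT)
  show "paste r s T \<omega> (stop s t T (restrict \<omega>' {s..t})) v = paste r s T \<omega> \<omega>' v" if "r \<le> v" "v \<le> t" for v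
  proof (cases "v \<le> s")
    case True
    then show ?thesis
      using that sT by (simp add: paste_before)
  next
    case False
    then show ?thesis
      using that le by (simp add: paste_after stop_before)
  qed
qed

text \<open>Here \<open>\<rho>\<close> is a conditional law of the path on \<open>[s,t]\<close>, where \<open>t\<close> is the end of the step. For fixed
  times and a fixed event of the future, the conditional integral of the increment vanishes on each
  cell, because integrating it further over an event of the past gives the integral of an increment of the
  switched family over an event before \<open>u\<close>. Countably many null sets are discarded; outside of them the conditional law solves
  the problem for countably many indices, hence for all, and uniqueness identifies it.\<close>

lemma active_law_AE:
  assumes Q: "prob_space Q" "sets Q = sets (\<F> T)" and c: "\<And>k. k \<in> I \<Longrightarrow> centered Q \<F> (W k) r T"
    and i: "i < N" "\<tau> i \<le> s" "s < \<tau> (Suc i)"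
    and \<rho>: "\<rho> \<in> \<F> s \<rightarrow>\<^sub>M prob_algebra (path_sigma \<kappa> s (\<tau> (Suc i)) (\<tau> (Suc i)))"
    and \<rho>_int: "\<And>h B. (\<lambda>(\<omega>, x). h \<omega> x) \<in> borel_measurable (\<F> s \<Otimes>\<^sub>M path_sigma \<kappa> s (\<tau> (Suc i)) (\<tau> (Suc i))) \<Longrightarrow>
      (\<And>\<omega> x. \<omega> \<in> \<Omega> \<Longrightarrow> x \<in> path_space \<kappa> s (\<tau> (Suc i)) \<Longrightarrow> \<bar>h \<omega> x\<bar> \<le> (B::real)) \<Longrightarrow>
      (\<integral>\<omega>. \<integral>x. h \<omega> x \<partial>\<rho> \<omega> \<partial>Q) = (\<integral>\<omega>. h \<omega> (restrict \<omega> {s..\<tau> (Suc i)}) \<partial>Q)"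
  shows "AE \<omega> in Q. \<rho> \<omega> = law (current i \<omega>) s (\<tau> (Suc i)) (\<omega> s)"
proof -
  interpret prob_space Q by fact
  let ?t = "\<tau> (Suc i)" and ?X = "\<lambda>\<omega> :: 'n path. restrict \<omega> {s..\<tau> (Suc i)}"
  let ?P = "path_sigma \<kappa> s ?t ?t :: 'n path measure"
  have le: "r \<le> s" "s \<le> ?t" "?t \<le> T" "s \<le> T" "0 \<le> s" "s < T"
    using times_ge[of i] times_le[of "Suc i"] i r0 by auto
  note spQ = space_path_measure[OF Q(2)]
  note D = dense_times_subset[OF le(2)]
  have \<rho>p: "prob_space (\<rho> \<omega>)" "sets (\<rho> \<omega>) = sets ?P" "space (\<rho> \<omega>) = path_space \<kappa> s ?t" if "\<omega> \<in> \<Omega>" for \<omega>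
    using kernel_prob_space[OF \<rho>] that by auto
  have sub: "subalgebra Q (\<F> s)"
    by (rule subalgebra_path_measure[OF Q(2) le(4)])
  \<comment> \<open>The joint law gives no mass to the pairs of a past and a future that do not meet at \<open>s\<close>.\<close>
  have initial: "AE \<omega> in Q. AE x in \<rho> \<omega>. x s = \<omega> s"
  proof -
    define B where "B = {(\<omega>, x) \<in> \<Omega> \<times> path_space \<kappa> s ?t. x s \<noteq> \<omega> s}"
    have [measurable]: "(\<lambda>p. fst p s) \<in> borel_measurable (\<F> s \<Otimes>\<^sub>M ?P)" "(\<lambda>p. snd p s) \<in> borel_measurable (\<F> s \<Otimes>\<^sub>M ?P)"
      by (rule measurable_compose[OF measurable_fst path_coordinate_measurable], (use le in auto)[2])
        (rule measurable_compose[OF measurable_snd path_coordinate_measurable], (use le in auto)[2])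
    have "{p \<in> space (\<F> s \<Otimes>\<^sub>M ?P). snd p s \<noteq> fst p s} \<in> sets (\<F> s \<Otimes>\<^sub>M ?P)"
      by measurable
    also have "{p \<in> space (\<F> s \<Otimes>\<^sub>M ?P). snd p s \<noteq> fst p s} = B"
      by (auto simp: B_def space_pair_measure)
    finally have B: "B \<in> sets (\<F> s \<Otimes>\<^sub>M ?P)" .
    then have m: "(\<lambda>(\<omega>, x). indicator B (\<omega>, x) :: real) \<in> borel_measurable (\<F> s \<Otimes>\<^sub>M ?P)"
      by (simp add: case_prod_beta)
    let ?g = "\<lambda>\<omega>. \<integral>x. indicator B (\<omega>, x) \<partial>\<rho> \<omega> :: real"
    have "(\<integral>\<omega>. ?g \<omega> \<partial>Q) = (\<integral>\<omega>. indicator B (\<omega>, ?X \<omega>) \<partial>Q)"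
      by (rule \<rho>_int[OF m, of 1]) (simp add: indicator_def)
    also have "\<dots> = (\<integral>\<omega>. 0 \<partial>Q)"
      using le by (intro Bochner_Integration.integral_cong) (auto simp: B_def)
    finally have zero: "(\<integral>\<omega>. ?g \<omega> \<partial>Q) = 0"
      by simp
    have meas: "?g \<in> borel_measurable Q"
      by (rule measurable_from_subalg[OF sub kernel_integral_measurable[OF m \<rho>]])
    have "\<bar>?g \<omega>\<bar> \<le> 1" if "\<omega> \<in> space Q" for \<omega>
      using \<rho>p that by (intro integral_bounded_le) (auto simp: spQ indicator_def)
    then have "integrable Q ?g"
      by (rule integrable_bounded[OF Q(1) meas])
    moreover have "AE \<omega> in Q. 0 \<le> ?g \<omega>"
      by (intro AE_I2 Bochner_Integration.integral_nonneg) simp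
    ultimately have "AE \<omega> in Q. ?g \<omega> = 0"
      using integral_nonneg_eq_0_iff_AE zero by blast
    with AE_space show ?thesis
    proof eventually_elim
      case (elim \<omega>)
      then have \<omega>: "\<omega> \<in> \<Omega>"
        by (simp add: spQ)
      have B': "Pair \<omega> -` B \<in> sets (\<rho> \<omega>)"
        using sets_Pair1[OF B, of \<omega>] \<rho>p(2)[OF \<omega>] by simp
      interpret \<rho>: prob_space "\<rho> \<omega>" by (rule \<rho>p[OF \<omega>])
      have "indicator B (\<omega>, x) = (indicator (Pair \<omega> -` B) x :: real)" for x
        by (simp add: indicator_def)
      then have "?g \<omega> = \<rho>.prob (Pair \<omega> -` B)"
        using B' sets.sets_into_space[OF B'] by (simp add: Int_absorb2)
      then have "AE x in \<rho> \<omega>. x \<notin> Pair \<omega> -` B"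
        using elim \<rho>.prob_eq_0[OF B'] by simp
      with AE_space show ?case
        by eventually_elim (use \<omega> \<rho>p(3)[OF \<omega>] in \<open>auto simp: B_def\<close>)
    qed
  qed
  have zero: "AE \<omega> in Q. \<omega> \<in> cells R i j \<longrightarrow>
      (\<integral>x. indicator (level_sets \<kappa> s ?t u p) x * on_path (Z (params R i j)) k u v x \<partial>\<rho> \<omega>) = 0"
    if j: "j \<in> labels R i" and k: "k \<in> I" and uv: "u \<in> dense_times s ?t" "v \<in> dense_times s ?t" "u \<le> v" for j k u v p
  proof -
    let ?\<theta> = "params R i j" and ?A = "cells R i j"
    let ?L = "level_sets \<kappa> s ?t u p :: 'n path set"
    let ?g = "\<lambda>\<omega>. indicator ?A \<omega> * (\<integral>x. indicator ?L x * on_path (Z ?\<theta>) k u v x \<partial>\<rho> \<omega>)"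
    have u: "s \<le> u" "u \<le> ?t" "s \<le> v" "v \<le> ?t" "r \<le> u" "v \<le> T" "u \<le> T" "\<tau> i \<le> u"
      using uv D le i by auto
    note inc = on_path_increments[OF params_in[OF i(1) j] k le(5,3)]
    obtain C where C: "\<And>x. x \<in> path_space \<kappa> s ?t \<Longrightarrow> \<bar>on_path (Z ?\<theta>) k u v x\<bar> \<le> C"
      using incrementsD(2)[OF inc u(1) uv(3) u(4)] by auto
    have C0: "0 \<le> C"
      using C[OF const_path_in_path_space] abs_ge_zero order_trans by blast
    have L: "?L \<in> sets ?P"
      using level_sets_measurable[OF u(1,2)] path_sigma_mono[OF u(2)] by blast
    have W: "on_path (Z ?\<theta>) k u v \<in> borel_measurable ?P"
      by (rule measurable_path_sigma_mono[OF u(4) incrementsD(1)[OF inc u(1) uv(3) u(4)]])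
    have L': "(indicator ?L :: _ \<Rightarrow> real) \<in> borel_measurable ?P"
      by (rule borel_measurable_indicator[OF L])
    have fC: "\<bar>indicator ?L x * on_path (Z ?\<theta>) k u v x\<bar> \<le> C" if "x \<in> path_space \<kappa> s ?t" for x
      using C[OF that] C0 by (simp add: indicator_def)
    have A: "?A \<in> sets (\<F> s)"
      using cells_measurable[OF i(1) j] by (rule path_sigma_mono[OF i(2)])
    have pair: "(\<lambda>(\<omega>, x). indicator B \<omega> * (indicator ?L x * on_path (Z ?\<theta>) k u v x) :: real) \<in>
        borel_measurable (\<F> s \<Otimes>\<^sub>M ?P)" if "B \<in> sets (\<F> s)" for B
      unfolding case_prod_beta
      by (intro borel_measurable_times measurable_compose[OF measurable_fst borel_measurable_indicator[OF that]]
          measurable_compose[OF measurable_snd L'] measurable_compose[OF measurable_snd W])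
    have gF: "?g \<in> borel_measurable (\<F> s)"
      using kernel_integral_measurable[OF pair[OF A] \<rho>] by simp
    have "\<bar>?g \<omega>\<bar> \<le> C" if "\<omega> \<in> \<Omega>" for \<omega>
    proof -
      have "\<bar>\<integral>x. indicator ?L x * on_path (Z ?\<theta>) k u v x \<partial>\<rho> \<omega>\<bar> \<le> C"
        using \<rho>p[OF that] fC by (intro integral_bounded_le) auto
      then show ?thesis
        using C0 by (simp add: indicator_def)
    qed
    then have gi: "integrable Q ?g"
      using measurable_from_subalg[OF sub gF] by (intro integrable_bounded[OF Q(1)]) (auto simp: spQ)
    have "AE \<omega> in Q. ?g \<omega> = 0"
    proof (rule AE_zero_of_integrals[OF Q(1) sub gF gi])
      fix B :: "'n path set" assume B: "B \<in> sets (\<F> s)"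
      have BA: "B \<inter> ?A \<in> sets (\<F> s)"
        using B A by (rule sets.Int)
      have "(\<integral>\<omega>. indicator B \<omega> * ?g \<omega> \<partial>Q) =
          (\<integral>\<omega>. \<integral>x. indicator (B \<inter> ?A) \<omega> * (indicator ?L x * on_path (Z ?\<theta>) k u v x) \<partial>\<rho> \<omega> \<partial>Q)"
        by (simp add: indicator_inter_arith mult.assoc)
      also have "\<dots> = (\<integral>\<omega>. indicator (B \<inter> ?A) \<omega> * (indicator ?L (?X \<omega>) * on_path (Z ?\<theta>) k u v (?X \<omega>)) \<partial>Q)"
        using fC C0 by (intro \<rho>_int[OF pair[OF BA], of C]) (simp add: indicator_def)
      also have "\<dots> = (\<integral>\<omega>. indicator (B \<inter> ?A \<inter> (?X -` ?L \<inter> \<Omega>)) \<omega> * W k u v \<omega> \<partial>Q)"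
      proof (rule Bochner_Integration.integral_cong)
        fix \<omega> assume "\<omega> \<in> space Q"
        then have \<omega>: "\<omega> \<in> \<Omega>"
          by (simp add: spQ)
        have "on_path (Z ?\<theta>) k u v (?X \<omega>) = W k u v \<omega>" if "\<omega> \<in> ?A"
        proof -
          have "on_path (Z ?\<theta>) k u v (?X \<omega>) = on_path (Z ?\<theta>) k u v \<omega>"
            by (rule on_path_restrict[OF u(1,4)])
          then show ?thesis
            using switched_mp_current[OF k i(1) u(8) uv(3) u(4) \<omega>] active_eq[OF i(1) j that] by simp
        qed
        then show "indicator (B \<inter> ?A) \<omega> * (indicator ?L (?X \<omega>) * on_path (Z ?\<theta>) k u v (?X \<omega>)) =
            indicator (B \<inter> ?A \<inter> (?X -` ?L \<inter> \<Omega>)) \<omega> * W k u v \<omega>"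
          using \<omega> by (cases "\<omega> \<in> ?A") (auto simp: indicator_def)
      qed simp
      also have "\<dots> = 0"
      proof -
        have "?X \<in> \<F> u \<rightarrow>\<^sub>M path_sigma \<kappa> s ?t u"
          using le by (intro restrict_path_measurable) auto
        from measurable_sets[OF this level_sets_measurable[OF u(1,2)]]
        have "?X -` ?L \<inter> \<Omega> \<in> sets (\<F> u)"
          by simp
        then have "B \<inter> ?A \<inter> (?X -` ?L \<inter> \<Omega>) \<in> sets (\<F> u)"
          using path_sigma_mono[OF u(1) BA] by (rule sets.Int[rotated])
        then show ?thesis
          using c[OF k] u uv(3) unfolding centered_def by blast
      qed
      finally show "(\<integral>\<omega>. indicator B \<omega> * ?g \<omega> \<partial>Q) = 0" .
    qed
    then show ?thesis
      by eventually_elim auto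
  qed
  \<comment> \<open>Countable determination provides countably many indices for each of the finitely many parameters.\<close>
  have "\<exists>K\<subseteq>I. countable K \<and> (\<forall>y P. mp_solution \<kappa> s ?t K (\<lambda>k. on_path (Z (params R i j)) k s) y P \<longrightarrow>
      mp_solution \<kappa> s ?t I (\<lambda>k. on_path (Z (params R i j)) k s) y P)" if "j \<in> labels R i" for j
    using determined[OF params_in[OF i(1) that]] le i(3) unfolding countably_determined_def by blast
  then obtain K where K: "\<And>j. j \<in> labels R i \<Longrightarrow> K j \<subseteq> I" "\<And>j. j \<in> labels R i \<Longrightarrow> countable (K j)"
    "\<And>j y P. j \<in> labels R i \<Longrightarrow> mp_solution \<kappa> s ?t (K j) (\<lambda>k. on_path (Z (params R i j)) k s) y P \<Longrightarrow>
      mp_solution \<kappa> s ?t I (\<lambda>k. on_path (Z (params R i j)) k s) y P"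
    by metis
  let ?zero = "\<lambda>\<omega> j k u v p. \<omega> \<in> cells R i j \<longrightarrow> u \<le> v \<longrightarrow>
      (\<integral>x. indicator (level_sets \<kappa> s ?t u p) x * on_path (Z (params R i j)) k u v x \<partial>\<rho> \<omega>) = 0"
  have "AE \<omega> in Q. \<forall>j\<in>labels R i. \<forall>k\<in>K j. \<forall>u\<in>dense_times s ?t. \<forall>v\<in>dense_times s ?t. \<forall>p\<in>\<rat>. ?zero \<omega> j k u v p"
    using countable_dense_times K(1,2) countable_finite[OF finite_labels[OF i(1)]] countable_rat
  proof (intro AE_ball_countable' )
    fix j k u v p assume "j \<in> labels R i" "k \<in> K j" "u \<in> dense_times s ?t" "v \<in> dense_times s ?t"
    then show "AE \<omega> in Q. ?zero \<omega> j k u v p"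
      using zero[of j k u v p] K(1) by (cases "u \<le> v") auto
  qed auto
  with initial AE_space show ?thesis
  proof eventually_elim
    case (elim \<omega>)
    then have \<omega>: "\<omega> \<in> \<Omega>"
      by (simp add: spQ)
    let ?j = "active i \<omega>"
    note j = active_cell[OF i(1) \<omega>]
    note \<theta> = current_in[OF i(1) \<omega>]
    have "centered (\<rho> \<omega>) (path_sigma \<kappa> s ?t) (on_path (Z (current i \<omega>)) k) s ?t" if k: "k \<in> K ?j" for k
      using elim(3) j k K(1)[OF j(1)]
      by (intro centered_from_countable[OF \<theta> _ le(5) i(3) le(3) \<rho>p(1,2)[OF \<omega>]]) auto
    then have "mp_solution \<kappa> s ?t (K ?j) (\<lambda>k. on_path (Z (current i \<omega>)) k s) (\<omega> s) (\<rho> \<omega>)"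
      using elim(1) \<rho>p(1,2)[OF \<omega>] by (subst on_path_solution_iff[OF \<theta> le(5,2,3) K(1)[OF j(1)]]) auto
    then show ?case
      by (intro law_unique[OF \<theta> le(5) i(3) le(3)] K(3)[OF j(1)])
  qed
qed

text \<open>The function \<open>\<psi>\<close> is a function of the past of \<open>s\<close> and of the path on \<open>[s,t]\<close>, so its conditional
  expectation is its integral against the conditional law, which is the restriction of the law that the
  step operator integrates against.\<close>

lemma step_operator_conditional:
  assumes Q: "prob_space Q" "sets Q = sets (\<F> T)" and c: "\<And>k. k \<in> I \<Longrightarrow> centered Q \<F> (W k) r T"
    and i: "i < N" "\<tau> i \<le> s" "s < \<tau> (Suc i)"
    and \<psi>: "\<psi> \<in> bounded_path_functions \<kappa> r T (\<tau> (Suc i))" and A: "A \<in> sets (\<F> s)"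
  shows "(\<integral>\<omega>. indicator A \<omega> * \<psi> \<omega> \<partial>Q) = (\<integral>\<omega>. indicator A \<omega> * step_op i s \<psi> \<omega> \<partial>Q)"
proof -
  let ?t = "\<tau> (Suc i)" and ?X = "\<lambda>\<omega> :: 'n path. restrict \<omega> {s..\<tau> (Suc i)}"
  let ?P = "path_sigma \<kappa> s ?t ?t :: 'n path measure"
  have le: "r \<le> s" "s \<le> ?t" "?t \<le> T" "s \<le> T" "0 \<le> s" "s < T"
    using times_ge[of i] times_le[of "Suc i"] i r0 by auto
  note spQ = space_path_measure[OF Q(2)]
  have sub: "subalgebra Q (\<F> s)"
    by (rule subalgebra_path_measure[OF Q(2) le(4)])
  have "?X \<in> \<F> T \<rightarrow>\<^sub>M ?P"
    using le by (intro restrict_path_measurable) auto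
  then have X: "?X \<in> Q \<rightarrow>\<^sub>M ?P"
    using Q(2) by (simp cong: measurable_cong_sets)
  obtain \<rho> where \<rho>: "\<rho> \<in> \<F> s \<rightarrow>\<^sub>M prob_algebra ?P"
    and \<rho>_int: "\<And>h B. (\<lambda>(\<omega>, x). h \<omega> x) \<in> borel_measurable (\<F> s \<Otimes>\<^sub>M ?P) \<Longrightarrow>
      (\<And>\<omega> x. \<omega> \<in> \<Omega> \<Longrightarrow> x \<in> path_space \<kappa> s ?t \<Longrightarrow> \<bar>h \<omega> x\<bar> \<le> (B::real)) \<Longrightarrow>
      (\<integral>\<omega>. \<integral>x. h \<omega> x \<partial>\<rho> \<omega> \<partial>Q) = (\<integral>\<omega>. h \<omega> (?X \<omega>) \<partial>Q)"
  proof (rule retract_conditional_distribution[OF Q(1) sub X path_code_measurable[OF le(2)] _ path_decode_measurable[OF le(2)]])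
    show "0 \<le> path_code s ?t x \<and> path_code s ?t x < 1" for x :: "'n path"
      by (rule path_code_bounds)
    show "path_decode \<kappa> s ?t (path_code s ?t x) = x" if "x \<in> space ?P" for x
      using that le(2) by (intro path_decode_code) auto
    fix \<rho> assume 1: "\<rho> \<in> \<F> s \<rightarrow>\<^sub>M prob_algebra ?P"
      and 2: "\<And>h B. (\<lambda>(\<omega>, x). h \<omega> x) \<in> borel_measurable (\<F> s \<Otimes>\<^sub>M ?P) \<Longrightarrow>
        (\<And>\<omega> x. \<omega> \<in> space Q \<Longrightarrow> x \<in> space ?P \<Longrightarrow> \<bar>h \<omega> x\<bar> \<le> (B::real)) \<Longrightarrow>
        (\<integral>\<omega>. \<integral>x. h \<omega> x \<partial>\<rho> \<omega> \<partial>Q) = (\<integral>\<omega>. h \<omega> (?X \<omega>) \<partial>Q)"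
    show thesis
      by (rule that[OF 1], erule 2[unfolded spQ space_path_sigma]) assumption
  qed
  have AE: "AE \<omega> in Q. \<rho> \<omega> = law (current i \<omega>) s ?t (\<omega> s)"
    by (rule active_law_AE[OF Q _ i \<rho>], erule c, erule \<rho>_int) assumption
  note \<psi>' = bounded_path_functionsD[OF \<psi> le(3)]
  obtain C where C: "\<And>\<omega>. \<omega> \<in> \<Omega> \<Longrightarrow> \<bar>\<psi> \<omega>\<bar> \<le> C"
    using \<psi>'(4) by auto
  have C0: "0 \<le> C"
    using C[OF const_path_in_path_space] abs_ge_zero order_trans by blast
  let ?f = "\<lambda>\<omega> x. \<psi> (paste r s T \<omega> (stop s ?t T x))"
  have ps: "paste r s T \<omega> (stop s ?t T x) \<in> \<Omega>" if "\<omega> \<in> \<Omega>" "x \<in> path_space \<kappa> s ?t" for \<omega> x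
    using that le by (intro paste_in_path_space[where t = T] stop_in_path_space) auto
  have st: "stop s ?t T \<in> ?P \<rightarrow>\<^sub>M path_sigma \<kappa> s T T"
    using le by (intro stop_measurable) auto
  have "(\<lambda>p. (fst p, stop s ?t T (snd p))) \<in> \<F> s \<Otimes>\<^sub>M ?P \<rightarrow>\<^sub>M \<F> s \<Otimes>\<^sub>M path_sigma \<kappa> s T T"
    using measurable_compose[OF measurable_snd st] by (intro measurable_Pair) auto
  from measurable_compose[OF measurable_compose[OF this paste_measurable[OF le(1,4,4) order_refl]] \<psi>'(2)]
  have f: "(\<lambda>(\<omega>, x). ?f \<omega> x) \<in> borel_measurable (\<F> s \<Otimes>\<^sub>M ?P)"
    by (simp add: case_prod_beta)
  have h: "(\<lambda>(\<omega>, x). indicator A \<omega> * ?f \<omega> x) \<in> borel_measurable (\<F> s \<Otimes>\<^sub>M ?P)"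
    unfolding case_prod_beta
    by (intro borel_measurable_times measurable_compose[OF measurable_fst borel_measurable_indicator[OF A]]
        f[unfolded case_prod_beta])
  have hC: "\<bar>indicator A \<omega> * ?f \<omega> x\<bar> \<le> C" if "\<omega> \<in> \<Omega>" "x \<in> path_space \<kappa> s ?t" for \<omega> x
    using C[OF ps[OF that]] C0 by (simp add: indicator_def)
  have AQ: "A \<in> sets Q"
    using A sub by (auto simp: subalgebra_def)
  have "(\<integral>\<omega>. indicator A \<omega> * \<psi> \<omega> \<partial>Q) = (\<integral>\<omega>. indicator A \<omega> * ?f \<omega> (?X \<omega>) \<partial>Q)"
  proof (rule Bochner_Integration.integral_cong)
    fix \<omega> assume "\<omega> \<in> space Q"
    then have \<omega>: "\<omega> \<in> \<Omega>"
      by (simp add: spQ)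
    have R: "restrict \<omega> {s..T} \<in> path_space \<kappa> s T"
      using \<omega> le by (intro restrict_in_path_space) auto
    have "?X (restrict \<omega> {s..T}) = ?X \<omega>"
      using le by (auto simp: restrict_def fun_eq_iff)
    then have "?f \<omega> (?X \<omega>) = \<psi> \<omega>"
      using restrict_local[OF \<psi>'(1) le(1-3) \<omega> R] paste_self[OF \<omega> le(1,4)] by simp
    then show "indicator A \<omega> * \<psi> \<omega> = indicator A \<omega> * ?f \<omega> (?X \<omega>)"
      by simp
  qed simp
  also have "\<dots> = (\<integral>\<omega>. \<integral>x. indicator A \<omega> * ?f \<omega> x \<partial>\<rho> \<omega> \<partial>Q)"
    by (rule \<rho>_int[OF h hC, symmetric])
  also have "\<dots> = (\<integral>\<omega>. indicator A \<omega> * step_op i s \<psi> \<omega> \<partial>Q)"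
  proof (rule integral_cong_AE)
    show "(\<lambda>\<omega>. \<integral>x. indicator A \<omega> * ?f \<omega> x \<partial>\<rho> \<omega>) \<in> borel_measurable Q"
      by (rule measurable_from_subalg[OF sub kernel_integral_measurable[OF h \<rho>]])
    have "step_op i s \<psi> \<in> borel_measurable (\<F> s)"
      using step_operator_in[OF i(1,2) le(6) bounded_path_functions_mono[OF le(3) \<psi>]] bounded_path_functionsD(1) le(4) by blast
    then show "(\<lambda>\<omega>. indicator A \<omega> * step_op i s \<psi> \<omega>) \<in> borel_measurable Q"
      by (intro borel_measurable_times borel_measurable_indicator AQ measurable_from_subalg[OF sub])
    show "AE \<omega> in Q. (\<integral>x. indicator A \<omega> * ?f \<omega> x \<partial>\<rho> \<omega>) = indicator A \<omega> * step_op i s \<psi> \<omega>"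
      using AE AE_space
    proof eventually_elim
      case (elim \<omega>)
      then have \<omega>: "\<omega> \<in> \<Omega>"
        by (simp add: spQ)
      note \<theta> = current_in[OF i(1) \<omega>]
      let ?L = "law (current i \<omega>) s T (\<omega> s)"
      have L: "sets ?L = sets (path_sigma \<kappa> s T T)" "space ?L = path_space \<kappa> s T"
        using step_law_prob(2,3)[OF i(1,2) le(6) \<omega>] by (auto simp: step_law_def)
      have f\<omega>: "?f \<omega> \<in> borel_measurable ?P"
        using measurable_compose[OF measurable_Pair1'[of \<omega> "\<F> s" ?P] f] \<omega> by simp
      have "?X \<in> path_sigma \<kappa> s T T \<rightarrow>\<^sub>M ?P"
        using le by (intro restrict_path_measurable) auto
      then have XL: "?X \<in> ?L \<rightarrow>\<^sub>M ?P"
        by (simp add: L(1) cong: measurable_cong_sets)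
      have "(\<integral>x. ?f \<omega> x \<partial>\<rho> \<omega>) = (\<integral>x. ?f \<omega> x \<partial>distr ?L ?P ?X)"
        using elim(1) restrict_law[OF \<theta> le(5) i(3) le(3)] by simp
      also have "\<dots> = (\<integral>x. ?f \<omega> (?X x) \<partial>?L)"
        by (rule integral_distr[OF XL f\<omega>])
      also have "\<dots> = (\<integral>x. \<psi> (paste r s T \<omega> x) \<partial>?L)"
        using restrict_local[OF \<psi>'(1) le(1-3) \<omega>] L(2) by (intro Bochner_Integration.integral_cong) auto
      also have "\<dots> = step_op i s \<psi> \<omega>"
        unfolding step_operator_integral[OF i(1) \<omega>] step_law_def ..
      finally show ?case
        by simp
    qed
  qed
  finally show ?thesis .
qed

lemma from_step_conditional:
  assumes Q: "prob_space Q" "sets Q = sets (\<F> T)" and c: "\<And>k. k \<in> I \<Longrightarrow> centered Q \<F> (W k) r T"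
    and i: "i \<le> N" and \<psi>: "\<psi> \<in> bounded_path_functions \<kappa> r T T" and A: "A \<in> sets (\<F> (\<tau> i))"
  shows "(\<integral>\<omega>. indicator A \<omega> * \<psi> \<omega> \<partial>Q) = (\<integral>\<omega>. indicator A \<omega> * from_step i \<psi> \<omega> \<partial>Q)"
  using i A
proof (induction rule: inc_induct)
  case base
  then show ?case by (simp add: from_step_last)
next
  case (step i)
  have "A \<in> sets (\<F> (\<tau> (Suc i)))"
    using path_sigma_mono[OF less_imp_le[OF times_less] step.prems] step.hyps by simp
  then have "(\<integral>\<omega>. indicator A \<omega> * \<psi> \<omega> \<partial>Q) = (\<integral>\<omega>. indicator A \<omega> * from_step (Suc i) \<psi> \<omega> \<partial>Q)"
    by (rule step.IH)
  also have "\<dots> = (\<integral>\<omega>. indicator A \<omega> * step_op i (\<tau> i) (from_step (Suc i) \<psi>) \<omega> \<partial>Q)"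
    using step.hyps times_less[of i] step.prems
    by (intro step_operator_conditional[OF Q c] from_step_in[OF _ \<psi>]) auto
  finally show ?case
    using step.hyps by (simp add: from_step_less)
qed

lemma chain_conditional:
  assumes Q: "prob_space Q" "sets Q = sets (\<F> T)" and c: "\<And>k. k \<in> I \<Longrightarrow> centered Q \<F> (W k) r T"
    and s: "r \<le> s" "s \<le> T" and \<psi>: "\<psi> \<in> bounded_path_functions \<kappa> r T T" and A: "A \<in> sets (\<F> s)"
  shows "(\<integral>\<omega>. indicator A \<omega> * \<psi> \<omega> \<partial>Q) = (\<integral>\<omega>. indicator A \<omega> * chain s \<psi> \<omega> \<partial>Q)"
proof (cases "s = T")
  case True
  then show ?thesis
    using chain_last[OF \<psi>] by simp
next
  case False
  then obtain i where i: "i < N" "\<tau> i \<le> s" "s < \<tau> (Suc i)"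
    using step_of_time[of s] s by auto
  have "A \<in> sets (\<F> (\<tau> (Suc i)))"
    using path_sigma_mono[OF less_imp_le[OF i(3)] A] .
  then have "(\<integral>\<omega>. indicator A \<omega> * \<psi> \<omega> \<partial>Q) = (\<integral>\<omega>. indicator A \<omega> * from_step (Suc i) \<psi> \<omega> \<partial>Q)"
    using i by (intro from_step_conditional[OF Q c _ \<psi>]) auto
  also have "\<dots> = (\<integral>\<omega>. indicator A \<omega> * step_op i s (from_step (Suc i) \<psi>) \<omega> \<partial>Q)"
    using i by (intro step_operator_conditional[OF Q c i _ A] from_step_in[OF _ \<psi>]) auto
  finally show ?thesis
    by (simp add: chain_step[OF i \<psi>])
qed

lemma chain_cond_exp:
  assumes Q: "mp_solution \<kappa> r T I (\<lambda>k. W k r) y Q"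
    and s: "r \<le> s" "s \<le> T" and \<psi>: "\<psi> \<in> bounded_path_functions \<kappa> r T T"
  shows "AE \<omega> in Q. real_cond_exp Q (\<F> s) \<psi> \<omega> = chain s \<psi> \<omega>"
proof -
  have Q': "prob_space Q" "sets Q = sets (\<F> T)" "\<And>k. k \<in> I \<Longrightarrow> centered Q \<F> (W k) r T"
    using Q unfolding switched_solution_iff by auto
  interpret prob_space Q by fact
  have sub: "subalgebra Q (\<F> s)"
    by (rule subalgebra_path_measure[OF Q'(2) s(2)])
  interpret finite_measure_subalgebra Q "\<F> s"
    by unfold_locales (rule sub)
  have int: "integrable Q \<phi>" if \<phi>: "\<phi> \<in> bounded_path_functions \<kappa> r T T" for \<phi>
  proof -
    obtain C where C: "\<And>\<omega>. \<omega> \<in> \<Omega> \<Longrightarrow> \<bar>\<phi> \<omega>\<bar> \<le> C"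
      using bounded_path_functionsD(4)[OF \<phi> order_refl] by auto
    have "\<phi> \<in> borel_measurable Q"
      using bounded_path_functionsD(1)[OF \<phi> order_refl] Q'(2) by (simp cong: measurable_cong_sets)
    then show ?thesis
      using C by (intro integrable_bounded[OF Q'(1)]) (auto simp: space_path_measure[OF Q'(2)])
  qed
  have ch: "chain s \<psi> \<in> bounded_path_functions \<kappa> r T s"
    by (rule chain_in[OF s \<psi>])
  show ?thesis
  proof (rule real_cond_exp_charact)
    show "integrable Q \<psi>" "integrable Q (chain s \<psi>)"
      using int \<psi> bounded_path_functions_mono[OF s(2) ch] by auto
    show "chain s \<psi> \<in> borel_measurable (\<F> s)"
      by (rule bounded_path_functionsD(1)[OF ch s(2)])
    fix A assume "A \<in> sets (\<F> s)"
    then show "(\<integral>\<omega>\<in>A. \<psi> \<omega> \<partial>Q) = (\<integral>\<omega>\<in>A. chain s \<psi> \<omega> \<partial>Q)"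
      using chain_conditional[OF Q' s \<psi>] by (simp add: set_lebesgue_integral_def)
  qed
qed

text \<open>At the initial time the conditional expectation is a function of the starting point, so it may be
  evaluated at the constant path.\<close>

lemma switched_solution_measure:
  assumes Q: "mp_solution \<kappa> r T I (\<lambda>k. W k r) y Q" and B: "B \<in> sets (\<F> T)"
  shows "measure Q B = chain r (restrict (indicator B) \<Omega>) (const_path r T y)"
proof -
  have Q': "prob_space Q" "sets Q = sets (\<F> T)" "AE \<omega> in Q. \<omega> r = y" "\<And>k. k \<in> I \<Longrightarrow> centered Q \<F> (W k) r T"
    using Q unfolding switched_solution_iff by auto
  interpret prob_space Q by fact
  note spQ = space_path_measure[OF Q'(2)]
  let ?\<psi> = "restrict (indicator B) \<Omega> :: 'n path \<Rightarrow> real"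
  have "?\<psi> \<in> borel_measurable (\<F> T) \<longleftrightarrow> (indicator B :: _ \<Rightarrow> real) \<in> borel_measurable (\<F> T)"
    by (rule measurable_cong) simp
  then have \<psi>: "?\<psi> \<in> bounded_path_functions \<kappa> r T T"
    using B by (auto simp: bounded_path_functions_def indicator_def intro!: exI[of _ 1])
  have rT': "r \<le> T" "r \<le> r"
    using rT by auto
  have ch: "chain r ?\<psi> \<in> borel_measurable (\<F> r)"
    by (rule bounded_path_functionsD(1)[OF chain_in[OF rT'(2,1) \<psi>] rT'(1)])
  have "measure Q B = (\<integral>\<omega>. indicator B \<omega> \<partial>Q)"
    using sets.sets_into_space[OF B] by (simp add: spQ Int_absorb2)
  also have "\<dots> = (\<integral>\<omega>. indicator \<Omega> \<omega> * ?\<psi> \<omega> \<partial>Q)"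
    by (intro Bochner_Integration.integral_cong) (auto simp: spQ)
  also have "\<dots> = (\<integral>\<omega>. indicator \<Omega> \<omega> * chain r ?\<psi> \<omega> \<partial>Q)"
    using sets.top[of "\<F> r"] by (intro chain_conditional[OF Q'(1,2,4) rT'(2,1) \<psi>]) simp_all
  also have "\<dots> = (\<integral>\<omega>. chain r ?\<psi> (const_path r T y) \<partial>Q)"
  proof (rule integral_cong_AE)
    have chQ: "chain r ?\<psi> \<in> borel_measurable Q"
      by (rule measurable_from_subalg[OF subalgebra_path_measure[OF Q'(2) rT'(1)] ch])
    have "\<Omega> \<in> sets Q"
      using sets.top[of Q] by (simp add: spQ)
    with chQ show "(\<lambda>\<omega>. indicator \<Omega> \<omega> * chain r ?\<psi> \<omega>) \<in> borel_measurable Q"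
      by (intro borel_measurable_times borel_measurable_indicator)
    show "AE \<omega> in Q. indicator \<Omega> \<omega> * chain r ?\<psi> \<omega> = chain r ?\<psi> (const_path r T y)"
      using Q'(3) AE_space
    proof eventually_elim
      case (elim \<omega>)
      have "chain r ?\<psi> \<omega> = chain r ?\<psi> (const_path r T y)"
        using elim rT by (intro path_sigma_measurable_local[OF ch] const_path_in_path_space)
          (auto simp: spQ const_path_def)
      then show ?case
        using elim by (simp add: spQ)
    qed
  qed simp
  finally show ?thesis
    using prob_space by simp
qed

lemma switched_solution_ex1: "\<exists>!Q. mp_solution \<kappa> r T I (\<lambda>k. W k r) y Q"
proof (rule ex_ex1I)
  show "\<exists>Q. mp_solution \<kappa> r T I (\<lambda>k. W k r) y Q"
    by (rule switched_solution_exists)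
  fix Q Q' assume Q: "mp_solution \<kappa> r T I (\<lambda>k. W k r) y Q" "mp_solution \<kappa> r T I (\<lambda>k. W k r) y Q'"
  then have s: "prob_space Q" "prob_space Q'" "sets Q = sets (\<F> T)" "sets Q' = sets (\<F> T)"
    by (auto simp: switched_solution_iff)
  show "Q = Q'"
  proof (rule measure_eqI)
    fix B assume "B \<in> sets Q"
    then have "measure Q B = measure Q' B"
      using switched_solution_measure[OF Q(1)] switched_solution_measure[OF Q(2)] s(3) by simp
    then show "emeasure Q B = emeasure Q' B"
      using s(1,2) by (simp add: finite_measure.emeasure_eq_measure prob_space.finite_measure)
  qed (simp add: s)
qed

end

theorem theorem3p13:
  fixes \<kappa> :: path_kind and T r :: real
    and \<Theta> :: "('n::finite, 'e::topological_space) control set"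
    and I :: "'k set"
    and Z :: "('n, 'e) control \<Rightarrow> ('k, 'n) mp"
  assumes "0 \<le> r" "r < T"
    and "theta_hypothesis \<kappa> T \<Theta> I Z"
    and "\<forall>\<theta>\<in>\<Theta>. countably_determined \<kappa> T I (Z \<theta>)"
  shows "\<forall>\<gamma>\<in>piecewise_controls \<kappa> T \<Theta> r. \<forall>R. represents \<kappa> T \<Theta> r R \<gamma> \<longrightarrow>
    (\<forall>y. \<exists>!Q. mp_solution \<kappa> r T I (\<lambda>k. switched_mp Z R k r) y Q) \<and>
    (\<forall>i<steps R. \<forall>s\<in>{times R i..<times R (Suc i)}.
      \<forall>\<psi>\<in>bounded_path_functions \<kappa> r T (times R (Suc i)).
        step_operator \<kappa> T I Z r R i s \<psi> \<in> borel_measurable (path_sigma \<kappa> r T s)) \<and>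
    (\<exists>!E. chain_extension \<kappa> T I Z r R E) \<and>
    (\<forall>E. chain_extension \<kappa> T I Z r R E \<longrightarrow>
      (\<forall>s\<in>{r..T}. \<forall>\<psi>\<in>bounded_path_functions \<kappa> r T T.
        E s \<psi> \<in> borel_measurable (path_sigma \<kappa> r T s) \<and>
        (\<forall>y. let Q = mp_law \<kappa> r T I (\<lambda>k. switched_mp Z R k r) y in
          AE \<omega> in Q. real_cond_exp Q (path_sigma \<kappa> r T s) \<psi> \<omega> = E s \<psi> \<omega>)))"
proof (intro ballI allI impI)
  fix \<gamma> R assume "represents \<kappa> T \<Theta> r R \<gamma>"
  then interpret switched_mp_problem \<kappa> T \<Theta> I Z r R
    using assms by unfold_locales (auto simp: represents_def)
  have 1: "\<forall>y. \<exists>!Q. mp_solution \<kappa> r T I (\<lambda>k. switched_mp Z R k r) y Q"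
    using switched_solution_ex1 by blast
  have 2: "step_operator \<kappa> T I Z r R i s \<psi> \<in> borel_measurable (path_sigma \<kappa> r T s)"
    if i: "i < steps R" "s \<in> {times R i..<times R (Suc i)}" and \<psi>: "\<psi> \<in> bounded_path_functions \<kappa> r T (times R (Suc i))" for i s \<psi>
  proof -
    have s: "\<tau> i \<le> s" "s < T" "\<tau> (Suc i) \<le> T"
      using i times_le[of "Suc i"] by auto
    show ?thesis
      using bounded_path_functionsD(1)[OF step_operator_in[OF i(1) s(1,2) bounded_path_functions_mono[OF s(3) \<psi>]]] s by simp
  qed
  have 3: "\<exists>!E. chain_extension \<kappa> T I Z r R E"
    using chain_extension_chain chain_extension_unique by blast
  have 4: "E s \<psi> \<in> borel_measurable (path_sigma \<kappa> r T s) \<and>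
        (\<forall>y. let Q = mp_law \<kappa> r T I (\<lambda>k. switched_mp Z R k r) y in
          AE \<omega> in Q. real_cond_exp Q (path_sigma \<kappa> r T s) \<psi> \<omega> = E s \<psi> \<omega>)"
    if E: "chain_extension \<kappa> T I Z r R E" and s: "s \<in> {r..T}" and \<psi>: "\<psi> \<in> bounded_path_functions \<kappa> r T T" for E s \<psi>
  proof -
    have s': "r \<le> s" "s \<le> T"
      using s by auto
    have "AE \<omega> in mp_law \<kappa> r T I (\<lambda>k. W k r) y.
        real_cond_exp (mp_law \<kappa> r T I (\<lambda>k. W k r) y) (\<F> s) \<psi> \<omega> = chain s \<psi> \<omega>" for y
    proof (rule chain_cond_exp[OF _ s' \<psi>])
      show "mp_solution \<kappa> r T I (\<lambda>k. W k r) y (mp_law \<kappa> r T I (\<lambda>k. W k r) y)"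
        unfolding mp_law_def by (rule theI'[OF switched_solution_ex1])
    qed
    then show ?thesis
      using bounded_path_functionsD(1)[OF chain_in[OF s' \<psi>] s'(2)]
      unfolding chain_extension_unique[OF E] Let_def by blast
  qed
  from 1 2 3 4 show "(\<forall>y. \<exists>!Q. mp_solution \<kappa> r T I (\<lambda>k. switched_mp Z R k r) y Q) \<and>
    (\<forall>i<steps R. \<forall>s\<in>{times R i..<times R (Suc i)}.
      \<forall>\<psi>\<in>bounded_path_functions \<kappa> r T (times R (Suc i)).
        step_operator \<kappa> T I Z r R i s \<psi> \<in> borel_measurable (path_sigma \<kappa> r T s)) \<and>
    (\<exists>!E. chain_extension \<kappa> T I Z r R E) \<and>
    (\<forall>E. chain_extension \<kappa> T I Z r R E \<longrightarrow>
      (\<forall>s\<in>{r..T}. \<forall>\<psi>\<in>bounded_path_functions \<kappa> r T T.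
        E s \<psi> \<in> borel_measurable (path_sigma \<kappa> r T s) \<and>
        (\<forall>y. let Q = mp_law \<kappa> r T I (\<lambda>k. switched_mp Z R k r) y in
          AE \<omega> in Q. real_cond_exp Q (path_sigma \<kappa> r T s) \<psi> \<omega> = E s \<psi> \<omega>)))"
    by blast
qed

end
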